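(* The functional $E_1$ attains its infimum in $\mathcal{A}_1(\ell)$ for every $\ell \in \mathbb{Z}$.
   Context: $\mathbb{S}^1 \subset \mathbb{R}^2$ is the unit circle. For $m = (m_1,m_2) \in H^1_{\mathrm{loc}}(\mathbb{R};\mathbb{S}^1)$ define $$E_1(m) = \frac12\left(\|m'\|_{L^2(\mathbb{R})}^2 + \|m_1-1\|_{\dot H^{1/2}(\mathbb{R})}^2 + \|m_1-1\|_{L^2(\mathbb{R})}^2\right) \in [0,\infty], \qquad \|f\|_{\dot H^{1/2}(\mathbb{R})}^2 = \frac{1}{2\pi}\int_{\mathbb{R}}\int_{\mathbb{R}} \frac{|f(s)-f(t)|^2}{|s-t|^2}\,ds\,dt.$$ Every $m \in H^1_{\mathrm{loc}}(\mathbb{R};\mathbb{S}^1)$ is continuous and has a continuous lifting $\phi\colon\mathbb{R}\to\mathbb{R}$ with $m = (\cos\phi,\sin\phi)$, unique up to a constant. If $E_1(m)<\infty$, then $m(x_1)\to(1,0)$ as $x_1\to\pm\infty$, and the winding number $\deg(m) = \frac{1}{2\pi}\lim_{x_1\to\infty}(\phi(x_1)-\phi(-x_1))$ is well-defined and belongs to $\mathbb{Z}$. For $\ell\in\mathbb{Z}$, $$\mathcal{A}_1(\ell) = \{m\in H^1_{\mathrm{loc}}(\mathbb{R};\mathbb{S}^1) : E_1(m)<\infty,\ \deg(m)=\ell\}.$$ "$E_1$ attains its infimum in $\mathcal{A}_1(\ell)$" means that there is $m\in\mathcal{A}_1(\ell)$ with $E_1(m) = \inf_{\mathcal{A}_1(\ell)}E_1$.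 *)

theory Defs
  imports "HOL-Analysis.Analysis"
begin

definition test_function :: "(real \<Rightarrow> real) \<Rightarrow> bool" where
  "test_function \<phi> \<longleftrightarrow>
     (\<forall>k x. ((deriv ^^ k) \<phi>) differentiable (at x)) \<and> compact (closure {x. \<phi> x \<noteq> 0})"

definition L1_loc :: "(real \<Rightarrow> 'a::euclidean_space) set" where
  "L1_loc = {f \<in> borel_measurable lborel. \<forall>K. compact K \<longrightarrow> set_integrable lborel K f}"

definition L2_loc :: "(real \<Rightarrow> 'a::euclidean_space) set" where
  "L2_loc = {f \<in> borel_measurable lborel.
     \<forall>K. compact K \<longrightarrow> set_integrable lborel K (\<lambda>x. (norm (f x))\<^sup>2)}"

definition has_weak_deriv :: "(real \<Rightarrow> 'a::euclidean_space) \<Rightarrow> (real \<Rightarrow> 'a) \<Rightarrow> bool" where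
  "has_weak_deriv f g \<longleftrightarrow> f \<in> L1_loc \<and> g \<in> L1_loc \<and>
     (\<forall>\<phi>. test_function \<phi> \<longrightarrow>
        (LINT x|lborel. deriv \<phi> x *\<^sub>R f x) = - (LINT x|lborel. \<phi> x *\<^sub>R g x))"

text \<open>The weak derivative is unique only up to null sets; an arbitrary version is picked.\<close>

definition weak_deriv :: "(real \<Rightarrow> 'a::euclidean_space) \<Rightarrow> real \<Rightarrow> 'a" where
  "weak_deriv f = (SOME g. has_weak_deriv f g)"

definition H1_loc :: "(real \<Rightarrow> 'a::euclidean_space) set" where
  "H1_loc = {f \<in> L2_loc. \<exists>g \<in> L2_loc. has_weak_deriv f g}"

text \<open>
  Sobolev functions on the line are equivalence classes modulo null sets, each of which has
  exactly one continuous member. The elements of the following set are these continuous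
  representatives, so that the constraint and the lifting make sense pointwise.
\<close>

definition H1_loc_circle :: "(real \<Rightarrow> real^2) set" where
  "H1_loc_circle = {m \<in> H1_loc. continuous_on UNIV m \<and> (\<forall>x. m x \<in> sphere 0 1)}"

definition L2_norm_sq :: "(real \<Rightarrow> 'a::euclidean_space) \<Rightarrow> ennreal" where
  "L2_norm_sq f = (\<integral>\<^sup>+x. ennreal ((norm (f x))\<^sup>2) \<partial>lborel)"

text \<open>The squared homogeneous Sobolev seminorm of order 1/2.\<close>

definition Hdot_half_sq :: "(real \<Rightarrow> real) \<Rightarrow> ennreal" where
  "Hdot_half_sq f = ennreal (1 / (2 * pi)) *
     (\<integral>\<^sup>+t. (\<integral>\<^sup>+s. ennreal (\<bar>f s - f t\<bar>\<^sup>2 / \<bar>s - t\<bar>\<^sup>2) \<partial>lborel) \<partial>lborel)"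

definition E1 :: "(real \<Rightarrow> real^2) \<Rightarrow> ennreal" where
  "E1 m = (L2_norm_sq (weak_deriv m) + Hdot_half_sq (\<lambda>x. m x $ 1 - 1)
            + L2_norm_sq (\<lambda>x. m x $ 1 - 1)) / 2"

definition is_lifting :: "(real \<Rightarrow> real^2) \<Rightarrow> (real \<Rightarrow> real) \<Rightarrow> bool" where
  "is_lifting m \<phi> \<longleftrightarrow> continuous_on UNIV \<phi> \<and> (\<forall>x. m x = vector [cos (\<phi> x), sin (\<phi> x)])"

text \<open>
  The choice of lifting is immaterial, as liftings differ by constants. The value is meaningful
  when the limit exists, in particular for circle-valued maps of finite energy.
\<close>

definition winding_deg :: "(real \<Rightarrow> real^2) \<Rightarrow> real" where
  "winding_deg m = (let \<phi> = (SOME \<phi>. is_lifting m \<phi>)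
                    in 1 / (2 * pi) * Lim at_top (\<lambda>x. \<phi> x - \<phi> (- x)))"

definition A1 :: "int \<Rightarrow> (real \<Rightarrow> real^2) set" where
  "A1 l = {m \<in> H1_loc_circle. E1 m < \<infinity> \<and> winding_deg m = real_of_int l}"

end

theory Submission
  imports Defs "HOL-Complex_Analysis.Great_Picard" "HOL-Real_Asymp.Real_Asymp"
begin

text \<open>
  Write \<open>m = (cos \<phi>, sin \<phi>)\<close> and \<open>u = 1 - m\<^sub>1 \<in> [0, 2]\<close>. All of \<open>E\<^sub>1\<close> is determined by \<open>u\<close>: the angle
  \<open>\<theta> = 2 arcsin (sqrt (u / 2))\<close> is \<open>\<phi>\<close> folded into \<open>[0, \<pi>]\<close>, so that \<open>\<bar>\<theta>'\<bar> = \<bar>m'\<bar>\<close>. Degree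
  \<open>\<plusminus>(k + 1)\<close> forces \<open>u\<close> to take the values \<open>2, 0, 2, \<dots>, 0, 2\<close> at some points
  \<open>z\<^sub>0 < \<dots> < z\<^bsub>2k\<^esub>\<close>, and conversely such a \<open>u\<close> can be unfolded, by reflecting \<open>\<theta>\<close> at the \<open>z\<^sub>j\<close>,
  to a map of that degree with the same energy. The set of these \<open>u\<close> is closed under local uniform
  convergence as long as the \<open>z\<^sub>j\<close> stay bounded, so the only loss of compactness is that two
  consecutive peaks drift apart. But positive bumps attract each other in the \<open>H\<^sup>1\<^sup>/\<^sup>2\<close> seminorm: when two
  peaks are at distance \<open>8 r\<close> with \<open>r\<close> large, cutting \<open>u\<close> to zero between them and deleting an interval of
  length \<open>r\<close> there lowers the energy. Hence a minimising sequence may be assumed to have bounded gaps.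
\<close>

text \<open>The difficulty is quantitative. Between two distant peaks nothing is known about
  \<open>u\<close> beyond the energy bound, so there is no decay rate by which the cost of cutting
  could be shown to be small. Two devices get around this. First, the mass \<open>X\<close> removed
  by the cut may be large, but its removal lowers the L2 term by at least a multiple of
  \<open>X^2 / r\<close>, and this quadratic saving absorbs all errors that involve
  \<open>X\<close>. The cut-off angle is the square of a linear ramp so that these errors and the
  saving are measured with the same weight. Second, what is left of the cost depends only on the
  profile that survives the cut, and the gain from moving its two halves together is a functional of
  the same profile; both are compared with one and the same moment of it. The zero required between
  two peaks comes for free, since the cut creates one. For maps and profiles two inequalities are
  combined: a map has at least the energy of its profile, and an unfolded profile yields a map of at
  most its own energy. Degree zero, where no peak is forced, is settled by the constant map.\<close>

section \<open>Difference quotients and primitives of square-integrable functions\<close>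

text \<open>Along the dyadic steps \<open>2\<^sup>-\<^sup>n\<close> these energies increase to the Dirichlet integral. Using their supremum in
  its place makes lower semicontinuity immediate and reduces chain rules to inequalities between increments.\<close>

definition dq :: "(real \<Rightarrow> real) \<Rightarrow> nat \<Rightarrow> ennreal" where
  "dq f n = (\<integral>\<^sup>+x. ennreal ((2^n * (f (x + 1/2^n) - f x))\<^sup>2) \<partial>lborel)"

text \<open>Local absolute continuity of \<open>f\<close> with derivative \<open>g\<close> in L2.
  Interval integrals in place of pointwise derivatives allow primitives to be split, reflected and
  assembled without exceptional null sets.\<close>

definition l2_primitive :: "(real \<Rightarrow> real) \<Rightarrow> (real \<Rightarrow> real) \<Rightarrow> bool" where
  "l2_primitive f g \<longleftrightarrow> g \<in> borel_measurable lborel \<and> integrable lborel (\<lambda>x. (g x)\<^sup>2) \<and>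
     (\<forall>a b. a \<le> b \<longrightarrow> f b - f a = (LINT x:{a..b}|lborel. g x))"

lemma nn_integral_lborel_translate:
  fixes f :: "real \<Rightarrow> ennreal"
  assumes [measurable]: "f \<in> borel_measurable borel"
  shows "(\<integral>\<^sup>+x. f (x + a) \<partial>lborel) = (\<integral>\<^sup>+x. f x \<partial>lborel)"
  using nn_integral_real_affine[of f 1 a] by (simp add: add.commute)

text \<open>The quotient with step \<open>2 * h\<close> at \<open>x\<close> is the mean of the
  quotients with step \<open>h\<close> at \<open>x\<close> and at \<open>x + h\<close>; convexity of
  the square and translation invariance of the integral do the rest. Halving the step makes this
  exact, hence the dyadic steps.\<close>

lemma dq_le_Suc:
  assumes [measurable]: "f \<in> borel_measurable borel"
  shows "dq f n \<le> dq f (Suc n)"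
proof -
  define h :: real where "h = 1 / 2^Suc n"
  have h2: "1 / 2^n = h + h" by (simp add: h_def)
  define d where "d = (\<lambda>x. 2^Suc n * (f (x + h) - f x))"
  have [measurable]: "d \<in> borel_measurable borel" unfolding d_def by measurable
  have "dq f n \<le> (\<integral>\<^sup>+x. ennreal (1/2) * ennreal ((d x)\<^sup>2) + ennreal (1/2) * ennreal ((d (x + h))\<^sup>2) \<partial>lborel)"
    unfolding dq_def
  proof (rule nn_integral_mono)
    fix x
    have "2^n * (f (x + 1/2^n) - f x) = (d x + d (x + h)) / 2"
      unfolding d_def h2 by (simp add: algebra_simps)
    then have "(2^n * (f (x + 1/2^n) - f x))\<^sup>2 = ((d x + d (x + h)) / 2)\<^sup>2" by (simp only:)
    also have "\<dots> \<le> 1/2 * (d x)\<^sup>2 + 1/2 * (d (x + h))\<^sup>2"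
      using zero_le_power2[of "d x - d (x + h)"] by (simp add: power2_eq_square field_simps)
    finally have "ennreal ((2^n * (f (x + 1/2^n) - f x))\<^sup>2) \<le> ennreal (1/2 * (d x)\<^sup>2 + 1/2 * (d (x + h))\<^sup>2)"
      by (rule ennreal_leI)
    also have "\<dots> = ennreal (1/2) * ennreal ((d x)\<^sup>2) + ennreal (1/2) * ennreal ((d (x + h))\<^sup>2)"
      by (subst ennreal_plus, simp, simp, subst (1 2) ennreal_mult) simp_all
    finally show "ennreal ((2^n * (f (x + 1/2^n) - f x))\<^sup>2)
        \<le> ennreal (1/2) * ennreal ((d x)\<^sup>2) + ennreal (1/2) * ennreal ((d (x + h))\<^sup>2)" .
  qed
  also have "\<dots> = ennreal (1/2) * (\<integral>\<^sup>+x. ennreal ((d x)\<^sup>2) \<partial>lborel)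
      + ennreal (1/2) * (\<integral>\<^sup>+x. ennreal ((d (x + h))\<^sup>2) \<partial>lborel)"
    by (simp add: nn_integral_add nn_integral_cmult)
  also have "(\<integral>\<^sup>+x. ennreal ((d (x + h))\<^sup>2) \<partial>lborel) = (\<integral>\<^sup>+x. ennreal ((d x)\<^sup>2) \<partial>lborel)"
    by (rule nn_integral_lborel_translate) measurable
  also have "ennreal (1/2) * (\<integral>\<^sup>+x. ennreal ((d x)\<^sup>2) \<partial>lborel) + ennreal (1/2) * (\<integral>\<^sup>+x. ennreal ((d x)\<^sup>2) \<partial>lborel)
     = (ennreal (1/2) + ennreal (1/2)) * (\<integral>\<^sup>+x. ennreal ((d x)\<^sup>2) \<partial>lborel)"
    by (simp only: distrib_right)
  also have "ennreal (1/2) + ennreal (1/2) = 1"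
    by (subst ennreal_plus[symmetric]) auto
  finally show ?thesis by (simp add: dq_def d_def h_def)
qed

lemma dq_add:
  assumes [measurable]: "f \<in> borel_measurable borel" "f' \<in> borel_measurable borel"
  shows "dq f n + dq f' n = (\<integral>\<^sup>+x. ennreal ((2^n)\<^sup>2 * ((f (x + 1/2^n) - f x)\<^sup>2 + (f' (x + 1/2^n) - f' x)\<^sup>2)) \<partial>lborel)"
  unfolding dq_def by (subst nn_integral_add[symmetric]) (auto simp: power_mult_distrib distrib_left)

lemma incseq_dq: "f \<in> borel_measurable borel \<Longrightarrow> incseq (dq f)"
  by (simp add: incseq_Suc_iff dq_le_Suc)

lemma integrable_set_of_square:
  fixes g :: "real \<Rightarrow> real"
  assumes [measurable]: "g \<in> borel_measurable lborel" and g2: "set_integrable lborel {a..b} (\<lambda>x. (g x)\<^sup>2)"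
  shows "set_integrable lborel {a..b} g"
proof -
  have 1: "set_integrable lborel {a..b} (\<lambda>x. 1 + (g x)\<^sup>2)"
    by (rule set_integral_add(1)[OF _ g2]) (rule borel_integrable_atLeastAtMost', auto)
  have m: "set_borel_measurable lborel {a..b} g"
    unfolding set_borel_measurable_def by measurable
  have "\<bar>y\<bar> \<le> 1 + y\<^sup>2" for y :: real
    using zero_le_power2[of "\<bar>y\<bar> - 1"] by (simp add: power2_eq_square algebra_simps)
  then show ?thesis
    by (intro set_integrable_bound[OF 1 m]) (auto intro!: AE_I2)
qed

text \<open>The integral of \<open>(g - c)^2\<close> is nonnegative, and \<open>c\<close> is the
  mean value of \<open>g\<close>, which minimises this integral.\<close>

lemma cauchy_schwarz_interval:
  fixes g :: "real \<Rightarrow> real"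
  assumes ab: "a \<le> b" and [measurable]: "g \<in> borel_measurable lborel"
    and g2: "set_integrable lborel {a..b} (\<lambda>x. (g x)\<^sup>2)"
  shows "(LINT x:{a..b}|lborel. g x)\<^sup>2 \<le> (b - a) * (LINT x:{a..b}|lborel. (g x)\<^sup>2)"
proof (cases "a = b")
  case True
  have "(LINT x:{a..a}|lborel. g x) = 0"
    unfolding set_lebesgue_integral_def
    by (rule integral_eq_zero_AE, rule AE_mp[OF AE_lborel_singleton[of a]]) (auto intro!: AE_I2 simp: indicator_def)
  then show ?thesis using True by simp
next
  case False
  with ab have ab: "a < b" by simp
  note gi = integrable_set_of_square[OF assms(2) g2]
  define I where "I = (LINT x:{a..b}|lborel. g x)"
  define c where "c = I / (b - a)"
  have ci: "set_integrable lborel {a..b} (\<lambda>x. k::real)" for k by (rule borel_integrable_atLeastAtMost') auto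
  have "0 \<le> (LINT x:{a..b}|lborel. (g x - c)\<^sup>2)"
    unfolding set_lebesgue_integral_def by (intro integral_nonneg_AE) auto
  also have "(\<lambda>x. (g x - c)\<^sup>2) = (\<lambda>x. (g x)\<^sup>2 - (2*c*g x - c\<^sup>2))" by (auto simp: power2_eq_square algebra_simps)
  also have "(LINT x:{a..b}|lborel. (g x)\<^sup>2 - (2*c*g x - c\<^sup>2)) =
     (LINT x:{a..b}|lborel. (g x)\<^sup>2) - ((LINT x:{a..b}|lborel. 2*c*g x) - (LINT x:{a..b}|lborel. c\<^sup>2))"
    using g2 gi ci by (subst set_integral_diff(2), simp, force)+ simp
  also have "(LINT x:{a..b}|lborel. 2*c*g x) = 2*c*I" by (simp add: I_def)
  also have "(LINT x:{a..b}|lborel. c\<^sup>2) = (b-a)*c\<^sup>2" using ab by (simp add: set_lebesgue_integral_def)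
  finally have "2*c*I - (b-a)*c\<^sup>2 \<le> (LINT x:{a..b}|lborel. (g x)\<^sup>2)" by simp
  moreover have "(b - a) * c = I" using ab by (simp add: c_def)
  then have "(b - a) * c\<^sup>2 = I * c" by (simp add: power2_eq_square mult.assoc[symmetric])
  then have "2*c*I - (b-a)*c\<^sup>2 = I\<^sup>2 / (b-a)" by (simp add: c_def power2_eq_square)
  ultimately have "I\<^sup>2 / (b - a) \<le> (LINT x:{a..b}|lborel. (g x)\<^sup>2)" by simp
  then show ?thesis using ab by (simp only: I_def[symmetric] pos_divide_le_eq diff_gt_0_iff_gt) (simp add: mult.commute)
qed

text \<open>Cauchy-Schwarz bounds each squared quotient by the mean of \<open>g^2\<close> over
  \<open>{x..x+h}\<close>. After exchanging the integrals every \<open>y\<close> is counted for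
  \<open>x\<close> in an interval of length \<open>h\<close>, which cancels the factor
  \<open>2^n\<close>.\<close>

lemma dq_le_of_primitive:
  assumes "l2_primitive f g"
  shows "dq f n \<le> (\<integral>\<^sup>+x. ennreal ((g x)\<^sup>2) \<partial>lborel)"
proof -
  from assms have [measurable]: "g \<in> borel_measurable borel" and g2: "integrable lborel (\<lambda>x. (g x)\<^sup>2)"
    and fg: "\<And>a b. a \<le> b \<Longrightarrow> f b - f a = (LINT x:{a..b}|lborel. g x)"
    by (auto simp: l2_primitive_def)
  define h :: real where "h = 1/2^n"
  have h: "h > 0" by (simp add: h_def)
  have gs: "set_integrable lborel {a..b} (\<lambda>x. (g x)\<^sup>2)" for a b
    unfolding set_integrable_def using integrable_mult_indicator[OF _ g2, of "{a..b}"] by simp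
  have "dq f n \<le> (\<integral>\<^sup>+x. (\<integral>\<^sup>+y. (if x \<le> y \<and> y \<le> x + h then ennreal (2^n * (g y)\<^sup>2) else 0) \<partial>lborel) \<partial>lborel)"
    unfolding dq_def
  proof (rule nn_integral_mono)
    fix x
    have "(2^n * (f (x + h) - f x))\<^sup>2 = (2^n)\<^sup>2 * (LINT y:{x..x+h}|lborel. g y)\<^sup>2"
      using fg[of x "x+h"] h by (simp add: power_mult_distrib)
    also have "\<dots> \<le> (2^n)\<^sup>2 * ((x + h - x) * (LINT y:{x..x+h}|lborel. (g y)\<^sup>2))"
      using h by (intro mult_left_mono cauchy_schwarz_interval gs) auto
    also have "\<dots> = (LINT y|lborel. 2^n * (indicator {x..x+h} y *\<^sub>R (g y)\<^sup>2))"
      by (simp add: set_lebesgue_integral_def h_def power2_eq_square)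
    finally have "ennreal ((2^n * (f (x + h) - f x))\<^sup>2) \<le> ennreal (LINT y|lborel. 2^n * (indicator {x..x+h} y *\<^sub>R (g y)\<^sup>2))"
      by (rule ennreal_leI)
    also have "\<dots> = (\<integral>\<^sup>+y. ennreal (2^n * (indicator {x..x+h} y *\<^sub>R (g y)\<^sup>2)) \<partial>lborel)"
      using gs[of x "x+h"] unfolding set_integrable_def
      by (intro nn_integral_eq_integral[symmetric] integrable_mult_right) auto
    also have "\<dots> = (\<integral>\<^sup>+y. (if x \<le> y \<and> y \<le> x + h then ennreal (2^n * (g y)\<^sup>2) else 0) \<partial>lborel)"
      by (intro nn_integral_cong) (auto simp: indicator_def)
    finally show "ennreal ((2^n * (f (x + 1/2^n) - f x))\<^sup>2)
      \<le> (\<integral>\<^sup>+y. (if x \<le> y \<and> y \<le> x + h then ennreal (2^n * (g y)\<^sup>2) else 0) \<partial>lborel)"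
      by (simp add: h_def)
  qed
  also have "\<dots> = (\<integral>\<^sup>+y. (\<integral>\<^sup>+x. (if x \<le> y \<and> y \<le> x + h then ennreal (2^n * (g y)\<^sup>2) else 0) \<partial>lborel) \<partial>lborel)"
    by (rule lborel_pair.Fubini'[symmetric]) measurable
  also have "\<dots> = (\<integral>\<^sup>+y. ennreal ((g y)\<^sup>2) \<partial>lborel)"
  proof (rule nn_integral_cong)
    fix y
    have "(\<integral>\<^sup>+x. (if x \<le> y \<and> y \<le> x + h then ennreal (2^n * (g y)\<^sup>2) else 0) \<partial>lborel)
      = (\<integral>\<^sup>+x. ennreal (2^n * (g y)\<^sup>2) * indicator {y-h..y} x \<partial>lborel)"
      by (intro nn_integral_cong) (auto simp: indicator_def)
    also have "\<dots> = ennreal (2^n * (g y)\<^sup>2) * ennreal h"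
      using h by (subst nn_integral_cmult_indicator) auto
    also have "\<dots> = ennreal ((g y)\<^sup>2)"
      by (simp add: ennreal_mult'[symmetric] h_def)
    finally show "(\<integral>\<^sup>+x. (if x \<le> y \<and> y \<le> x + h then ennreal (2^n * (g y)\<^sup>2) else 0) \<partial>lborel) = ennreal ((g y)\<^sup>2)" .
  qed
  finally show ?thesis .
qed

lemma average_tendsto:
  fixes f :: "real \<Rightarrow> real"
  assumes f: "continuous_on UNIV f"
  shows "(\<lambda>n. 2^n * integral {b..b+1/2^n} f) \<longlonglongrightarrow> f b"
proof -
  \<comment> \<open>The base point lies strictly to the left of \<open>b\<close>, so that the
    derivative of \<open>G\<close> at \<open>b\<close> is two-sided.\<close>
  define G where "G x = integral {b-1..x} f" for x
  have c: "continuous_on A f" for A using f continuous_on_subset by blast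
  have "(G has_real_derivative f b) (at b within {b-1..b+1})"
    unfolding G_def by (rule integral_has_real_derivative[OF c]) auto
  then have "DERIV G b :> f b" by (simp add: at_within_Icc_at)
  then have "(\<lambda>h. (G (b + h) - G b) / h) \<midarrow>0\<rightarrow> f b" by (simp add: DERIV_def)
  moreover have "filterlim (\<lambda>n. 1/2^n :: real) (at 0) sequentially"
    unfolding filterlim_at using LIMSEQ_divide_realpow_zero[of 2 1] by auto
  ultimately have "(\<lambda>n. (G (b + 1/2^n) - G b) / (1/2^n)) \<longlonglongrightarrow> f b"
    by (rule filterlim_compose)
  moreover have "(G (b + 1/2^n) - G b) / (1/2^n) = integral {b..b+1/2^n} f * 2^n" for n
    using Henstock_Kurzweil_Integration.integral_combine[of "b-1" b "b+1/2^n" f] integrable_continuous_interval[OF c]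
    by (simp add: G_def)
  ultimately show ?thesis by (simp add: mult.commute)
qed

text \<open>Two copies of \<open>f\<close>, shifted by \<open>h\<close> against each other, cancel
  on the common part of their domains; only averages near the two endpoints survive. With
  \<open>average_tendsto\<close> this leads from quotients back to increments of
  \<open>f\<close>.\<close>

lemma integral_difference_quotient:
  fixes f :: "real \<Rightarrow> real"
  assumes f: "continuous_on UNIV f" and ab: "a \<le> b" and h: "h \<ge> 0"
  shows "(LINT x:{a..b}|lborel. c * (f (x + h) - f x))
    = c * integral {b..b+h} f - c * integral {a..a+h} f"
proof -
  have c: "continuous_on A f" for A using f continuous_on_subset by blast
  have i: "f integrable_on {u..v}" for u v by (rule integrable_continuous_interval[OF c])
  have ch: "continuous_on A (\<lambda>x. f (x + h))" for A
    by (rule continuous_on_compose2[OF f]) (auto intro!: continuous_intros)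
  have "(LINT x:{a..b}|lborel. c * (f (x + h) - f x)) = integral {a..b} (\<lambda>x. c * (f (x + h) - f x))"
    by (intro set_borel_integral_eq_integral(2) borel_integrable_atLeastAtMost' continuous_intros c ch)
  also have "\<dots> = c * (integral {a..b} (\<lambda>x. f (x + h)) - integral {a..b} f)"
    by (simp add: integral_diff integrable_continuous_interval ch i)
  also have "integral {a..b} (\<lambda>x. f (x + h)) = integral {a+h..b+h} f"
    using integral_shift[of a h b f] c by (simp add: o_def)
  also have "integral {a+h..b+h} f - integral {a..b} f = integral {b..b+h} f - integral {a..a+h} f"
    using Henstock_Kurzweil_Integration.integral_combine[of a b "b+h" f] Henstock_Kurzweil_Integration.integral_combine[of a "a+h" "b+h" f] i ab h by simp
  finally show ?thesis by (simp add: algebra_simps)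
qed

section \<open>Hoelder continuity and an L2 derivative from bounded difference quotients\<close>

lemma difference_quotient_L2:
  assumes f: "continuous_on UNIV f" and S: "dq f n \<le> ennreal S" "0 \<le> S"
  defines "d \<equiv> \<lambda>x. 2^n * (f (x + 1/2^n) - f x)"
  shows "d \<in> borel_measurable lborel" "integrable lborel (\<lambda>x. (d x)\<^sup>2)" "(LINT x|lborel. (d x)\<^sup>2) \<le> S"
proof -
  have [measurable]: "f \<in> borel_measurable borel" using f by (rule borel_measurable_continuous_onI)
  show dm[measurable]: "d \<in> borel_measurable lborel" unfolding d_def by measurable
  have *: "(\<integral>\<^sup>+x. ennreal ((d x)\<^sup>2) \<partial>lborel) \<le> ennreal S" using S by (simp add: dq_def d_def)
  then show i: "integrable lborel (\<lambda>x. (d x)\<^sup>2)"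
    by (intro integrableI_nonneg) (auto simp: less_top[symmetric] top_unique)
  show "(LINT x|lborel. (d x)\<^sup>2) \<le> S"
    using * S(2) by (subst (asm) nn_integral_eq_integral[OF i]) auto
qed

lemma set_integral_square_le:
  fixes g :: "real \<Rightarrow> real"
  assumes [measurable]: "g \<in> borel_measurable lborel" and g2: "integrable lborel (\<lambda>x. (g x)\<^sup>2)" and ab: "a \<le> b"
  shows "set_integrable lborel {a..b} g"
    and "(LINT x:{a..b}|lborel. g x)\<^sup>2 \<le> (b - a) * (LINT x|lborel. (g x)\<^sup>2)"
proof -
  have gs: "set_integrable lborel {a..b} (\<lambda>x. (g x)\<^sup>2)"
    unfolding set_integrable_def using integrable_mult_indicator[OF _ g2, of "{a..b}"] by simp
  show "set_integrable lborel {a..b} g" by (rule integrable_set_of_square[OF _ gs]) measurable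
  have "(LINT x:{a..b}|lborel. g x)\<^sup>2 \<le> (b - a) * (LINT x:{a..b}|lborel. (g x)\<^sup>2)"
    by (rule cauchy_schwarz_interval[OF ab _ gs]) measurable
  also have "\<dots> \<le> (b - a) * (LINT x|lborel. (g x)\<^sup>2)"
    unfolding set_lebesgue_integral_def
    using gs g2 ab by (intro mult_left_mono integral_mono) (auto simp: set_integrable_def indicator_def)
  finally show "(LINT x:{a..b}|lborel. g x)\<^sup>2 \<le> (b - a) * (LINT x|lborel. (g x)\<^sup>2)" .
qed

text \<open>The averages of \<open>f\<close> just right of \<open>a\<close> and of \<open>b\<close>
  differ by the integral of the difference quotient over \<open>{a..b}\<close>, to which
  Cauchy-Schwarz applies with a bound uniform in \<open>n\<close>. In the limit the averages become
  values.\<close>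

lemma hoelder_of_dq:
  assumes f: "continuous_on UNIV f" and S: "\<And>n. dq f n \<le> ennreal S" "0 \<le> S"
  shows "(f b - f a)\<^sup>2 \<le> S * \<bar>b - a\<bar>"
proof -
  have *: "(f b - f a)\<^sup>2 \<le> S * (b - a)" if ab: "a \<le> b" for a b
  proof -
    have "(2^n * integral {b..b+1/2^n} f - 2^n * integral {a..a+1/2^n} f)\<^sup>2 \<le> S * (b - a)" for n
    proof -
      note d = difference_quotient_L2[OF f S]
      have "(2^n * integral {b..b+1/2^n} f - 2^n * integral {a..a+1/2^n} f)\<^sup>2
        = (LINT x:{a..b}|lborel. 2^n * (f (x + 1/2^n) - f x))\<^sup>2"
        by (subst integral_difference_quotient[OF f ab]) auto
      also have "\<dots> \<le> (b - a) * (LINT x|lborel. (2^n * (f (x + 1/2^n) - f x))\<^sup>2)"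
        by (rule set_integral_square_le(2)[OF d(1,2) ab])
      also have "\<dots> \<le> (b - a) * S" using ab d(3)[of n] by (intro mult_left_mono) auto
      finally show ?thesis by (simp add: mult.commute)
    qed
    moreover have "(\<lambda>n. (2^n * integral {b..b+1/2^n} f - 2^n * integral {a..a+1/2^n} f)\<^sup>2) \<longlonglongrightarrow> (f b - f a)\<^sup>2"
      by (intro tendsto_intros average_tendsto f)
    ultimately show ?thesis by (intro LIMSEQ_le_const2) auto
  qed
  show ?thesis
  proof (cases "a \<le> b")
    case True then show ?thesis using *[of a b] by simp
  next
    case False then show ?thesis using *[of b a] by (simp add: power2_commute)
  qed
qed


text \<open>The Riesz-Fischer argument: along a fast Cauchy subsequence the functions converge
  almost everywhere, and Fatou carries both the norm bound and the mutual distances over to the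
  limit. Only the convergence of interval integrals is passed on, since primitives see nothing
  else.\<close>

lemma L2_limit:
  fixes v :: "nat \<Rightarrow> real \<Rightarrow> real"
  assumes v[measurable]: "\<And>k. v k \<in> borel_measurable lborel" and v2: "\<And>k. integrable lborel (\<lambda>x. (v k x)\<^sup>2)"
    and B: "\<And>k. (LINT x|lborel. (v k x)\<^sup>2) \<le> B k" "B \<longlonglongrightarrow> S"
    and cauchy: "\<And>e. e > 0 \<Longrightarrow> \<exists>K. \<forall>i\<ge>K. \<forall>j\<ge>K. (\<integral>\<^sup>+x. ennreal ((v i x - v j x)\<^sup>2) \<partial>lborel) \<le> ennreal e"
  obtains g r where "g \<in> borel_measurable lborel" "integrable lborel (\<lambda>x. (g x)\<^sup>2)"
    "(LINT x|lborel. (g x)\<^sup>2) \<le> S" "filterlim r at_top sequentially"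
    "\<And>a b. a \<le> b \<Longrightarrow> (\<lambda>i. LINT x:{a..b}|lborel. v (r i) x) \<longlonglongrightarrow> (LINT x:{a..b}|lborel. g x)"
proof -
  have "\<forall>m. \<exists>K. \<forall>i\<ge>K. \<forall>j\<ge>K. (\<integral>\<^sup>+x. ennreal ((v i x - v j x)\<^sup>2) \<partial>lborel) \<le> ennreal ((1/4)^m)"
    by (intro allI cauchy) auto
  then obtain K :: "nat \<Rightarrow> nat" where K: "\<And>m i j. i \<ge> K m \<Longrightarrow> j \<ge> K m \<Longrightarrow> (\<integral>\<^sup>+x. ennreal ((v i x - v j x)\<^sup>2) \<partial>lborel) \<le> ennreal ((1/4)^m)"
    by metis
  \<comment> \<open>The sum dominates every \<open>K i\<close> with \<open>i \<le> m\<close>, and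
    the summand \<open>m\<close> makes \<open>r\<close> tend to infinity.\<close>
  define r where "r m = m + (\<Sum>i\<le>m. K i)" for m
  have rK: "r j \<ge> K m" if "m \<le> j" for m j
    using member_le_sum[of m "{..j}" K] that by (simp add: r_def)
  define w where "w i = v (r i)" for i
  have wm[measurable]: "w i \<in> borel_measurable borel" for i using v[of "r i"] by (simp add: w_def)
  have ww: "(\<integral>\<^sup>+x. ennreal ((w i x - w j x)\<^sup>2) \<partial>lborel) \<le> ennreal ((1/4)^i)" if "i \<le> j" for i j
    unfolding w_def using that by (intro K rK) auto
  have "(\<integral>\<^sup>+x. (\<Sum>i. ennreal (2^i * (w i x - w (Suc i) x)\<^sup>2)) \<partial>lborel) = (\<Sum>i. \<integral>\<^sup>+x. ennreal (2^i * (w i x - w (Suc i) x)\<^sup>2) \<partial>lborel)"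
    by (rule nn_integral_suminf) auto
  also have "\<dots> = (\<Sum>i. ennreal (2^i) * (\<integral>\<^sup>+x. ennreal ((w i x - w (Suc i) x)\<^sup>2) \<partial>lborel))"
    by (simp add: ennreal_mult nn_integral_cmult)
  \<comment> \<open>The squared distances decay like \<open>4^-i\<close>, so that the weight
    \<open>2^i\<close> still leaves a geometric series. The weight serves below to pass from squares
    to absolute values.\<close>
  also have "\<dots> \<le> (\<Sum>i. ennreal (2^i) * ennreal ((1/4)^i))"
    by (intro suminf_le mult_left_mono ww) auto
  also have "\<dots> = (\<Sum>i. ennreal ((1/2)^i))"
    by (simp add: ennreal_mult[symmetric] power_mult_distrib[symmetric])
  also have "\<dots> = ennreal (\<Sum>i. (1/2)^i)"
    by (rule suminf_ennreal2) (auto intro!: summable_geometric)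
  finally have fin: "(\<integral>\<^sup>+x. (\<Sum>i. ennreal (2^i * (w i x - w (Suc i) x)\<^sup>2)) \<partial>lborel) < \<infinity>"
    by (auto simp: less_top[symmetric] top_unique)
  have "AE x in lborel. (\<Sum>i. ennreal (2^i * (w i x - w (Suc i) x)\<^sup>2)) \<noteq> \<infinity>"
    by (rule nn_integral_PInf_AE) (use fin in auto)
  then have conv: "AE x in lborel. convergent (\<lambda>i. w i x)"
  proof (rule AE_mp, intro AE_I2 impI)
    fix x assume "(\<Sum>i. ennreal (2^i * (w i x - w (Suc i) x)\<^sup>2)) \<noteq> \<infinity>"
    then have s: "summable (\<lambda>i. 2^i * (w i x - w (Suc i) x)\<^sup>2)"
      by (intro summable_suminf_not_top) auto
    have "summable (\<lambda>i. 2^i * (w i x - w (Suc i) x)\<^sup>2 + (1/2)^i)"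
      by (intro summable_add s summable_geometric) auto
    \<comment> \<open>From \<open>(t * y - 1)^2 \<ge> 0\<close>: the weighted square and the
      geometric term together dominate the increment.\<close>
    moreover have "\<bar>w (Suc i) x - w i x\<bar> \<le> 2^i * (w i x - w (Suc i) x)\<^sup>2 + (1/2)^i" for i
    proof -
      define y where "y = \<bar>w (Suc i) x - w i x\<bar>"
      define t :: real where "t = 2^i"
      have "t > 0" by (simp add: t_def)
      have "0 \<le> (t * y - 1)\<^sup>2" by simp
      then have "2 * (t * y) \<le> t * (t * y\<^sup>2) + 1" by (simp add: power2_eq_square algebra_simps)
      moreover have "0 \<le> t * y" using \<open>t > 0\<close> by (simp add: y_def)
      ultimately have "t * y \<le> t * (t * y\<^sup>2 + 1/t)" using \<open>t > 0\<close> by (simp add: distrib_left)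
      then have "y \<le> t * y\<^sup>2 + 1/t" using \<open>t > 0\<close> by simp
      then show ?thesis by (simp add: y_def t_def power2_commute power_one_over)
    qed
    ultimately have "summable (\<lambda>i. \<bar>w (Suc i) x - w i x\<bar>)"
      by (intro summable_comparison_test[of "\<lambda>i. \<bar>w (Suc i) x - w i x\<bar>"]) auto
    then have "summable (\<lambda>i. w (Suc i) x - w i x)" by (rule summable_rabs_cancel)
    then obtain L where "(\<lambda>n. \<Sum>i<n. w (Suc i) x - w i x) \<longlonglongrightarrow> L" using summable_LIMSEQ by blast
    then have "(\<lambda>n. (w n x - w 0 x) + w 0 x) \<longlonglongrightarrow> L + w 0 x"
      by (intro tendsto_add tendsto_const) (simp add: sum_lessThan_telescope[of "\<lambda>i. w i x"])
    then show "convergent (\<lambda>i. w i x)" by (auto simp: convergent_def)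
  qed
  define g where "g x = lim (\<lambda>i. w i x)" for x
  have gm[measurable]: "g \<in> borel_measurable borel" unfolding g_def by measurable
  have wg: "AE x in lborel. (\<lambda>i. w i x) \<longlonglongrightarrow> g x"
    using conv by eventually_elim (simp add: g_def convergent_LIMSEQ_iff)
  have rlim: "filterlim r at_top sequentially"
    by (rule filterlim_at_top_mono[OF filterlim_ident]) (auto simp: r_def)
  have "(\<integral>\<^sup>+x. ennreal ((g x)\<^sup>2) \<partial>lborel) = (\<integral>\<^sup>+x. liminf (\<lambda>i. ennreal ((w i x)\<^sup>2)) \<partial>lborel)"
  proof (rule nn_integral_cong_AE, use wg in eventually_elim)
    case (elim x)
    then have "(\<lambda>i. ennreal ((w i x)\<^sup>2)) \<longlonglongrightarrow> ennreal ((g x)\<^sup>2)" by (intro tendsto_intros)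
    then show ?case by (rule lim_imp_Liminf[OF trivial_limit_sequentially, symmetric])
  qed
  also have "\<dots> \<le> liminf (\<lambda>i. \<integral>\<^sup>+x. ennreal ((w i x)\<^sup>2) \<partial>lborel)"
    by (rule nn_integral_liminf) auto
  also have "\<dots> \<le> liminf (\<lambda>i. ennreal (B (r i)))"
  proof (intro Liminf_mono always_eventually allI)
    fix i show "(\<integral>\<^sup>+x. ennreal ((w i x)\<^sup>2) \<partial>lborel) \<le> ennreal (B (r i))"
      unfolding w_def by (subst nn_integral_eq_integral[OF v2]) (auto intro!: ennreal_leI B)
  qed
  also have "\<dots> = ennreal S"
  proof (rule lim_imp_Liminf)
    show "(\<lambda>i. ennreal (B (r i))) \<longlonglongrightarrow> ennreal S"
      by (intro tendsto_ennrealI filterlim_compose[OF B(2) rlim])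
  qed simp
  finally have gS: "(\<integral>\<^sup>+x. ennreal ((g x)\<^sup>2) \<partial>lborel) \<le> ennreal S" .
  have S0: "0 \<le> S"
  proof (rule LIMSEQ_le_const[OF B(2)])
    have "0 \<le> B k" for k by (rule order_trans[OF _ B(1)]) simp
    then show "\<exists>N. \<forall>n\<ge>N. 0 \<le> B n" by simp
  qed
  have g2: "integrable lborel (\<lambda>x. (g x)\<^sup>2)"
    using gS by (intro integrableI_nonneg) (auto simp: less_top[symmetric] top_unique)
  have gS': "(LINT x|lborel. (g x)\<^sup>2) \<le> S"
    using gS S0 by (subst (asm) nn_integral_eq_integral[OF g2]) auto
  \<comment> \<open>Fatou in \<open>j\<close> with \<open>i\<close> fixed: the limit inherits the
    bound on the distances.\<close>
  have wg2: "(\<integral>\<^sup>+x. ennreal ((w i x - g x)\<^sup>2) \<partial>lborel) \<le> ennreal ((1/4)^i)" for i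
  proof -
    have "(\<integral>\<^sup>+x. ennreal ((w i x - g x)\<^sup>2) \<partial>lborel) = (\<integral>\<^sup>+x. liminf (\<lambda>j. ennreal ((w i x - w j x)\<^sup>2)) \<partial>lborel)"
    proof (rule nn_integral_cong_AE, use wg in eventually_elim)
      case (elim x)
      then have "(\<lambda>j. ennreal ((w i x - w j x)\<^sup>2)) \<longlonglongrightarrow> ennreal ((w i x - g x)\<^sup>2)" by (intro tendsto_intros)
      then show ?case by (rule lim_imp_Liminf[OF trivial_limit_sequentially, symmetric])
    qed
    also have "\<dots> \<le> liminf (\<lambda>j. \<integral>\<^sup>+x. ennreal ((w i x - w j x)\<^sup>2) \<partial>lborel)"
      by (rule nn_integral_liminf) auto
    also have "\<dots> \<le> liminf (\<lambda>j. ennreal ((1/4)^i))"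
      by (intro Liminf_mono eventually_sequentiallyI[of i] ww)
    finally show ?thesis by (simp add: Liminf_const)
  qed
  have "(\<lambda>i. LINT x:{a..b}|lborel. w i x) \<longlonglongrightarrow> (LINT x:{a..b}|lborel. g x)" if ab: "a \<le> b" for a b
  proof -
    have sq: "((LINT x:{a..b}|lborel. w i x) - (LINT x:{a..b}|lborel. g x))\<^sup>2 \<le> (b - a) * (1/4)^i" for i
    proof -
      have dm: "(\<lambda>x. w i x - g x) \<in> borel_measurable lborel" by measurable
      have d2: "integrable lborel (\<lambda>x. (w i x - g x)\<^sup>2)"
        using wg2[of i] by (intro integrableI_nonneg) (auto simp: less_top[symmetric] top_unique)
      have wi: "set_integrable lborel {a..b} (w i)"
        unfolding w_def by (rule set_integral_square_le(1)[OF v v2 ab])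
      have gi: "set_integrable lborel {a..b} g"
        by (rule set_integral_square_le(1)[OF _ g2 ab]) measurable
      have "((LINT x:{a..b}|lborel. w i x) - (LINT x:{a..b}|lborel. g x))\<^sup>2 = (LINT x:{a..b}|lborel. w i x - g x)\<^sup>2"
        by (simp add: set_integral_diff(2)[OF wi gi])
      also have "\<dots> \<le> (b - a) * (LINT x|lborel. (w i x - g x)\<^sup>2)"
        by (rule set_integral_square_le(2)[OF dm d2 ab])
      also have "\<dots> \<le> (b - a) * (1/4)^i"
        using wg2[of i] ab by (intro mult_left_mono) (simp_all add: nn_integral_eq_integral[OF d2])
      finally show ?thesis .
    qed
    have "(\<lambda>i. (b - a) * (1/4)^i) \<longlonglongrightarrow> (b - a) * 0"
      by (intro tendsto_mult tendsto_const LIMSEQ_power_zero) simp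
    then have lim0: "(\<lambda>i. (b - a) * (1/4)^i) \<longlonglongrightarrow> 0" by simp
    have "(\<lambda>i. ((LINT x:{a..b}|lborel. w i x) - (LINT x:{a..b}|lborel. g x))\<^sup>2) \<longlonglongrightarrow> 0"
      by (rule tendsto_sandwich[OF _ _ tendsto_const lim0])
        (intro always_eventually allI zero_le_power2, intro always_eventually allI sq)
    from tendsto_real_sqrt[OF this]
    have "(\<lambda>i. \<bar>(LINT x:{a..b}|lborel. w i x) - (LINT x:{a..b}|lborel. g x)\<bar>) \<longlonglongrightarrow> 0" by simp
    then have "(\<lambda>i. (LINT x:{a..b}|lborel. w i x) - (LINT x:{a..b}|lborel. g x)) \<longlonglongrightarrow> 0"
      by (rule tendsto_rabs_zero_cancel)
    then show ?thesis by (rule LIM_zero_cancel)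
  qed
  then show ?thesis using that[OF _ g2 gS' rlim] by (simp add: w_def)
qed

text \<open>The derivative is found by minimising the norm. \<open>C d\<close> is the convex set of
  functions whose interval integrals reproduce the increments of \<open>f\<close> up to
  \<open>d\<close>. Difference quotients with small step show that it contains elements of squared
  norm at most \<open>S\<close>, and nearly minimal elements form a Cauchy sequence as
  \<open>d\<close> tends to 0.\<close>

lemma primitive_of_dq_bound:
  assumes f: "continuous_on UNIV f" and S: "\<And>n. dq f n \<le> ennreal S" "0 \<le> S"
  obtains g where "l2_primitive f g" "(LINT x|lborel. (g x)\<^sup>2) \<le> S"
proof -
  define C where "C d = {v. v \<in> borel_measurable lborel \<and> integrable lborel (\<lambda>x. (v x)\<^sup>2) \<and>
    (\<forall>a b. a \<le> b \<longrightarrow> \<bar>(LINT x:{a..b}|lborel. v x) - (f b - f a)\<bar> \<le> d)}" for d :: real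
  define Q where "Q v = (LINT x|lborel. (v x)\<^sup>2)" for v :: "real \<Rightarrow> real"
  define I where "I d = Inf (Q ` C d)" for d
  have Q0: "0 \<le> Q v" for v unfolding Q_def by simp
  have bdd: "bdd_below (Q ` C d)" for d by (rule bdd_belowI[of _ 0]) (auto simp: Q0)
  have IQ: "I d \<le> Q v" if "v \<in> C d" for v d
    unfolding I_def using that by (intro cInf_lower bdd) auto
  have cf: "continuous_on A f" for A using f continuous_on_subset by blast
  \<comment> \<open>The interval integrals of a difference quotient are increments of averages of
    \<open>f\<close>. Each average is off by at most \<open>sqrt (S * h)\<close> by Hoelder
    continuity, and there are two endpoints, hence the factor 2.\<close>
  have ne: "\<exists>v\<in>C d. Q v \<le> S" if d: "d > 0" for d
  proof -
    have "(\<lambda>n. 2 * sqrt (S * (1/2^n))) \<longlonglongrightarrow> 2 * sqrt (S * 0)"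
      using LIMSEQ_divide_realpow_zero[of 2 1] by (intro tendsto_intros) auto
    then have "\<forall>\<^sub>F n in sequentially. 2 * sqrt (S * (1/2^n)) < d" using d by (intro order_tendstoD(2)) auto
    then obtain n where n: "2 * sqrt (S * (1/2^n)) < d" by (auto simp: eventually_sequentially)
    define h :: real where "h = 1/2^n"
    have h: "h > 0" "2^n * h = 1" by (auto simp: h_def)
    have av: "\<bar>2^n * integral {b..b+h} f - f b\<bar> \<le> sqrt (S * h)" for b
    proof -
      have "f integrable_on {b..b+h}" by (rule integrable_continuous_interval[OF cf])
      then have "integral {b..b+h} (\<lambda>x. f x - f b) = integral {b..b+h} f - f b * h"
        using h by (subst integral_diff) auto
      moreover have "norm (integral {b..b+h} (\<lambda>x. f x - f b)) \<le> sqrt (S * h) * (b + h - b)"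
      proof (rule integral_bound)
        show "continuous_on {b..b+h} (\<lambda>x. f x - f b)" by (intro continuous_intros cf)
        fix t assume t: "t \<in> {b..b+h}"
        have "(f t - f b)\<^sup>2 \<le> S * h"
          using hoelder_of_dq[OF f S, of t b] t S(2) mult_left_mono[of "\<bar>t - b\<bar>" h S] by auto
        then have "sqrt ((f t - f b)\<^sup>2) \<le> sqrt (S * h)" by (rule real_sqrt_le_mono)
        then show "norm (f t - f b) \<le> sqrt (S * h)" by simp
      qed (use h in auto)
      ultimately have "\<bar>integral {b..b+h} f - f b * h\<bar> \<le> sqrt (S * h) * h" by simp
      then have "2^n * \<bar>integral {b..b+h} f - f b * h\<bar> \<le> 2^n * (sqrt (S * h) * h)" by (intro mult_left_mono) auto
      moreover have "2^n * \<bar>integral {b..b+h} f - f b * h\<bar> = \<bar>2^n * integral {b..b+h} f - f b * (2^n * h)\<bar>"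
        unfolding abs_mult_pos'[of "2^n", simplified] by (simp add: algebra_simps)
      then have "2^n * \<bar>integral {b..b+h} f - f b * h\<bar> = \<bar>2^n * integral {b..b+h} f - f b\<bar>"
        using h(2) by simp
      moreover have "2^n * (sqrt (S * h) * h) = sqrt (S * h)" using h(2) by (simp add: mult.left_commute)
      ultimately show ?thesis by simp
    qed
    define v where "v x = 2^n * (f (x + 1/2^n) - f x)" for x
    note v = difference_quotient_L2[OF f S, of n, folded v_def]
    have "v \<in> C d"
      unfolding C_def
    proof (intro CollectI conjI v(1,2) allI impI)
      fix a b :: real assume ab: "a \<le> b"
      have "(LINT x:{a..b}|lborel. v x) = 2^n * integral {b..b+h} f - 2^n * integral {a..a+h} f"
        unfolding v_def using integral_difference_quotient[OF f ab, of h "2^n"] h by (simp add: h_def)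
      then show "\<bar>(LINT x:{a..b}|lborel. v x) - (f b - f a)\<bar> \<le> d"
        using av[of a] av[of b] n by (simp add: h_def)
    qed
    then show ?thesis using v(3) by (auto simp: Q_def)
  qed
  have CC: "C d \<subseteq> C d'" if "d \<le> d'" for d d' using that by (force simp: C_def)
  define \<delta> where "\<delta> k = 1 / (real k + 1)" for k :: nat
  have \<delta>: "\<delta> k > 0" for k by (simp add: \<delta>_def)
  have \<delta>mono: "\<delta> j \<le> \<delta> i" if "i \<le> j" for i j using that by (simp add: \<delta>_def field_simps)
  have \<delta>0: "\<delta> \<longlonglongrightarrow> 0" unfolding \<delta>_def by real_asymp
  \<comment> \<open>Tightening the constraint raises the minimal norms, which stay below
    \<open>S\<close>. Hence \<open>N\<close> converges, and the differences \<open>N j - N i\<close>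
    in the bound below become small.\<close>
  define N where "N k = I (\<delta> k)" for k
  have Nmono: "N i \<le> N j" if "i \<le> j" for i j
    unfolding N_def I_def using ne[OF \<delta>[of j]] CC[OF \<delta>mono[OF that]] by (intro cInf_superset_mono bdd) auto
  have NS: "N k \<le> S" for k
    using ne[OF \<delta>[of k]] IQ by (force simp: N_def intro: order_trans)
  have "\<exists>v\<in>C (\<delta> k). Q v \<le> N k + \<delta> k" for k
  proof -
    have "\<exists>q\<in>Q ` C (\<delta> k). q < N k + \<delta> k"
      unfolding N_def I_def using ne[OF \<delta>[of k]] \<delta>[of k] by (intro cInf_lessD) auto
    then show ?thesis by (auto intro: less_imp_le)
  qed
  then obtain v where vC: "\<And>k. v k \<in> C (\<delta> k)" and vQ: "\<And>k. Q (v k) \<le> N k + \<delta> k" by metis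
  have vm[measurable]: "v k \<in> borel_measurable lborel" and v2: "integrable lborel (\<lambda>x. (v k x)\<^sup>2)"
    and vf: "a \<le> b \<Longrightarrow> \<bar>(LINT x:{a..b}|lborel. v k x) - (f b - f a)\<bar> \<le> \<delta> k" for k a b
    using vC[of k] by (auto simp: C_def)
  text \<open>The midpoint of two nearly optimal competitors is again a competitor, so the parallelogram law bounds their distance.\<close>
  have par: "integrable lborel (\<lambda>x. (v i x - v j x)\<^sup>2)"
     "(LINT x|lborel. (v i x - v j x)\<^sup>2) \<le> 2 * (N j - N i) + 2 * \<delta> i + 2 * \<delta> j" if ij: "i \<le> j" for i j
  proof -
    have mid: "integrable lborel (\<lambda>x. v i x * v j x)"
    proof (rule Bochner_Integration.integrable_bound[of lborel "\<lambda>x. (v i x)\<^sup>2 + (v j x)\<^sup>2"])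
      show "integrable lborel (\<lambda>x. (v i x)\<^sup>2 + (v j x)\<^sup>2)" by (intro Bochner_Integration.integrable_add v2)
      have "\<bar>s * t\<bar> \<le> s\<^sup>2 + t\<^sup>2" for s t :: real
        using zero_le_power2[of "\<bar>s\<bar> - \<bar>t\<bar>"] mult_nonneg_nonneg[of "\<bar>s\<bar>" "\<bar>t\<bar>"]
        by (simp add: power2_eq_square abs_mult algebra_simps del: mult_nonneg_nonneg)
      then show "AE x in lborel. norm (v i x * v j x) \<le> norm ((v i x)\<^sup>2 + (v j x)\<^sup>2)" by simp
    qed measurable
    have e1: "(\<lambda>x. (v i x - v j x)\<^sup>2) = (\<lambda>x. (v i x)\<^sup>2 + (v j x)\<^sup>2 - 2 * (v i x * v j x))"
      by (auto simp: power2_eq_square algebra_simps)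
    have e2: "(\<lambda>x. ((v i x + v j x)/2)\<^sup>2) = (\<lambda>x. ((v i x)\<^sup>2 + (v j x)\<^sup>2 + 2 * (v i x * v j x))/4)"
      by (auto simp: power2_eq_square algebra_simps)
    show "integrable lborel (\<lambda>x. (v i x - v j x)\<^sup>2)" unfolding e1 using v2 mid by auto
    have m2: "integrable lborel (\<lambda>x. ((v i x + v j x)/2)\<^sup>2)" unfolding e2 using v2 mid by auto
    have "(\<lambda>x. (v i x + v j x)/2) \<in> C (\<delta> i)"
      unfolding C_def
    proof (intro CollectI conjI m2 allI impI)
      fix a b :: real assume ab: "a \<le> b"
      have "(LINT x:{a..b}|lborel. (v i x + v j x)/2) = ((LINT x:{a..b}|lborel. v i x) + (LINT x:{a..b}|lborel. v j x))/2"
        using set_integral_square_le(1)[OF vm v2 ab] by (simp add: set_integral_add(2))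
      moreover have "\<bar>(LINT x:{a..b}|lborel. v j x) - (f b - f a)\<bar> \<le> \<delta> i"
        using vf[OF ab, of j] \<delta>mono[OF ij] by simp
      ultimately show "\<bar>(LINT x:{a..b}|lborel. (v i x + v j x)/2) - (f b - f a)\<bar> \<le> \<delta> i"
        using vf[OF ab, of i] by (simp add: abs_le_iff field_simps)
    qed measurable
    then have "N i \<le> (LINT x|lborel. ((v i x + v j x)/2)\<^sup>2)" unfolding N_def using IQ by (force simp: Q_def)
    also have "\<dots> = (Q (v i) + Q (v j) + 2 * (LINT x|lborel. v i x * v j x))/4"
      unfolding e2 Q_def using v2 mid by simp
    finally have "4 * N i \<le> Q (v i) + Q (v j) + 2 * (LINT x|lborel. v i x * v j x)" by simp
    moreover have "(LINT x|lborel. (v i x - v j x)\<^sup>2) = Q (v i) + Q (v j) - 2 * (LINT x|lborel. v i x * v j x)"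
      unfolding e1 Q_def using v2 mid by simp
    ultimately show "(LINT x|lborel. (v i x - v j x)\<^sup>2) \<le> 2 * (N j - N i) + 2 * \<delta> i + 2 * \<delta> j"
      using vQ[of i] vQ[of j] by (simp add: algebra_simps)
  qed
  have "incseq N" using Nmono by (auto simp: incseq_def)
  then obtain N' where N': "N \<longlonglongrightarrow> N'" using NS incseq_convergent by blast
  have "Cauchy N" using N' by (simp add: LIMSEQ_imp_Cauchy)
  have cau: "\<exists>K. \<forall>i\<ge>K. \<forall>j\<ge>K. (\<integral>\<^sup>+x. ennreal ((v i x - v j x)\<^sup>2) \<partial>lborel) \<le> ennreal e" if e: "e > 0" for e
  proof -
    obtain K1 where K1: "\<And>i j. i \<ge> K1 \<Longrightarrow> j \<ge> K1 \<Longrightarrow> \<bar>N j - N i\<bar> < e/8"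
      using \<open>Cauchy N\<close> e unfolding Cauchy_def dist_real_def by (metis zero_less_divide_iff zero_less_numeral)
    obtain K2 where K2: "\<And>i. i \<ge> K2 \<Longrightarrow> \<delta> i < e/8"
      using order_tendstoD(2)[OF \<delta>0, of "e/8"] e by (auto simp: eventually_sequentially)
    have *: "(\<integral>\<^sup>+x. ennreal ((v i x - v j x)\<^sup>2) \<partial>lborel) \<le> ennreal e" if "K1 + K2 \<le> i" "i \<le> j" for i j
    proof -
      have "(LINT x|lborel. (v i x - v j x)\<^sup>2) \<le> e"
      proof -
        have *: "\<bar>N j - N i\<bar> < e/8" "\<delta> i < e/8" "\<delta> j < e/8" using K1 K2 that by auto
        have "N j - N i < e/8" by (rule le_less_trans[OF abs_ge_self *(1)])
        then obtain y where y: "N j - N i = y" "y < e/8" by blast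
        then have "2 * (N j - N i) + 2 * \<delta> i + 2 * \<delta> j \<le> e"
          using * e unfolding y(1) by linarith
        with par(2)[OF that(2)] show ?thesis by (rule order_trans)
      qed
      then show ?thesis by (subst nn_integral_eq_integral[OF par(1)[OF that(2)]]) (auto intro: ennreal_leI)
    qed
    show ?thesis
    proof (intro exI allI impI)
      fix i j assume "K1 + K2 \<le> i" "K1 + K2 \<le> j"
      then show "(\<integral>\<^sup>+x. ennreal ((v i x - v j x)\<^sup>2) \<partial>lborel) \<le> ennreal e"
        using *[of i j] *[of j i] by (cases "i \<le> j") (auto simp: power2_commute[of "v i _"])
    qed
  qed
  have "(\<lambda>k. S + \<delta> k) \<longlonglongrightarrow> S + 0" by (intro tendsto_intros \<delta>0)
  then have lim: "(\<lambda>k. S + \<delta> k) \<longlonglongrightarrow> S" by simp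
  have QB: "(LINT x|lborel. (v k x)\<^sup>2) \<le> S + \<delta> k" for k
    using vQ[of k] NS[of k] by (simp add: Q_def)
  obtain g r where g: "g \<in> borel_measurable lborel" "integrable lborel (\<lambda>x. (g x)\<^sup>2)"
    "(LINT x|lborel. (g x)\<^sup>2) \<le> S" and r: "filterlim r at_top sequentially"
    and vg: "\<And>a b. a \<le> b \<Longrightarrow> (\<lambda>i. LINT x:{a..b}|lborel. v (r i) x) \<longlonglongrightarrow> (LINT x:{a..b}|lborel. g x)"
    by (rule L2_limit[OF vm v2 QB lim cau]) blast+
  have "f b - f a = (LINT x:{a..b}|lborel. g x)" if ab: "a \<le> b" for a b
  proof -
    have "(\<lambda>i. \<delta> (r i)) \<longlonglongrightarrow> 0" by (rule filterlim_compose[OF \<delta>0 r])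
    then have "(\<lambda>i. (LINT x:{a..b}|lborel. v (r i) x) - (f b - f a)) \<longlonglongrightarrow> 0"
      by (rule Lim_null_comparison[rotated]) (use vf[OF ab] in auto)
    then have "(\<lambda>i. LINT x:{a..b}|lborel. v (r i) x) \<longlonglongrightarrow> f b - f a" by (rule LIM_zero_cancel)
    then show ?thesis using vg[OF ab] LIMSEQ_unique by blast
  qed
  then have "l2_primitive f g" using g by (simp add: l2_primitive_def)
  then show ?thesis using that g(3) by blast
qed

section \<open>A smooth step function\<close>

text \<open>The smoothness clause of \<open>test_function\<close> alone, so that closure properties
  are available for functions without compact support, such as a smooth step.\<close>

definition smooth_fun :: "(real \<Rightarrow> real) \<Rightarrow> bool" where
  "smooth_fun f \<longleftrightarrow> (\<forall>k x. ((deriv ^^ k) f) differentiable (at x))"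

text \<open>All iterated derivatives stay inside \<open>F\<close>. Smoothness thus reduces to
  exhibiting a class of differentiable functions that is closed under \<open>deriv\<close>.\<close>

lemma smooth_fun_coinduct:
  assumes F: "\<And>f. f \<in> F \<Longrightarrow> (\<forall>x. f differentiable (at x)) \<and> deriv f \<in> F" and "f \<in> F"
  shows "smooth_fun f"
proof -
  have "(deriv ^^ k) f \<in> F" for k by (induction k) (use assms in auto)
  then show ?thesis using F by (auto simp: smooth_fun_def)
qed

lemma smooth_fun_antideriv:
  assumes "\<And>x. DERIV f x :> f' x" "smooth_fun f'"
  shows "smooth_fun f"
proof -
  have "deriv f = f'" using assms(1) by (auto simp: DERIV_imp_deriv)
  then have "(deriv ^^ Suc k) f = (deriv ^^ k) f'" for k by (simp add: funpow_Suc_right del: funpow.simps)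
  then have "((deriv ^^ k) f) differentiable (at x)" for k x
    using assms by (cases k) (auto simp: smooth_fun_def real_differentiable_def simp del: funpow.simps)
  then show ?thesis by (simp add: smooth_fun_def)
qed

lemma smooth_fun_diff:
  assumes "smooth_fun f" "smooth_fun g"
  shows "smooth_fun (\<lambda>x. f x - g x)"
proof -
  have d: "(\<lambda>x. a x - b x) differentiable (at x) \<and> deriv (\<lambda>x. a x - b x) = (\<lambda>x. deriv a x - deriv b x)"
    if "\<And>x. a differentiable (at x)" "\<And>x. b differentiable (at x)" for a b :: "real \<Rightarrow> real" and x
    using that by (auto intro!: derivative_intros ext DERIV_imp_deriv simp: DERIV_deriv_iff_real_differentiable)
  have "(deriv ^^ k) (\<lambda>x. f x - g x) = (\<lambda>x. (deriv ^^ k) f x - (deriv ^^ k) g x)" for k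
    by (induction k) (use assms d in \<open>auto simp: smooth_fun_def\<close>)
  then show ?thesis using assms d by (simp add: smooth_fun_def)
qed

lemma smooth_fun_affine:
  assumes "smooth_fun f"
  shows "smooth_fun (\<lambda>x. f (a * x + b))"
proof -
  have d: "((\<lambda>x. c * g (a * x + b)) has_real_derivative (c * a) * deriv g (a * x + b)) (at x)"
    if "\<And>x. g differentiable (at x)" for g :: "real \<Rightarrow> real" and c x
  proof -
    have "(g has_real_derivative deriv g (a * x + b)) (at (a * x + b))"
      using that by (simp add: DERIV_deriv_iff_real_differentiable)
    then have "((\<lambda>x. g (a * x + b)) has_real_derivative deriv g (a * x + b) * a) (at x)"
      by (rule DERIV_chain2) (auto intro!: derivative_eq_intros)
    from DERIV_cmult[OF this, of c] show ?thesis by (simp add: mult_ac)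
  qed
  have *: "(deriv ^^ k) (\<lambda>x. f (a * x + b)) = (\<lambda>x. a^k * (deriv ^^ k) f (a * x + b))" for k
  proof (induction k)
    case (Suc k)
    have "deriv (\<lambda>x. a^k * (deriv ^^ k) f (a * x + b)) = (\<lambda>x. (a^k * a) * deriv ((deriv ^^ k) f) (a * x + b))"
      using assms by (intro ext DERIV_imp_deriv d) (auto simp: smooth_fun_def)
    with Suc show ?case by (simp add: mult_ac)
  qed simp
  show ?thesis unfolding smooth_fun_def
  proof (intro allI)
    fix k x
    have "((\<lambda>x. a^k * (deriv ^^ k) f (a * x + b)) has_real_derivative (a^k * a) * deriv ((deriv ^^ k) f) (a * x + b)) (at x)"
      by (rule d) (use assms in \<open>simp add: smooth_fun_def\<close>)
    then show "((deriv ^^ k) (\<lambda>x. f (a * x + b))) differentiable (at x)"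
      unfolding * real_differentiable_def by blast
  qed
qed

text \<open>For \<open>p = 1\<close> and \<open>n = 0\<close> the standard bump function on the unit
  interval. The rational prefactor makes the family closed under differentiation.\<close>

definition bump :: "real poly \<Rightarrow> nat \<Rightarrow> real \<Rightarrow> real" where
  "bump p n x = (if 0 < x \<and> x < 1 then poly p x / (x * (1 - x))^n * exp (- (1 / (x * (1 - x)))) else 0)"

text \<open>The exponential beats every power: \<open>exp (1 / q) \<ge> (1 / (q * m))^m\<close> for
  \<open>q = x * (1 - x)\<close>. The quadratic decay at both endpoints is what forces the
  derivative to vanish there.\<close>

lemma bump_quadratic_bound: "\<exists>C. \<forall>x. \<bar>bump p n x\<bar> \<le> C * x\<^sup>2 \<and> \<bar>bump p n x\<bar> \<le> C * (x - 1)\<^sup>2"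
proof -
  have "bounded (poly p ` {0..1})"
    by (intro compact_imp_bounded compact_continuous_image continuous_intros) auto
  then obtain M where "M > 0" and "\<forall>y\<in>poly p ` {0..1}. norm y \<le> M" unfolding bounded_pos by blast
  then have M: "\<bar>poly p x\<bar> \<le> M" if "x \<in> {0..1}" for x using that by auto
  \<comment> \<open>Two powers more than in the denominator, so that a factor \<open>q^2\<close>
    survives the division by \<open>q^n\<close>.\<close>
  define m where "m = n + 2"
  define C where "C = M * real m ^ m"
  have *: "\<bar>bump p n x\<bar> \<le> C * (x * (1 - x))\<^sup>2" for x
  proof (cases "0 < x \<and> x < 1")
    case True
    define q where "q = x * (1 - x)"
    have q: "q > 0" using True by (simp add: q_def)
    have "(1 / q / real m)^m \<le> exp (1 / q / real m)^m"
      using q by (intro power_mono order_trans[OF _ exp_ge_add_one_self]) auto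
    also have "\<dots> = exp (real m * (1 / q / real m))" by (rule exp_of_nat_mult[symmetric])
    also have "real m * (1 / q / real m) = 1 / q" by (simp add: m_def)
    finally have "1 / (q^m * real m ^ m) \<le> exp (1 / q)" by (simp add: power_divide power_mult_distrib)
    then have "inverse (exp (1 / q)) \<le> inverse (1 / (q^m * real m ^ m))"
      using q by (intro le_imp_inverse_le) (auto simp: m_def)
    then have "exp (- (1 / q)) \<le> q^m * real m ^ m" by (simp add: exp_minus)
    then have "\<bar>poly p x\<bar> / q^n * exp (- (1 / q)) \<le> M / q^n * (q^m * real m ^ m)"
      using M[of x] True q \<open>M > 0\<close> by (intro mult_mono divide_right_mono) auto
    also have "\<dots> = C * q\<^sup>2" using q by (simp add: C_def m_def power_add power2_eq_square)
    finally show ?thesis using True q by (simp add: bump_def q_def abs_mult)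
  next
    case False
    then have "bump p n x = 0" by (auto simp: bump_def)
    then show ?thesis using \<open>M > 0\<close> by (simp add: C_def)
  qed
  have "\<bar>bump p n x\<bar> \<le> C * x\<^sup>2 \<and> \<bar>bump p n x\<bar> \<le> C * (x - 1)\<^sup>2" for x
  proof (cases "0 < x \<and> x < 1")
    case True
    have "x * (1 - x) \<le> x * 1" "x * (1 - x) \<le> 1 * (1 - x)"
      using True by (intro mult_left_mono mult_right_mono; simp)+
    then have "(x * (1 - x))\<^sup>2 \<le> x\<^sup>2" "(x * (1 - x))\<^sup>2 \<le> (1 - x)\<^sup>2"
      using True by (intro power_mono; simp)+
    moreover have "C \<ge> 0" using \<open>M > 0\<close> by (simp add: C_def)
    ultimately have "C * (x * (1 - x))\<^sup>2 \<le> C * x\<^sup>2" "C * (x * (1 - x))\<^sup>2 \<le> C * (1 - x)\<^sup>2"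
      by (auto intro: mult_left_mono)
    then show ?thesis using *[of x] by (simp add: power2_commute[of x 1])
  next
    case False
    then have "bump p n x = 0" by (auto simp: bump_def)
    then show ?thesis using \<open>M > 0\<close> by (simp add: C_def)
  qed
  then show ?thesis by blast
qed

lemma DERIV_zero_of_quadratic_bound:
  fixes f :: "real \<Rightarrow> real"
  assumes "\<And>x. \<bar>f x\<bar> \<le> C * (x - a)\<^sup>2"
  shows "DERIV f a :> 0"
proof -
  have fa: "f a = 0" using assms[of a] by simp
  have "((\<lambda>h. (f (a + h) - f a) / h) \<longlongrightarrow> 0) (at 0)"
  proof (rule Lim_null_comparison)
    show "\<forall>\<^sub>F h in at 0. norm ((f (a + h) - f a) / h) \<le> C * \<bar>h\<bar>"
    proof (rule eventually_at_filter[THEN iffD2], rule always_eventually, intro allI impI)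
      fix h :: real assume "h \<noteq> 0"
      then show "norm ((f (a + h) - f a) / h) \<le> C * \<bar>h\<bar>"
        using assms[of "a + h"] by (simp add: fa field_simps power2_eq_square abs_mult_self_eq)
    qed
    have "((\<lambda>h. C * \<bar>h\<bar>) \<longlongrightarrow> C * \<bar>0\<bar>) (at 0)" by (intro tendsto_intros)
    then show "((\<lambda>h. C * \<bar>h\<bar>) \<longlongrightarrow> 0) (at 0)" by simp
  qed
  then show ?thesis by (simp add: DERIV_def)
qed

text \<open>Product and quotient rule, where \<open>[:0, 1, -1:]\<close> is
  \<open>q = x * (1 - x)\<close> and \<open>[:1, -2:]\<close> is its derivative; differentiating
  \<open>- 1 / q\<close> in the exponent raises the power of \<open>q\<close> in the denominator by
  two. At the endpoints the quadratic bound takes over.\<close>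

lemma DERIV_bump:
  "DERIV (bump p n) x :> bump (pderiv p * [:0, 1, -1:]^2 - of_nat n * p * [:1, -2:] * [:0, 1, -1:] + p * [:1, -2:]) (n + 2) x"
   (is "DERIV _ _ :> bump ?p' _ _")
proof -
  obtain C where C: "\<And>x. \<bar>bump p n x\<bar> \<le> C * x\<^sup>2" "\<And>x. \<bar>bump p n x\<bar> \<le> C * (x - 1)\<^sup>2"
    using bump_quadratic_bound by blast
  consider "0 < x" "x < 1" | "x < 0 \<or> x > 1" | "x = 0" | "x = 1" by linarith
  then show ?thesis
  proof cases
    case 1
    define q where "q x = x * (1 - x)" for x :: real
    have q: "q x > 0" using 1 by (simp add: q_def)
    have dq: "DERIV q x :> 1 - 2 * x" unfolding q_def by (auto intro!: derivative_eq_intros)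
    have D1: "DERIV (\<lambda>x. poly p x / q x ^ n) x :> (poly (pderiv p) x * q x ^ n
        - poly p x * (of_nat n * ((1 - 2*x) * q x ^ (n - Suc 0)))) / (q x ^ n * q x ^ n)"
      using q by (intro DERIV_divide poly_DERIV DERIV_power dq) auto
    have D2: "DERIV (\<lambda>x. exp (- (1 / q x))) x :> exp (- (1 / q x)) * ((1 - 2*x) / (q x * q x))"
      using q by (auto intro!: derivative_eq_intros dq) (simp add: field_simps)
    have aux: "(a * Q - P * (d * (k * Q / y))) / (Q * Q) * E + E * (d / (y * y)) * (P / Q)
      = (a * y\<^sup>2 - k * P * d * y + P * d) / (Q * y\<^sup>2) * E" if "Q > 0" "y > 0" for a Q P d k y E :: real
      using that by (simp add: field_simps power2_eq_square)
    have nq: "of_nat n * ((1 - 2*x) * q x ^ (n - Suc 0)) = (1 - 2*x) * (of_nat n * q x ^ n / q x)"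
      using q by (cases n) auto
    note DERIV_mult[OF D1 D2]
    also have "(poly (pderiv p) x * q x ^ n
        - poly p x * (of_nat n * ((1 - 2*x) * q x ^ (n - Suc 0)))) / (q x ^ n * q x ^ n) * exp (- (1 / q x))
       + exp (- (1 / q x)) * ((1 - 2*x) / (q x * q x)) * (poly p x / q x ^ n)
       = (poly (pderiv p) x * (q x)\<^sup>2 - of_nat n * poly p x * (1 - 2*x) * q x + poly p x * (1 - 2*x)) / q x ^ (n+2) * exp (- (1 / q x))"
      unfolding nq power_add by (rule aux) (use q in auto)
    also have "\<dots> = bump ?p' (n + 2) x"
      using 1 by (simp add: bump_def q_def power2_eq_square algebra_simps)
    finally have "DERIV (\<lambda>x. poly p x / q x ^ n * exp (- (1 / q x))) x :> bump ?p' (n + 2) x" .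
    then show ?thesis
    proof (rule has_field_derivative_transform_within_open[of _ _ _ "{0<..<1}"])
    qed (use 1 in \<open>auto simp: bump_def q_def\<close>)
  next
    case 2
    have "DERIV (\<lambda>_. 0) x :> (0::real)" by simp
    then have "DERIV (bump p n) x :> 0"
    proof (rule has_field_derivative_transform_within_open[of _ _ _ "- {0..1}"])
    qed (use 2 in \<open>auto simp: bump_def\<close>)
    then show ?thesis using 2 by (auto simp: bump_def)
  next
    case 3
    then show ?thesis using DERIV_zero_of_quadratic_bound[of "bump p n" C 0] C(1) by (simp add: bump_def)
  next
    case 4
    then show ?thesis using DERIV_zero_of_quadratic_bound[of "bump p n" C 1] C(2) by (simp add: bump_def)
  qed
qed

lemma smooth_fun_bump: "smooth_fun (bump p n)"
proof (rule smooth_fun_coinduct[of "{bump p n |p n. True}"])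
  fix f assume "f \<in> {bump p n |p n. True}"
  then obtain p n where f: "f = bump p n" by blast
  have "deriv f = bump (pderiv p * [:0, 1, -1:]^2 - of_nat n * p * [:1, -2:] * [:0, 1, -1:] + p * [:1, -2:]) (n + 2)"
    unfolding f by (intro ext DERIV_imp_deriv DERIV_bump)
  then show "(\<forall>x. f differentiable (at x)) \<and> deriv f \<in> {bump p n |p n. True}"
    using DERIV_bump unfolding f real_differentiable_def by blast
qed blast

text \<open>The normalised primitive of the standard bump. As it is constant on both sides of the
  unit interval, differences of rescaled copies are test functions.\<close>

lemma smooth_step_exists:
  obtains \<Phi> \<rho> :: "real \<Rightarrow> real" where "smooth_fun \<Phi>" "\<And>x. DERIV \<Phi> x :> \<rho> x" "continuous_on UNIV \<rho>"
    "\<And>x. \<rho> x \<ge> 0" "\<And>x. x \<le> 0 \<or> 1 \<le> x \<Longrightarrow> \<rho> x = 0"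
    "\<And>x. x \<le> 0 \<Longrightarrow> \<Phi> x = 0" "\<And>x. x \<ge> 1 \<Longrightarrow> \<Phi> x = 1" "\<And>x. 0 \<le> \<Phi> x \<and> \<Phi> x \<le> 1"
proof -
  define b where "b = bump 1 0"
  have bs: "smooth_fun b" unfolding b_def by (rule smooth_fun_bump)
  have b0: "b x \<ge> 0" for x by (simp add: b_def bump_def)
  have bz: "b x = 0" if "x \<le> 0 \<or> 1 \<le> x" for x using that by (auto simp: b_def bump_def)
  have bp: "b (1/2) > 0" by (simp add: b_def bump_def)
  have bd: "isCont b x" for x unfolding b_def by (rule DERIV_isCont[OF DERIV_bump])
  then have bc: "continuous_on UNIV b" by (simp add: continuous_at_imp_continuous_on)
  obtain F where F: "\<And>x. (F has_vector_derivative b x) (at x)"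
    using einterval_antiderivative[of "-\<infinity>" "\<infinity>" b] bd by auto
  then have F: "DERIV F x :> b x" for x by (simp add: has_real_derivative_iff_has_vector_derivative)
  have mono: "F x \<le> F y" if "x \<le> y" for x y
    using DERIV_nonneg_imp_nondecreasing[OF that] F b0 by blast
  have F0: "F x = F 0" if x0: "x \<le> 0" for x
  proof (cases "x = 0")
    case False
    then obtain z where z: "z > x" "z < 0" "F 0 - F x = (0 - x) * b z"
      using MVT2[of x 0 F b] x0 False F by auto
    then show ?thesis using bz[of z] by simp
  qed simp
  have F1: "F x = F 1" if x0: "1 \<le> x" for x
  proof (cases "x = 1")
    case False
    then obtain z where z: "z > 1" "z < x" "F x - F 1 = (x - 1) * b z"
      using MVT2[of 1 x F b] x0 False F by auto
    then show ?thesis using bz[of z] by simp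
  qed simp
  \<comment> \<open>Otherwise monotonicity would make \<open>F\<close> constant on the unit
    interval, against its positive slope at the midpoint.\<close>
  have "F 0 \<noteq> F 1"
  proof
    assume eq: "F 0 = F 1"
    have const: "F x = F 0" if "x \<in> {0<..<1}" for x using mono[of 0 x] mono[of x 1] eq that by auto
    have "DERIV F (1/2) :> 0"
      by (rule has_field_derivative_transform_within_open[of "\<lambda>_. F 0" _ _ "{0<..<1}"]) (auto simp: const)
    with F[of "1/2"] have "b (1/2) = 0" by (rule DERIV_unique)
    with bp show False by simp
  qed
  with mono[of 0 1] have F01: "F 0 < F 1" by simp
  define \<Phi> where "\<Phi> x = (F x - F 0) / (F 1 - F 0)" for x
  define \<rho> where "\<rho> x = b x / (F 1 - F 0)" for x
  have D: "DERIV \<Phi> x :> \<rho> x" for x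
    unfolding \<Phi>_def \<rho>_def using F01 by (auto intro!: derivative_eq_intros F)
  have "\<rho> = bump [:1 / (F 1 - F 0):] 0" by (auto simp: \<rho>_def b_def bump_def)
  then have sm: "smooth_fun \<Phi>" using smooth_fun_antideriv[OF D] smooth_fun_bump by simp
  have co: "continuous_on UNIV \<rho>" unfolding \<rho>_def using F01 by (intro continuous_intros bc) auto
  have \<rho>0: "0 \<le> \<rho> x" for x using F01 b0[of x] by (simp add: \<rho>_def)
  have \<rho>z: "\<rho> x = 0" if "x \<le> 0 \<or> 1 \<le> x" for x using bz[OF that] by (simp add: \<rho>_def)
  have \<Phi>0: "\<Phi> x = 0" if "x \<le> 0" for x using F0[OF that] by (simp add: \<Phi>_def)
  have \<Phi>1: "\<Phi> x = 1" if "1 \<le> x" for x using F1[OF that] F01 by (simp add: \<Phi>_def)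
  have "0 \<le> \<Phi> x \<and> \<Phi> x \<le> 1" for x
  proof -
    have "F 0 \<le> F x" using mono[of 0 x] F0[of x] by (cases "x \<le> 0") auto
    moreover have "F x \<le> F 1" using mono[of x 1] F1[of x] by (cases "1 \<le> x") auto
    ultimately show ?thesis using F01 by (simp add: \<Phi>_def)
  qed
  then show ?thesis using that[of \<Phi> \<rho>] sm D co \<rho>0 \<rho>z \<Phi>0 \<Phi>1 by blast
qed

section \<open>Weak derivatives of continuous functions\<close>

text \<open>The rescaled kernel is supported just to the right of \<open>c\<close>. Substituting
  \<open>x = c + y / Suc n\<close> fixes the kernel and moves the scale into the argument of
  \<open>m\<close>, where continuity and dominated convergence apply.\<close>

lemma mollifier_tendsto:
  fixes m :: "real \<Rightarrow> 'a::euclidean_space"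
  assumes m: "continuous_on UNIV m" and \<rho>c: "continuous_on UNIV \<rho>" and \<rho>0: "\<And>x. \<rho> x \<ge> 0"
    and \<rho>z': "\<forall>x. x \<le> 0 \<or> 1 \<le> x \<longrightarrow> \<rho> x = 0" and \<rho>1: "(LINT x|lborel. \<rho> x) = 1"
  shows "integrable lborel (\<lambda>x. (real (Suc n) * \<rho> (real (Suc n) * x + - (real (Suc n) * c))) *\<^sub>R m x)"
    and "(\<lambda>n. LINT x|lborel. (real (Suc n) * \<rho> (real (Suc n) * x + - (real (Suc n) * c))) *\<^sub>R m x) \<longlonglongrightarrow> m c"
proof -
  have \<rho>z: "\<rho> x = 0" if "x \<le> 0 \<or> 1 \<le> x" for x using \<rho>z' that by blast
  have [measurable]: "m \<in> borel_measurable borel" "\<rho> \<in> borel_measurable borel"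
    using m \<rho>c by (auto intro: borel_measurable_continuous_onI)
  have "bounded (m ` {c..c+1})"
    by (intro compact_imp_bounded compact_continuous_image continuous_on_subset[OF m]) auto
  then obtain M where M: "\<And>x. x \<in> {c..c+1} \<Longrightarrow> norm (m x) \<le> M" unfolding bounded_iff by blast
  have \<rho>i: "integrable lborel \<rho>"
  proof -
    have "set_integrable lborel {0..1} \<rho>"
      by (rule borel_integrable_atLeastAtMost') (rule continuous_on_subset[OF \<rho>c], simp)
    moreover have "(\<lambda>x. indicator {0..1} x *\<^sub>R \<rho> x) = \<rho>"
    proof
      fix x show "indicator {0..1} x *\<^sub>R \<rho> x = \<rho> x" using \<rho>z[of x] by (cases "x < 0"; cases "x > 1") auto
    qed
    ultimately show ?thesis by (simp add: set_integrable_def)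
  qed
  have bound: "norm (\<rho> y *\<^sub>R m (c + 1 / real (Suc n) * y)) \<le> \<rho> y * M" for n y
  proof (cases "y \<le> 0 \<or> 1 \<le> y")
    case True then show ?thesis using \<rho>z by simp
  next
    case False
    then have "c + 1 / real (Suc n) * y \<in> {c..c+1}" by (auto simp: field_simps)
    from mult_left_mono[OF M[OF this] \<rho>0[of y]] show ?thesis using \<rho>0[of y] by simp
  qed
  have int: "integrable lborel (\<lambda>y. \<rho> y *\<^sub>R m (c + 1 / real (Suc n) * y))" for n
  proof (rule Bochner_Integration.integrable_bound[of lborel "\<lambda>y. \<rho> y * M"])
    show "integrable lborel (\<lambda>y. \<rho> y * M)" using \<rho>i by simp
    show "AE y in lborel. norm (\<rho> y *\<^sub>R m (c + 1 / real (Suc n) * y)) \<le> norm (\<rho> y * M)"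
      using order_trans[OF bound abs_ge_self] by (intro AE_I2) simp
  qed measurable
  have eq: "(real (Suc n) * \<rho> (real (Suc n) * (c + 1 / real (Suc n) * y) + - (real (Suc n) * c))) *\<^sub>R m (c + 1 / real (Suc n) * y)
     = real (Suc n) *\<^sub>R (\<rho> y *\<^sub>R m (c + 1 / real (Suc n) * y))" for n y
    by (simp add: distrib_left del: of_nat_Suc)
  show "integrable lborel (\<lambda>x. (real (Suc n) * \<rho> (real (Suc n) * x + - (real (Suc n) * c))) *\<^sub>R m x)"
    using lborel_integrable_real_affine_iff[of "1 / real (Suc n)" "\<lambda>x. (real (Suc n) * \<rho> (real (Suc n) * x + - (real (Suc n) * c))) *\<^sub>R m x" c]
      integrable_scaleR_right[OF int[of n], of "real (Suc n)"]
    unfolding eq by (simp del: of_nat_Suc)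
  have "(LINT x|lborel. (real (Suc n) * \<rho> (real (Suc n) * x + - (real (Suc n) * c))) *\<^sub>R m x)
     = (LINT y|lborel. \<rho> y *\<^sub>R m (c + 1 / real (Suc n) * y))" for n
    using lborel_integral_real_affine[of "1 / real (Suc n)" "\<lambda>x. (real (Suc n) * \<rho> (real (Suc n) * x + - (real (Suc n) * c))) *\<^sub>R m x" c]
    unfolding eq integral_scaleR_right by (simp del: of_nat_Suc)
  moreover have "(\<lambda>n. LINT y|lborel. \<rho> y *\<^sub>R m (c + 1 / real (Suc n) * y)) \<longlonglongrightarrow> (LINT y|lborel. \<rho> y *\<^sub>R m c)"
  proof (rule integral_dominated_convergence[of _ _ _ "\<lambda>y. \<rho> y * M"])
    show "integrable lborel (\<lambda>y. \<rho> y * M)" using \<rho>i by simp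
    show "AE y in lborel. (\<lambda>n. \<rho> y *\<^sub>R m (c + 1 / real (Suc n) * y)) \<longlonglongrightarrow> \<rho> y *\<^sub>R m c"
    proof (intro AE_I2 tendsto_intros)
      fix y
      have "(\<lambda>n. c + 1 / real (Suc n) * y) \<longlonglongrightarrow> c + 0 * y"
        by (intro tendsto_intros LIMSEQ_Suc[OF lim_1_over_n])
      then show "(\<lambda>n. m (c + 1 / real (Suc n) * y)) \<longlonglongrightarrow> m c"
        using m by (intro isCont_tendsto_compose[of c m]) (auto simp: continuous_on_eq_continuous_at)
    qed
    show "AE y in lborel. norm (\<rho> y *\<^sub>R m (c + 1 / real (Suc n) * y)) \<le> \<rho> y * M" for n
      by (intro AE_I2 bound)
  qed measurable
  moreover have "(LINT y|lborel. \<rho> y *\<^sub>R m c) = m c" using \<rho>1 \<rho>i by simp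
  ultimately show "(\<lambda>n. LINT x|lborel. (real (Suc n) * \<rho> (real (Suc n) * x + - (real (Suc n) * c))) *\<^sub>R m x) \<longlonglongrightarrow> m c"
    by simp
qed

lemma set_integrable_L1_loc: "g \<in> L1_loc \<Longrightarrow> set_integrable lborel {a..b} g"
  by (auto simp: L1_loc_def)

text \<open>The weak derivative is tested with a smoothed indicator that rises just right of
  \<open>a\<close> and falls just right of \<open>b\<close>. Its derivative is a difference of two
  mollifiers, so one side tends to \<open>m a - m b\<close>, while the other tends, up to sign, to
  the integral of \<open>g\<close>.\<close>

lemma weak_deriv_ftc:
  fixes m :: "real \<Rightarrow> 'a::euclidean_space"
  assumes m: "continuous_on UNIV m" and w: "has_weak_deriv m g" and ab: "a \<le> b"
  shows "m b - m a = (LINT x:{a..b}|lborel. g x)"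
proof -
  from w have g: "g \<in> L1_loc" by (simp add: has_weak_deriv_def)
  then have [measurable]: "g \<in> borel_measurable borel" by (simp add: L1_loc_def)
  obtain \<Phi> \<rho> :: "real \<Rightarrow> real" where \<Phi>s: "smooth_fun \<Phi>" and D: "\<And>x. DERIV \<Phi> x :> \<rho> x" and \<rho>c: "continuous_on UNIV \<rho>"
    and \<rho>0: "\<And>x. \<rho> x \<ge> 0" and \<rho>z: "\<And>x. x \<le> 0 \<or> 1 \<le> x \<Longrightarrow> \<rho> x = 0"
    and \<Phi>0: "\<And>x. x \<le> 0 \<Longrightarrow> \<Phi> x = 0" and \<Phi>1: "\<And>x. x \<ge> 1 \<Longrightarrow> \<Phi> x = 1" and \<Phi>b: "\<And>x. 0 \<le> \<Phi> x \<and> \<Phi> x \<le> 1"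
    using smooth_step_exists by blast
  have \<Phi>c: "continuous_on UNIV \<Phi>" by (rule DERIV_continuous_on) (rule D)
  have [measurable]: "\<Phi> \<in> borel_measurable borel" using \<Phi>c by (rule borel_measurable_continuous_onI)
  have "(LINT x|lborel. \<rho> x * indicator {0..1} x) = \<Phi> 1 - \<Phi> 0"
    using \<rho>c by (intro integral_FTC_Icc_real D) (auto simp: continuous_on_eq_continuous_at)
  moreover have "(\<lambda>x. \<rho> x * indicator {0..1} x) = \<rho>"
    proof
      fix x show "\<rho> x * indicator {0..1} x = \<rho> x" using \<rho>z[of x] by (cases "x < 0"; cases "x > 1") auto
    qed
  ultimately have \<rho>1: "(LINT x|lborel. \<rho> x) = 1" by (simp add: \<Phi>0 \<Phi>1)
  have \<rho>z': "\<forall>x. x \<le> 0 \<or> 1 \<le> x \<longrightarrow> \<rho> x = 0" using \<rho>z by blast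
  note mol = mollifier_tendsto[OF m \<rho>c \<rho>0 \<rho>z' \<rho>1]
  define \<phi> where "\<phi> n x = \<Phi> (real (Suc n) * x + - (real (Suc n) * a)) - \<Phi> (real (Suc n) * x + - (real (Suc n) * b))" for n x
  have \<phi>z: "\<phi> n x = 0" if "x \<notin> {a..b+1}" for n x
  proof (cases "x < a")
    case True
    then have "real (Suc n) * x \<le> real (Suc n) * a" "real (Suc n) * x \<le> real (Suc n) * b"
      using ab by (intro mult_left_mono; simp)+
    then show ?thesis by (simp add: \<phi>_def \<Phi>0)
  next
    case False
    with that have "x > b + 1" by auto
    then have "1 * 1 \<le> real (Suc n) * (x - a)" "1 * 1 \<le> real (Suc n) * (x - b)"
      using ab by (intro mult_mono; simp)+
    then show ?thesis by (simp add: \<phi>_def \<Phi>1 right_diff_distrib)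
  qed
  have test: "test_function (\<phi> n)" for n
  proof -
    have "{x. \<phi> n x \<noteq> 0} \<subseteq> {a..b+1}" using \<phi>z by blast
    then have "compact (closure {x. \<phi> n x \<noteq> 0})"
      unfolding compact_closure by (rule bounded_subset[rotated]) simp
    moreover have "smooth_fun (\<phi> n)" unfolding \<phi>_def by (intro smooth_fun_diff smooth_fun_affine \<Phi>s)
    ultimately show ?thesis by (simp add: test_function_def smooth_fun_def)
  qed
  have d\<phi>: "deriv (\<phi> n) = (\<lambda>x. real (Suc n) * \<rho> (real (Suc n) * x + - (real (Suc n) * a))
       - real (Suc n) * \<rho> (real (Suc n) * x + - (real (Suc n) * b)))" for n
  proof (intro ext DERIV_imp_deriv)
    have *: "DERIV (\<lambda>x. \<Phi> (real (Suc n) * x + c)) x :> \<rho> (real (Suc n) * x + c) * real (Suc n)" for c x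
      by (rule DERIV_chain2[OF D]) (auto intro!: derivative_eq_intros)
    show "DERIV (\<phi> n) x :> real (Suc n) * \<rho> (real (Suc n) * x + - (real (Suc n) * a))
       - real (Suc n) * \<rho> (real (Suc n) * x + - (real (Suc n) * b))" for x
      unfolding \<phi>_def using DERIV_diff[OF *[of "- (real (Suc n) * a)" x] *[of "- (real (Suc n) * b)" x]]
      by (simp add: mult.commute del: of_nat_Suc)
  qed
  have "(\<lambda>n. (LINT x|lborel. deriv (\<phi> n) x *\<^sub>R m x)) \<longlonglongrightarrow> m a - m b"
    unfolding d\<phi> scaleR_left_diff_distrib
    by (subst Bochner_Integration.integral_diff[OF mol(1) mol(1)]) (intro tendsto_diff mol(2))
  moreover have "(LINT x|lborel. deriv (\<phi> n) x *\<^sub>R m x) = - (LINT x|lborel. \<phi> n x *\<^sub>R g x)" for n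
    using w test[of n] by (simp add: has_weak_deriv_def)
  ultimately have lim1: "(\<lambda>n. (LINT x|lborel. \<phi> n x *\<^sub>R g x)) \<longlonglongrightarrow> - (m a - m b)"
    using tendsto_minus by fastforce
  \<comment> \<open>The limit is half-open because both smoothed steps still vanish at their own
    starting points \<open>a\<close> and \<open>b\<close>.\<close>
  have "(\<lambda>n. (LINT x|lborel. \<phi> n x *\<^sub>R g x)) \<longlonglongrightarrow> (LINT x|lborel. indicator {a<..b} x *\<^sub>R g x)"
  proof (rule integral_dominated_convergence[of _ _ _ "\<lambda>x. norm (indicator {a..b+1} x *\<^sub>R g x)"])
    show "integrable lborel (\<lambda>x. norm (indicator {a..b+1} x *\<^sub>R g x))"
      using set_integrable_L1_loc[OF g] unfolding set_integrable_def by (rule integrable_norm)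
    show "(\<lambda>x. \<phi> n x *\<^sub>R g x) \<in> borel_measurable lborel" for n unfolding \<phi>_def by measurable
    show "AE x in lborel. norm (\<phi> n x *\<^sub>R g x) \<le> norm (indicator {a..b+1} x *\<^sub>R g x)" for n
    proof (intro AE_I2)
      fix x
      have "\<bar>\<phi> n x\<bar> \<le> 1"
        using \<Phi>b[of "real (Suc n) * x + - (real (Suc n) * a)"] \<Phi>b[of "real (Suc n) * x + - (real (Suc n) * b)"]
        unfolding \<phi>_def by linarith
      then show "norm (\<phi> n x *\<^sub>R g x) \<le> norm (indicator {a..b+1} x *\<^sub>R g x)"
        using \<phi>z[of x n] by (cases "x \<in> {a..b+1}") (auto intro: mult_left_le_one_le)
    qed
    have lin: "\<forall>\<^sub>F n in sequentially. 1 \<le> real (Suc n) * x + - (real (Suc n) * c)" if "c < x" for c x :: real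
    proof -
      obtain N where "1 / (x - c) < real N" using reals_Archimedean2 by blast
      then have N: "1 < real N * (x - c)" using that by (simp add: field_simps)
      show ?thesis
      proof (rule eventually_sequentiallyI[of N])
        fix n assume "N \<le> n"
        then have "real N * (x - c) \<le> real (Suc n) * (x - c)" using that by (intro mult_right_mono) auto
        with N show "1 \<le> real (Suc n) * x + - (real (Suc n) * c)" by (simp add: right_diff_distrib)
      qed
    qed
    show "AE x in lborel. (\<lambda>n. \<phi> n x *\<^sub>R g x) \<longlonglongrightarrow> indicator {a<..b} x *\<^sub>R g x"
    proof (intro AE_I2 tendsto_scaleR tendsto_const tendsto_eventually)
      fix x
      have neg: "\<Phi> (real (Suc n) * x + - (real (Suc n) * c)) = 0" if "x \<le> c" for n c
        using mult_left_mono[OF that, of "real (Suc n)"] by (intro \<Phi>0) simp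
      show "\<forall>\<^sub>F n in sequentially. \<phi> n x = indicator {a<..b} x"
      proof -
        consider "x \<le> a" | "a < x" "x \<le> b" | "a < x" "b < x" by linarith
        then show ?thesis
        proof cases
          case 1
          then show ?thesis using ab neg by (intro always_eventually) (simp add: \<phi>_def)
        next
          case 2
          from lin[OF 2(1)] show ?thesis by eventually_elim (use 2 neg[OF 2(2)] \<Phi>1 in \<open>simp add: \<phi>_def\<close>)
        next
          case 3
          from lin[OF 3(1)] lin[OF 3(2)] show ?thesis by eventually_elim (use 3 \<Phi>1 in \<open>simp add: \<phi>_def\<close>)
        qed
      qed
    qed
  qed measurable
  with lim1 have "- (m a - m b) = (LINT x|lborel. indicator {a<..b} x *\<^sub>R g x)" by (rule LIMSEQ_unique)
  also have "\<dots> = (LINT x:{a..b}|lborel. g x)"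
    unfolding set_lebesgue_integral_def
  proof (rule integral_cong_AE)
    show "AE x in lborel. indicator {a<..b} x *\<^sub>R g x = indicator {a..b} x *\<^sub>R g x"
      by (rule AE_mp[OF AE_lborel_singleton[of a]], rule AE_I2) (auto simp: indicator_def)
  qed measurable
  finally show ?thesis by simp
qed

text \<open>Half-lines are an intersection-stable generator of the Borel sets, so the vanishing of
  integrals extends from intervals to all Borel sets; truncation to
  \<open>{- real N..real N}\<close> supplies integrability. This pins down the arbitrary version
  chosen by \<open>weak_deriv\<close>.\<close>

lemma AE_eq_of_interval_integrals:
  fixes g h :: "real \<Rightarrow> 'a::euclidean_space"
  assumes g: "g \<in> L1_loc" and h: "h \<in> L1_loc"
    and eq: "\<And>a b. a \<le> b \<Longrightarrow> (LINT x:{a..b}|lborel. g x) = (LINT x:{a..b}|lborel. h x)"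
  shows "AE x in lborel. g x = h x"
proof -
  have *: "AE x in lborel. indicator {- real N..real N} x *\<^sub>R (g x - h x) = 0" for N
  proof (rule sigma_finite_measure.density_zero[OF sigma_finite_lborel])
    define f where "f x = indicator {- real N..real N} x *\<^sub>R (g x - h x)" for x
    have d0: "set_integrable lborel {a..b} (\<lambda>x. g x - h x)" for a b
      by (intro set_integral_diff(1) set_integrable_L1_loc g h)
    have dz: "(LINT x:{a..b}|lborel. g x - h x) = 0" if "a \<le> b" for a b
      using eq[OF that] by (simp add: set_integral_diff(2)[OF set_integrable_L1_loc[OF g] set_integrable_L1_loc[OF h]])
    show f: "integrable lborel (\<lambda>x. indicator {- real N..real N} x *\<^sub>R (g x - h x))"
      using d0[of "- real N" "real N"] by (simp add: set_integrable_def)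
    have tot: "(LINT x|lborel. f x) = 0" using dz[of "- real N" "real N"] by (simp add: f_def set_lebesgue_integral_def)
    have f': "integrable lborel f" using f unfolding f_def[abs_def] .
    fix A :: "real set" assume "A \<in> sets lborel"
    then have *: "A \<in> sigma_sets UNIV (range (\<lambda>a. {..a}))" by (simp add: borel_eq_atMost)
    have "Int_stable (range (\<lambda>a::real. {..a}))" by (auto simp: Int_stable_def)
    moreover have "range (\<lambda>a::real. {..a}) \<subseteq> Pow UNIV" by simp
    ultimately have "(LINT x:A|lborel. f x) = 0" using *
    proof (induction rule: sigma_sets_induct_disjoint)
      case (basic A)
      then obtain a where A: "A = {..a}" by auto
      show ?case
      proof (cases "- real N \<le> a")
        case True
        have "(LINT x:A|lborel. f x) = (LINT x:{- real N..min a (real N)}|lborel. g x - h x)"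
          unfolding set_lebesgue_integral_def f_def A by (intro Bochner_Integration.integral_cong) (auto simp: indicator_def)
        then show ?thesis using dz[of "- real N" "min a (real N)"] True by simp
      next
        case False
        then have "(\<lambda>x. indicator A x *\<^sub>R f x) = (\<lambda>x. 0)" by (auto simp: A f_def indicator_def)
        then show ?thesis by (simp add: set_lebesgue_integral_def)
      qed
    next
      case empty show ?case by (simp add: set_lebesgue_integral_def)
    next
      case (compl A)
      then have A: "A \<in> sets borel" by (simp add: borel_eq_atMost)
      have "(\<lambda>x. indicator (UNIV - A) x *\<^sub>R f x) = (\<lambda>x. f x - indicator A x *\<^sub>R f x)" by (auto simp: indicator_def)
      moreover have "integrable lborel (\<lambda>x. indicator A x *\<^sub>R f x)" using A f' by (intro integrable_mult_indicator) auto
      ultimately show ?case using compl.IH tot f' by (simp add: set_lebesgue_integral_def)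
    next
      case (union A)
      then have A: "A i \<in> sets lborel" for i by (auto simp: borel_eq_atMost)
      have "(LINT x:(\<Union>i. A i)|lborel. f x) = (\<Sum>i. LINT x:(A i)|lborel. f x)"
      proof (rule lebesgue_integral_countable_add[OF A])
        show "set_integrable lborel (\<Union>i. A i) f" unfolding set_integrable_def
          using A f' by (intro integrable_mult_indicator) auto
        show "\<And>i j. i \<noteq> j \<Longrightarrow> A i \<inter> A j = {}" using union.hyps(1) by (auto simp: disjoint_family_on_def)
      qed
      then show ?case using union.IH by simp
    qed
    then show "(LINT x:A|lborel. indicator {- real N..real N} x *\<^sub>R (g x - h x)) = 0" by (simp add: f_def)
  qed
  have "AE x in lborel. \<forall>N. indicator {- real N..real N} x *\<^sub>R (g x - h x) = 0"
    by (intro AE_all_countable[THEN iffD2] allI *)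
  then show ?thesis
  proof eventually_elim
    case (elim x)
    obtain N where "\<bar>x\<bar> < real N" using reals_Archimedean2 by blast
    then have "x \<in> {- real N..real N}" by auto
    with elim[rule_format, of N] show ?case by simp
  qed
qed

lemma continuous_L1_loc:
  fixes f :: "real \<Rightarrow> 'a::euclidean_space"
  assumes "continuous_on UNIV f"
  shows "f \<in> L1_loc"
  unfolding L1_loc_def set_integrable_def
  using assms by (auto intro!: borel_integrable_compact borel_measurable_continuous_onI intro: continuous_on_subset)

text \<open>Integration by parts through Fubini: \<open>f x\<close> is written as
  \<open>f (- R)\<close> plus the integral of \<open>g\<close> from \<open>- R\<close> to
  \<open>x\<close>. Exchanging the integrals over the triangle \<open>y \<le> x\<close> leaves the
  integral of \<open>D\<close> from \<open>y\<close> to \<open>R\<close>, which is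
  \<open>- \<phi> y\<close>.\<close>

lemma has_weak_deriv_of_primitive:
  fixes f g :: "real \<Rightarrow> 'a::euclidean_space"
  assumes f: "continuous_on UNIV f" and g: "g \<in> L1_loc"
    and fg: "\<And>a b. a \<le> b \<Longrightarrow> f b - f a = (LINT x:{a..b}|lborel. g x)"
  shows "has_weak_deriv f g"
  unfolding has_weak_deriv_def
proof (intro conjI allI impI continuous_L1_loc[OF f] g)
  fix \<phi> :: "real \<Rightarrow> real" assume \<phi>: "test_function \<phi>"
  have [measurable]: "g \<in> borel_measurable borel" using g by (simp add: L1_loc_def)
  have dk: "((deriv ^^ k) \<phi>) differentiable (at x)" for k x using \<phi> by (simp add: test_function_def)
  define D where "D = deriv \<phi>"
  have D: "DERIV \<phi> x :> D x" for x using dk[of 0 x] by (simp add: D_def DERIV_deriv_iff_real_differentiable)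
  have Dc: "isCont D x" for x
    using dk[of 1 x] by (auto simp: D_def real_differentiable_def intro: DERIV_isCont)
  then have Dc': "continuous_on UNIV D" by (simp add: continuous_at_imp_continuous_on)
  then have [measurable]: "D \<in> borel_measurable borel" by (rule borel_measurable_continuous_onI)
  have "bounded (closure {x. \<phi> x \<noteq> 0})" using \<phi> compact_imp_bounded by (auto simp: test_function_def)
  then have "bounded {x. \<phi> x \<noteq> 0}" using bounded_subset closure_subset by blast
  then obtain R0 where R0: "\<And>x. \<phi> x \<noteq> 0 \<Longrightarrow> \<bar>x\<bar> \<le> R0" "R0 > 0" unfolding bounded_pos by auto
  \<comment> \<open>One unit beyond the support, so that \<open>\<phi>\<close> and \<open>D\<close>
    vanish at the endpoints of \<open>{- R..R}\<close>.\<close>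
  define R where "R = R0 + 1"
  have R: "R > 0" using R0 by (simp add: R_def)
  have \<phi>z: "\<phi> x = 0" if "\<bar>x\<bar> > R0" for x using R0(1)[of x] that by fastforce
  have Dz: "D x = 0" if "\<bar>x\<bar> > R0" for x
  proof -
    have "DERIV \<phi> x :> 0"
    proof (rule has_field_derivative_transform_within_open[of "\<lambda>_. 0" _ _ "- {-R0..R0}"])
    qed (use that \<phi>z in auto)
    then show ?thesis using D DERIV_unique by blast
  qed
  have ftc: "(LINT x|lborel. D x * indicator {a..b} x) = \<phi> b - \<phi> a" if "a \<le> b" for a b
    using that by (intro integral_FTC_Icc_real D) (auto simp: Dc)
  define H where "H x y = (if - R \<le> y \<and> y \<le> x \<and> x \<le> R then D x *\<^sub>R g y else 0)" for x y
  have Hm[measurable]: "case_prod H \<in> borel_measurable (lborel \<Otimes>\<^sub>M lborel)" unfolding H_def by measurable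
  have "bounded (D ` {-R..R})"
    by (intro compact_imp_bounded compact_continuous_image continuous_on_subset[OF Dc']) auto
  then obtain M where M: "\<forall>y\<in>D ` {-R..R}. norm y \<le> M" "M > 0" unfolding bounded_pos by blast
  have gi: "integrable lborel (\<lambda>y. indicator {-R..R} y *\<^sub>R g y)"
    using set_integrable_L1_loc[OF g] by (simp add: set_integrable_def)
  have Hi: "integrable (lborel \<Otimes>\<^sub>M lborel) (case_prod H)"
  proof (rule integrableI_bounded[OF Hm])
    have "(\<integral>\<^sup>+z. ennreal (norm (case_prod H z)) \<partial>(lborel \<Otimes>\<^sub>M lborel)) = (\<integral>\<^sup>+x. \<integral>\<^sup>+y. ennreal (norm (H x y)) \<partial>lborel \<partial>lborel)"
      by (subst lborel.nn_integral_fst[symmetric]) auto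
    also have "\<dots> \<le> (\<integral>\<^sup>+x. \<integral>\<^sup>+y. (ennreal M * indicator {-R..R} x) * ennreal (norm (indicator {-R..R} y *\<^sub>R g y)) \<partial>lborel \<partial>lborel)"
    proof (intro nn_integral_mono)
      fix x y
      show "ennreal (norm (H x y)) \<le> (ennreal M * indicator {-R..R} x) * ennreal (norm (indicator {-R..R} y *\<^sub>R g y))"
      proof (cases "- R \<le> y \<and> y \<le> x \<and> x \<le> R")
        case True
        have "norm (H x y) \<le> M * norm (g y)" using True M(1) by (auto simp: H_def intro!: mult_right_mono)
        then show ?thesis using True M(2) by (simp add: ennreal_mult'[symmetric])
      qed (auto simp: H_def)
    qed
    also have "\<dots> = (\<integral>\<^sup>+x. (ennreal M * indicator {-R..R} x) * (\<integral>\<^sup>+y. ennreal (norm (indicator {-R..R} y *\<^sub>R g y)) \<partial>lborel) \<partial>lborel)"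
      by (intro nn_integral_cong nn_integral_cmult) measurable
    also have "\<dots> = (\<integral>\<^sup>+x. ennreal M * indicator {-R..R} x \<partial>lborel) * (\<integral>\<^sup>+y. ennreal (norm (indicator {-R..R} y *\<^sub>R g y)) \<partial>lborel)"
      by (rule nn_integral_multc) measurable
    also have "\<dots> < \<infinity>"
      using gi R unfolding integrable_iff_bounded
      by (subst nn_integral_cmult_indicator) (auto simp: ennreal_mult_less_top)
    finally show "(\<integral>\<^sup>+z. ennreal (norm (case_prod H z)) \<partial>(lborel \<Otimes>\<^sub>M lborel)) < \<infinity>" .
  qed
  have Hx: "D x *\<^sub>R f x = D x *\<^sub>R f (- R) + (LINT y|lborel. H x y)" for x
  proof (cases "\<bar>x\<bar> \<le> R")
    case True
    have "f x - f (- R) = (LINT y:{-R..x}|lborel. g y)" using True by (intro fg) auto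
    moreover have "(LINT y|lborel. H x y) = (LINT y|lborel. D x *\<^sub>R (indicator {-R..x} y *\<^sub>R g y))"
      using True by (intro Bochner_Integration.integral_cong) (auto simp: H_def indicator_def)
    moreover have "\<dots> = D x *\<^sub>R (LINT y:{-R..x}|lborel. g y)"
      unfolding set_lebesgue_integral_def by (rule integral_scaleR_right)
    ultimately have "(LINT y|lborel. H x y) = D x *\<^sub>R (f x - f (- R))" by simp
    then show ?thesis by (simp add: scaleR_right_diff_distrib)
  next
    case False
    then have "D x = 0" using Dz by (simp add: R_def)
    then have "H x y = 0" for y by (auto simp: H_def)
    then show ?thesis using \<open>D x = 0\<close> by simp
  qed
  have Di: "integrable lborel D"
  proof -
    have "integrable lborel (\<lambda>x. indicator {-R..R} x *\<^sub>R D x)"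
      by (rule borel_integrable_compact) (auto intro: continuous_on_subset[OF Dc'])
    moreover have "(\<lambda>x. indicator {-R..R} x *\<^sub>R D x) = D"
    proof
      fix x show "indicator {-R..R} x *\<^sub>R D x = D x" using Dz[of x] by (cases "\<bar>x\<bar> \<le> R") (auto simp: R_def indicator_def)
    qed
    ultimately show ?thesis by simp
  qed
  have "(LINT x|lborel. D x * indicator {-R..R} x) = 0"
    using ftc[of "- R" R] R \<phi>z by (simp add: R_def)
  moreover have "(\<lambda>x. D x * indicator {-R..R} x) = D"
    proof
      fix x show "D x * indicator {-R..R} x = D x" using Dz[of x] by (cases "\<bar>x\<bar> \<le> R") (auto simp: R_def indicator_def)
    qed
  ultimately have D0: "(LINT x|lborel. D x) = 0" by simp
  have "(LINT x|lborel. D x *\<^sub>R f x) = (LINT x|lborel. D x *\<^sub>R f (- R)) + (LINT x|lborel. LINT y|lborel. H x y)"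
    unfolding Hx using Di lborel_pair.integrable_fst'[OF Hi] by (subst Bochner_Integration.integral_add) auto
  also have "(LINT x|lborel. D x *\<^sub>R f (- R)) = 0" using D0 Di by simp
  also have "(LINT x|lborel. LINT y|lborel. H x y) = (LINT y|lborel. LINT x|lborel. H x y)"
    using lborel_pair.Fubini_integral[OF Hi] by simp
  also have "\<dots> = (LINT y|lborel. - (\<phi> y *\<^sub>R g y))"
  proof (intro Bochner_Integration.integral_cong refl)
    fix y
    show "(LINT x|lborel. H x y) = - (\<phi> y *\<^sub>R g y)"
    proof (cases "\<bar>y\<bar> \<le> R")
      case True
      have "(LINT x|lborel. H x y) = (LINT x|lborel. (D x * indicator {y..R} x) *\<^sub>R g y)"
        using True by (intro Bochner_Integration.integral_cong) (auto simp: H_def indicator_def)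
      also have "\<dots> = (LINT x|lborel. D x * indicator {y..R} x) *\<^sub>R g y"
        using Di by (intro integral_scaleR_left integrable_real_mult_indicator) auto
      also have "\<dots> = (\<phi> R - \<phi> y) *\<^sub>R g y" using True by (subst ftc) auto
      also have "\<phi> R = 0" by (rule \<phi>z) (use R0 in \<open>simp add: R_def\<close>)
      finally show ?thesis by simp
    next
      case False
      then have "\<phi> y = 0" by (intro \<phi>z) (simp add: R_def)
      moreover from False have "H x y = 0" for x by (auto simp: H_def)
      ultimately show ?thesis by simp
    qed
  qed
  finally show "(LINT x|lborel. deriv \<phi> x *\<^sub>R f x) = - (LINT x|lborel. \<phi> x *\<^sub>R g x)" by (simp add: D_def)
qed

section \<open>The energy in terms of the profile and its cut-off\<close>

text \<open>For \<open>u = 1 - cos \<theta>\<close> these are \<open>\<bar>cos (\<theta>/2)\<bar>\<close> and \<open>\<bar>sin (\<theta>/2)\<bar>\<close>, whose Dirichlet integral is a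
  quarter of that of \<open>\<theta>\<close>. Half angles make the inequality for the cut-off below exact already for increments.\<close>

definition half_cos :: "(real \<Rightarrow> real) \<Rightarrow> real \<Rightarrow> real" where "half_cos u x = sqrt (1 - u x / 2)"
definition half_sin :: "(real \<Rightarrow> real) \<Rightarrow> real \<Rightarrow> real" where "half_sin u x = sqrt (u x / 2)"

definition profile :: "(real \<Rightarrow> real) \<Rightarrow> bool" where
  "profile u \<longleftrightarrow> continuous_on UNIV u \<and> (\<forall>x. 0 \<le> u x \<and> u x \<le> 2)"

definition half_angle_energy :: "(real \<Rightarrow> real) \<Rightarrow> ennreal" where
  "half_angle_energy u = (SUP n. dq (half_cos u) n + dq (half_sin u) n)"

text \<open>Meant as \<open>2 * E1\<close> written in terms of \<open>u\<close>; the factor 4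
  compensates the halving of the angle.\<close>

definition profile_energy :: "(real \<Rightarrow> real) \<Rightarrow> ennreal" where
  "profile_energy u = 4 * half_angle_energy u + Hdot_half_sq u + L2_norm_sq u"

definition ramp :: "real \<Rightarrow> real \<Rightarrow> real" where "ramp r x = max 0 (min 1 (2 - \<bar>x\<bar> / r))"
text \<open>The ramp enters squared so that increments of the angle still carry a factor
  \<open>ramp\<close>. Errors caused by the cut are then weighted by \<open>ramp^2 * u\<close>, the
  density of \<open>cut_mass\<close>.\<close>

definition cut_angle :: "real \<Rightarrow> real \<Rightarrow> real" where "cut_angle r x = pi / 2 * (ramp r x)\<^sup>2"
definition cutoff :: "real \<Rightarrow> (real \<Rightarrow> real) \<Rightarrow> real \<Rightarrow> real" where
  "cutoff r u x = (cos (cut_angle r x))\<^sup>2 * u x"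
definition cut_mass :: "real \<Rightarrow> (real \<Rightarrow> real) \<Rightarrow> ennreal" where
  "cut_mass r u = (\<integral>\<^sup>+x. ennreal ((ramp r x)\<^sup>2 * u x) \<partial>lborel)"
text \<open>Up to the factor \<open>r / pi\<close>, the Poisson integral of \<open>u\<close> at
  height \<open>r\<close> above the origin. It measures how strongly \<open>u\<close> interacts with
  the region of the cut.\<close>

definition poisson_mass :: "real \<Rightarrow> (real \<Rightarrow> real) \<Rightarrow> ennreal" where
  "poisson_mass r u = (\<integral>\<^sup>+x. ennreal (u x / (r\<^sup>2 + x\<^sup>2)) \<partial>lborel)"

lemma profile_measurable[measurable_dest]: "profile u \<Longrightarrow> u \<in> borel_measurable borel"
  by (auto simp: profile_def intro: borel_measurable_continuous_onI)

lemma ramp_measurable[measurable]: "ramp r \<in> borel_measurable borel"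
  unfolding ramp_def by measurable

lemma cut_angle_measurable[measurable]: "cut_angle r \<in> borel_measurable borel"
  unfolding cut_angle_def by measurable

lemma ramp_bounds: "0 \<le> ramp r x" "ramp r x \<le> 1" by (auto simp: ramp_def)

lemma ramp_inside: "r > 0 \<Longrightarrow> \<bar>x\<bar> \<le> r \<Longrightarrow> ramp r x = 1" by (auto simp: ramp_def field_simps)

lemma ramp_outside: "r > 0 \<Longrightarrow> 2 * r \<le> \<bar>x\<bar> \<Longrightarrow> ramp r x = 0" by (auto simp: ramp_def field_simps)

lemma ramp_lipschitz:
  assumes "r > 0"
  shows "\<bar>ramp r s - ramp r t\<bar> \<le> \<bar>s - t\<bar> / r"
proof -
  have "\<bar>ramp r s - ramp r t\<bar> \<le> \<bar>\<bar>s\<bar> / r - \<bar>t\<bar> / r\<bar>" unfolding ramp_def by linarith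
  also have "\<dots> = \<bar>\<bar>s\<bar> - \<bar>t\<bar>\<bar> / r" using assms by (simp add: diff_divide_distrib[symmetric])
  also have "\<dots> \<le> \<bar>s - t\<bar> / r" using assms by (intro divide_right_mono) auto
  finally show ?thesis .
qed

lemma cut_angle_bounds: "0 \<le> cut_angle r x" "cut_angle r x \<le> pi / 2"
  using ramp_bounds[of r x] power_mono[of "ramp r x" 1 2] by (auto simp: cut_angle_def)

lemma cos_cut_angle_nonneg: "0 \<le> cos (cut_angle r x)"
  using cut_angle_bounds[of r x] by (intro cos_ge_zero) linarith+

text \<open>Factor \<open>a^2 - b^2\<close>. The constant 8 comes from
  \<open>(pi / 2)^2 \<le> 4\<close> and \<open>(a + b)^2 \<le> 2 * (a^2 + b^2)\<close>; the last
  factor is what ties the error to the ramp.\<close>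

lemma cut_angle_diff: "(cut_angle r s - cut_angle r t)\<^sup>2 \<le> 8 * (ramp r s - ramp r t)\<^sup>2 * ((ramp r s)\<^sup>2 + (ramp r t)\<^sup>2)"
proof -
  define a where "a = ramp r s" define b where "b = ramp r t"
  have "cut_angle r s - cut_angle r t = pi / 2 * ((a - b) * (a + b))"
    by (simp add: cut_angle_def a_def b_def power2_eq_square algebra_simps)
  then have "(cut_angle r s - cut_angle r t)\<^sup>2 = (pi / 2)\<^sup>2 * ((a - b)\<^sup>2 * (a + b)\<^sup>2)"
    by (simp only: power_mult_distrib)
  also have "\<dots> \<le> 2\<^sup>2 * ((a - b)\<^sup>2 * (2 * (a\<^sup>2 + b\<^sup>2)))"
  proof (intro mult_mono)
    show "(pi / 2)\<^sup>2 \<le> 2\<^sup>2" using pi_less_4 by (intro power_mono) auto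
    show "(a + b)\<^sup>2 \<le> 2 * (a\<^sup>2 + b\<^sup>2)" using zero_le_power2[of "a - b"] by (simp add: power2_eq_square algebra_simps)
  qed auto
  finally show ?thesis by (simp add: a_def b_def algebra_simps)
qed

text \<open>A chord of the unit circle is no longer than its arc.\<close>

lemma two_minus_two_cos_le: "2 - 2 * cos x \<le> (x::real)\<^sup>2"
proof -
  have "cos x = 1 - 2 * (sin (x/2))\<^sup>2" using cos_double_sin[of "x/2"] by simp
  moreover have "\<bar>sin (x/2)\<bar>\<^sup>2 \<le> \<bar>x/2\<bar>\<^sup>2" by (intro power_mono abs_sin_x_le_abs_x) auto
  ultimately show ?thesis by (simp add: power_divide)
qed

text \<open>Localisation: the omitted square \<open>(sin \<alpha> * a - sin \<beta> * b)\<^sup>2\<close> is the energy density of the complementary piece.\<close>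

lemma ims_localisation:
  fixes a b :: real
  assumes "a \<ge> 0" "b \<ge> 0"
  shows "(cos \<alpha> * a - cos \<beta> * b)\<^sup>2 \<le> (a - b)\<^sup>2 + (\<alpha> - \<beta>)\<^sup>2 * (a * b)"
proof -
  have s: "(sin x)\<^sup>2 = 1 - (cos x)\<^sup>2" for x :: real by (simp add: sin_squared_eq)
  have "0 \<le> (sin \<alpha> * a - sin \<beta> * b)\<^sup>2" by simp
  also have "\<dots> = (1 - (cos \<alpha>)\<^sup>2) * a\<^sup>2 + (1 - (cos \<beta>)\<^sup>2) * b\<^sup>2 - 2 * (sin \<alpha> * sin \<beta>) * (a * b)"
    by (simp add: power2_diff power_mult_distrib s)
  also have "\<dots> = (a - b)\<^sup>2 + (2 - 2 * cos (\<alpha> - \<beta>)) * (a * b) - (cos \<alpha> * a - cos \<beta> * b)\<^sup>2"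
    by (simp add: cos_diff power2_eq_square algebra_simps)
  also have "\<dots> \<le> (a - b)\<^sup>2 + (\<alpha> - \<beta>)\<^sup>2 * (a * b) - (cos \<alpha> * a - cos \<beta> * b)\<^sup>2"
    using assms by (intro diff_right_mono add_left_mono mult_right_mono two_minus_two_cos_le) auto
  finally show ?thesis by simp
qed

text \<open>\<open>ims_localisation\<close> is applied twice, once for each factor of the squared
  cosine in \<open>cutoff\<close>; hence the factor 2.\<close>

lemma cutoff_difference:
  assumes u: "\<And>x. 0 \<le> u x"
  shows "(cutoff r u s - cutoff r u t)\<^sup>2 \<le> (u s - u t)\<^sup>2 + 2 * (cut_angle r s - cut_angle r t)\<^sup>2 * (u s * u t)"
proof -
  define cs where "cs = cos (cut_angle r s)" define ct where "ct = cos (cut_angle r t)"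
  have c: "0 \<le> cs" "cs \<le> 1" "0 \<le> ct" "ct \<le> 1" using cos_cut_angle_nonneg by (auto simp: cs_def ct_def)
  have "(cutoff r u s - cutoff r u t)\<^sup>2 = (cs * (cs * u s) - ct * (ct * u t))\<^sup>2"
    by (simp add: cutoff_def cs_def ct_def power2_eq_square mult.assoc)
  also have "\<dots> \<le> (cs * u s - ct * u t)\<^sup>2 + (cut_angle r s - cut_angle r t)\<^sup>2 * ((cs * u s) * (ct * u t))"
    unfolding cs_def ct_def using u cos_cut_angle_nonneg by (intro ims_localisation) auto
  also have "(cs * u s - ct * u t)\<^sup>2 \<le> (u s - u t)\<^sup>2 + (cut_angle r s - cut_angle r t)\<^sup>2 * (u s * u t)"
    unfolding cs_def ct_def using u by (intro ims_localisation) auto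
  also have "(cut_angle r s - cut_angle r t)\<^sup>2 * ((cs * u s) * (ct * u t)) \<le> (cut_angle r s - cut_angle r t)\<^sup>2 * ((1 * u s) * (1 * u t))"
    using u c by (intro mult_left_mono mult_mono) auto
  finally show ?thesis by (simp add: algebra_simps)
qed

text \<open>The reverse triangle inequality for the Euclidean norm of the plane, squared.\<close>

lemma sqrt_sum_squares_reverse: "(sqrt (x\<^sup>2 + y\<^sup>2) - sqrt (x'\<^sup>2 + y'\<^sup>2))\<^sup>2 \<le> (x - x')\<^sup>2 + (y - y')\<^sup>2"
proof -
  have "x * x' + y * y' \<le> sqrt ((x\<^sup>2 + y\<^sup>2) * (x'\<^sup>2 + y'\<^sup>2))"
  proof (rule real_le_rsqrt)
    have "0 \<le> (x * y' - y * x')\<^sup>2" by simp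
    then show "(x * x' + y * y')\<^sup>2 \<le> (x\<^sup>2 + y\<^sup>2) * (x'\<^sup>2 + y'\<^sup>2)"
      by (simp add: power2_eq_square algebra_simps)
  qed
  then have "x * x' + y * y' \<le> sqrt (x\<^sup>2 + y\<^sup>2) * sqrt (x'\<^sup>2 + y'\<^sup>2)" by (simp add: real_sqrt_mult)
  then show ?thesis by (simp add: power2_diff)
qed

text \<open>The half-angle vectors before and after the cut-off are projections of the points with colatitude
  \<open>\<theta>/2\<close> and longitude \<open>\<omega>\<close> on the sphere, which turns this into an elementary identity in three dimensions.\<close>

lemma cutoff_half_angle:
  assumes u: "\<And>x. 0 \<le> u x \<and> u x \<le> 2"
  shows "(half_cos (cutoff r u) s - half_cos (cutoff r u) t)\<^sup>2 + (half_sin (cutoff r u) s - half_sin (cutoff r u) t)\<^sup>2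
    \<le> (half_cos u s - half_cos u t)\<^sup>2 + (half_sin u s - half_sin u t)\<^sup>2 + (u s + u t) / 4 * (cut_angle r s - cut_angle r t)\<^sup>2"
proof -
  define C where "C = half_cos u"
  define S where "S = half_sin u"
  have S0: "S x \<ge> 0" for x using u[of x] by (simp add: S_def half_sin_def)
  have S2: "(S x)\<^sup>2 = u x / 2" for x using u[of x] by (simp add: S_def half_sin_def)
  have C2: "(C x)\<^sup>2 = 1 - u x / 2" for x using u[of x] by (simp add: C_def half_cos_def)
  have hs: "half_sin (cutoff r u) x = cos (cut_angle r x) * S x" for x
    using cos_cut_angle_nonneg[of r x] by (simp add: half_sin_def S_def cutoff_def real_sqrt_mult[symmetric] real_sqrt_unique
        power_mult_distrib flip: real_sqrt_pow2)
     (simp add: real_sqrt_mult real_sqrt_divide)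
  \<comment> \<open>What is cut away from the half sine reappears in the half cosine, so that the
    half-angle vector keeps its unit length.\<close>
  have hc: "half_cos (cutoff r u) x = sqrt ((C x)\<^sup>2 + (sin (cut_angle r x) * S x)\<^sup>2)" for x
    by (simp add: half_cos_def cutoff_def C2 power_mult_distrib S2 sin_squared_eq algebra_simps)
  define a where "a = S s" define b where "b = S t"
  have "(half_cos (cutoff r u) s - half_cos (cutoff r u) t)\<^sup>2 \<le> (C s - C t)\<^sup>2 + (sin (cut_angle r s) * a - sin (cut_angle r t) * b)\<^sup>2"
    unfolding hc a_def b_def by (rule sqrt_sum_squares_reverse)
  moreover have "(sin (cut_angle r s) * a - sin (cut_angle r t) * b)\<^sup>2 + (cos (cut_angle r s) * a - cos (cut_angle r t) * b)\<^sup>2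
     = (a - b)\<^sup>2 + (2 - 2 * cos (cut_angle r s - cut_angle r t)) * (a * b)"
    by (simp add: cos_diff power2_diff power_mult_distrib sin_squared_eq algebra_simps)
  moreover have "(2 - 2 * cos (cut_angle r s - cut_angle r t)) * (a * b) \<le> (cut_angle r s - cut_angle r t)\<^sup>2 * ((u s + u t) / 4)"
  proof (intro mult_mono two_minus_two_cos_le)
    show "a * b \<le> (u s + u t) / 4"
      using S2[of s] S2[of t] zero_le_power2[of "a - b"] by (simp add: power2_eq_square a_def b_def algebra_simps)
    show "0 \<le> a * b" using S0 by (simp add: a_def b_def)
  qed auto
  ultimately show ?thesis unfolding hs C_def S_def[symmetric] a_def[symmetric] b_def[symmetric]
    by (simp add: mult.commute)
qed

section \<open>The cost of the cut-off, term by term\<close>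

lemma profile_cutoff:
  assumes "profile u" "r > 0"
  shows "profile (cutoff r u)" "cutoff r u x \<le> u x" "0 \<le> cutoff r u x"
    "\<bar>x\<bar> \<le> r \<Longrightarrow> cutoff r u x = 0" "2 * r \<le> \<bar>x\<bar> \<Longrightarrow> cutoff r u x = u x"
proof -
  have u: "continuous_on UNIV u" "\<And>x. 0 \<le> u x" "\<And>x. u x \<le> 2" using assms by (auto simp: profile_def)
  have le: "cutoff r u x \<le> u x" and ge: "0 \<le> cutoff r u x" for x
    using u(2)[of x] cos_cut_angle_nonneg[of r x] power_le_one[of "cos (cut_angle r x)" 2]
    by (auto simp: cutoff_def intro: mult_left_le_one_le)
  have "continuous_on UNIV (cutoff r u)"
    unfolding cutoff_def cut_angle_def ramp_def using assms(2) by (intro continuous_intros u) auto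
  then show "profile (cutoff r u)" using le ge u order_trans[OF le] by (auto simp: profile_def)
  show "cutoff r u x \<le> u x" "0 \<le> cutoff r u x" by (fact le ge)+
  show "\<bar>x\<bar> \<le> r \<Longrightarrow> cutoff r u x = 0" using assms(2) by (simp add: cutoff_def cut_angle_def ramp_inside)
  show "2 * r \<le> \<bar>x\<bar> \<Longrightarrow> cutoff r u x = u x" using assms(2) by (simp add: cutoff_def cut_angle_def ramp_outside)
qed

lemma half_measurable[measurable]:
  assumes [measurable]: "u \<in> borel_measurable borel"
  shows "half_cos u \<in> borel_measurable borel" "half_sin u \<in> borel_measurable borel"
  unfolding half_cos_def[abs_def] half_sin_def[abs_def] by measurable

lemma dq_half_sum:
  assumes [measurable]: "u \<in> borel_measurable borel"
  shows "dq (half_cos u) n + dq (half_sin u) n = (\<integral>\<^sup>+x. ennreal ((2^n)\<^sup>2 *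
     ((half_cos u (x + 1/2^n) - half_cos u x)\<^sup>2 + (half_sin u (x + 1/2^n) - half_sin u x)\<^sup>2)) \<partial>lborel)"
  by (rule dq_add) measurable

text \<open>The bound from \<open>cut_angle_diff\<close> contains products of \<open>u\<close> at
  one point with the ramp at the other. Moving the ramp to the same point costs
  \<open>(ramp r s - ramp r t)^2\<close>, which lives near the cut and is absorbed by the Poisson
  weight. The constants are \<open>24 = 8 * 3\<close> and \<open>160 = 8 * 2 * 10\<close>.\<close>

lemma cutoff_dir_pointwise:
  assumes u: "\<And>x. 0 \<le> u x \<and> u x \<le> 2" and r: "r \<ge> 1" and h: "0 < h" "h \<le> 1"
  shows "(u s + u (s + h)) * (cut_angle r s - cut_angle r (s + h))\<^sup>2 \<le> h\<^sup>2 *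
    (24 / r\<^sup>2 * ((ramp r s)\<^sup>2 * u s + (ramp r (s + h))\<^sup>2 * u (s + h))
      + 160 / r\<^sup>2 * (u s / (r\<^sup>2 + s\<^sup>2) + u (s + h) / (r\<^sup>2 + (s + h)\<^sup>2)))"
proof -
  define t where "t = s + h"
  define a where "a = u s" define b where "b = u t"
  define x where "x = ramp r s" define y where "y = ramp r t"
  have ab: "a \<ge> 0" "b \<ge> 0" using u by (auto simp: a_def b_def)
  have xy: "(x - y)\<^sup>2 \<le> (h / r)\<^sup>2"
  proof -
    have "\<bar>x - y\<bar> \<le> \<bar>h / r\<bar>" using ramp_lipschitz[of r s t] r h by (simp add: x_def y_def t_def)
    then show ?thesis by (rule abs_le_square_iff[THEN iffD1])
  qed
  \<comment> \<open>As \<open>h \<le> 1 \<le> r\<close>, both points lie outside the ramp once one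
    of them is beyond \<open>3 * r\<close>; otherwise
    \<open>r^2 + z^2 \<le> 10 * r^2\<close>.\<close>
  have loc: "c * (x - y)\<^sup>2 \<le> c * (h\<^sup>2 * (10 / (r\<^sup>2 + z\<^sup>2)))" if z: "z = s \<or> z = t" and c: "c \<ge> 0" for c z
  proof (cases "\<bar>z\<bar> \<le> 3 * r")
    case True
    then have "z\<^sup>2 \<le> (3 * r)\<^sup>2" using r by (intro abs_le_square_iff[THEN iffD1]) auto
    then have "r\<^sup>2 + z\<^sup>2 \<le> 10 * r\<^sup>2" by (simp add: power2_eq_square)
    moreover have "r\<^sup>2 + z\<^sup>2 > 0" using r by (intro add_pos_nonneg) auto
    ultimately have "1 / r\<^sup>2 \<le> 10 / (r\<^sup>2 + z\<^sup>2)" using r by (simp add: field_simps)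
    then have "h\<^sup>2 * (1 / r\<^sup>2) \<le> h\<^sup>2 * (10 / (r\<^sup>2 + z\<^sup>2))" by (intro mult_left_mono) auto
    with xy have "(x - y)\<^sup>2 \<le> h\<^sup>2 * (10 / (r\<^sup>2 + z\<^sup>2))" by (simp add: power_divide)
    then show ?thesis using c by (rule mult_left_mono)
  next
    case False
    then have "2 * r \<le> \<bar>s\<bar>" "2 * r \<le> \<bar>t\<bar>" using z h r by (auto simp: t_def abs_if split: if_splits)
    then have "x = 0" "y = 0" using r by (auto simp: x_def y_def ramp_outside)
    then show ?thesis using c by simp
  qed
  have sq: "p\<^sup>2 \<le> 2 * q\<^sup>2 + 2 * (q - p)\<^sup>2" for p q :: real
    using zero_le_power2[of "2 * q - p"] by (simp add: power2_eq_square algebra_simps)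
  have "a * y\<^sup>2 \<le> a * (2 * x\<^sup>2 + 2 * (x - y)\<^sup>2)" "b * x\<^sup>2 \<le> b * (2 * y\<^sup>2 + 2 * (y - x)\<^sup>2)"
    using ab sq by (auto intro: mult_left_mono)
  then have "(a + b) * (x\<^sup>2 + y\<^sup>2) \<le> 3 * (x\<^sup>2 * a + y\<^sup>2 * b) + 2 * (a * (x - y)\<^sup>2) + 2 * (b * (x - y)\<^sup>2)"
    by (simp add: algebra_simps power2_commute[of y x])
  define L where "L = 3 * (x\<^sup>2 * a + y\<^sup>2 * b)"
  define M where "M = 10 / (r\<^sup>2 + s\<^sup>2) * a + 10 / (r\<^sup>2 + t\<^sup>2) * b"
  have "a * (x - y)\<^sup>2 + b * (x - y)\<^sup>2 \<le> h\<^sup>2 * M"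
    using loc[of s a] loc[of t b] ab by (simp add: M_def algebra_simps)
  moreover have "h\<^sup>2 * M \<le> 1 * M"
    using h ab r by (intro mult_right_mono) (auto simp: M_def power_le_one)
  ultimately have "(a + b) * (x\<^sup>2 + y\<^sup>2) \<le> L + 2 * M"
    using \<open>(a + b) * (x\<^sup>2 + y\<^sup>2) \<le> _\<close> by (simp add: L_def)
  moreover have "L + 2 * M \<ge> 0" using ab r by (simp add: L_def M_def)
  ultimately have "8 * (x - y)\<^sup>2 * ((a + b) * (x\<^sup>2 + y\<^sup>2)) \<le> 8 * (h / r)\<^sup>2 * (L + 2 * M)"
    using xy ab by (intro mult_mono) auto
  moreover have "(a + b) * (cut_angle r s - cut_angle r t)\<^sup>2 \<le> (a + b) * (8 * (x - y)\<^sup>2 * (x\<^sup>2 + y\<^sup>2))"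
    using cut_angle_diff[of r s t] ab unfolding x_def y_def by (intro mult_left_mono) auto
  ultimately have "(a + b) * (cut_angle r s - cut_angle r t)\<^sup>2 \<le> 8 * (h / r)\<^sup>2 * (L + 2 * M)" by (simp add: algebra_simps)
  also have "\<dots> = h\<^sup>2 * (24 / r\<^sup>2 * (x\<^sup>2 * a + y\<^sup>2 * b) + 160 / r\<^sup>2 * (a / (r\<^sup>2 + s\<^sup>2) + b / (r\<^sup>2 + t\<^sup>2)))"
    by (simp add: L_def M_def power_divide distrib_left) (simp add: algebra_simps add_divide_distrib)
  finally show ?thesis by (simp add: a_def b_def x_def y_def t_def)
qed

text \<open>The factor \<open>h^2\<close> of the pointwise bound cancels the \<open>4^n\<close> of
  the difference quotients, so the error is uniform in \<open>n\<close>. The points \<open>x\<close>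
  and \<open>x + h\<close> contribute equally by translation, which doubles 24 and 160.\<close>

lemma half_angle_energy_cutoff:
  assumes u: "profile u" and r: "r \<ge> 1"
  shows "4 * half_angle_energy (cutoff r u) \<le> 4 * half_angle_energy u + (ennreal (48 / r\<^sup>2) * cut_mass r u + ennreal (320 / r\<^sup>2) * poisson_mass r u)"
proof -
  have ub: "0 \<le> u x \<and> u x \<le> 2" for x using u by (simp add: profile_def)
  have [measurable]: "u \<in> borel_measurable borel" "cutoff r u \<in> borel_measurable borel"
    using u profile_cutoff(1)[OF u] r by (auto dest: profile_measurable)
  define P where "P = (\<lambda>x. ennreal (24 / r\<^sup>2) * ennreal ((ramp r x)\<^sup>2 * u x) + ennreal (160 / r\<^sup>2) * ennreal (u x / (r\<^sup>2 + x\<^sup>2)))"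
  have [measurable]: "P \<in> borel_measurable borel" unfolding P_def by measurable
  have IP: "(\<integral>\<^sup>+x. P x \<partial>lborel) = ennreal (24 / r\<^sup>2) * cut_mass r u + ennreal (160 / r\<^sup>2) * poisson_mass r u"
    unfolding P_def cut_mass_def poisson_mass_def by (simp add: nn_integral_add nn_integral_cmult)
  have "4 * (dq (half_cos (cutoff r u)) n + dq (half_sin (cutoff r u)) n)
    \<le> 4 * half_angle_energy u + (ennreal (48 / r\<^sup>2) * cut_mass r u + ennreal (320 / r\<^sup>2) * poisson_mass r u)" for n
  proof -
    define h :: real where "h = 1 / 2^n"
    have h: "0 < h" "h \<le> 1" "(2^n)\<^sup>2 * h\<^sup>2 = 1" by (auto simp: h_def power_one_over field_simps)
    define F where "F v x = (half_cos v (x + h) - half_cos v x)\<^sup>2 + (half_sin v (x + h) - half_sin v x)\<^sup>2" for v x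
    have Fn: "F v x \<ge> 0" for v x by (simp add: F_def)
    have [measurable]: "F u \<in> borel_measurable borel" "F (cutoff r u) \<in> borel_measurable borel" unfolding F_def by measurable
    have pw: "4 * ((2^n)\<^sup>2 * F (cutoff r u) x) \<le> 4 * ((2^n)\<^sup>2 * F u x)
       + ((24 / r\<^sup>2 * ((ramp r x)\<^sup>2 * u x) + 160 / r\<^sup>2 * (u x / (r\<^sup>2 + x\<^sup>2)))
        + (24 / r\<^sup>2 * ((ramp r (x + h))\<^sup>2 * u (x + h)) + 160 / r\<^sup>2 * (u (x + h) / (r\<^sup>2 + (x + h)\<^sup>2))))" for x
    proof -
      define K where "K = 24 / r\<^sup>2 * ((ramp r x)\<^sup>2 * u x + (ramp r (x + h))\<^sup>2 * u (x + h))
          + 160 / r\<^sup>2 * (u x / (r\<^sup>2 + x\<^sup>2) + u (x + h) / (r\<^sup>2 + (x + h)\<^sup>2))"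
      have "F (cutoff r u) x \<le> F u x + (u (x + h) + u x) / 4 * (cut_angle r (x + h) - cut_angle r x)\<^sup>2"
        unfolding F_def using cutoff_half_angle[of u r "x + h" x] ub by simp
      also have "(u (x + h) + u x) / 4 * (cut_angle r (x + h) - cut_angle r x)\<^sup>2 = (u x + u (x + h)) * (cut_angle r x - cut_angle r (x + h))\<^sup>2 / 4"
        by (simp add: power2_commute add.commute)
      also have "\<dots> \<le> h\<^sup>2 * K / 4"
        unfolding K_def using cutoff_dir_pointwise[of u r h x, OF ub r h(1,2)] by simp
      finally have "4 * (2^n)\<^sup>2 * F (cutoff r u) x \<le> 4 * (2^n)\<^sup>2 * (F u x + h\<^sup>2 * K / 4)" by (intro mult_left_mono) auto
      also have "\<dots> = 4 * ((2^n)\<^sup>2 * F u x) + ((2^n)\<^sup>2 * h\<^sup>2) * K" by (simp add: algebra_simps)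
      finally show ?thesis unfolding h(3) by (simp add: K_def algebra_simps)
    qed
    have "4 * (dq (half_cos (cutoff r u)) n + dq (half_sin (cutoff r u)) n) = (\<integral>\<^sup>+x. ennreal (4 * ((2^n)\<^sup>2 * F (cutoff r u) x)) \<partial>lborel)"
      unfolding F_def h_def by (simp add: dq_half_sum ennreal_mult nn_integral_cmult)
    also have "\<dots> \<le> (\<integral>\<^sup>+x. 4 * ennreal ((2^n)\<^sup>2 * F u x) + (P x + P (x + h)) \<partial>lborel)"
    proof (rule nn_integral_mono)
      fix x
      have "4 * ennreal ((2^n)\<^sup>2 * F u x) + (P x + P (x + h)) = ennreal (4 * ((2^n)\<^sup>2 * F u x)
       + ((24 / r\<^sup>2 * ((ramp r x)\<^sup>2 * u x) + 160 / r\<^sup>2 * (u x / (r\<^sup>2 + x\<^sup>2)))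
        + (24 / r\<^sup>2 * ((ramp r (x + h))\<^sup>2 * u (x + h)) + 160 / r\<^sup>2 * (u (x + h) / (r\<^sup>2 + (x + h)\<^sup>2)))))"
        using ub Fn by (simp add: P_def ennreal_mult'[symmetric] ennreal_plus[symmetric] del: ennreal_plus flip: ennreal_numeral)
      then show "ennreal (4 * ((2^n)\<^sup>2 * F (cutoff r u) x)) \<le> 4 * ennreal ((2^n)\<^sup>2 * F u x) + (P x + P (x + h))"
        using ennreal_leI[OF pw] by simp
    qed
    also have "\<dots> = 4 * (\<integral>\<^sup>+x. ennreal ((2^n)\<^sup>2 * F u x) \<partial>lborel) + ((\<integral>\<^sup>+x. P x \<partial>lborel) + (\<integral>\<^sup>+x. P (x + h) \<partial>lborel))"
      by (simp add: nn_integral_add nn_integral_cmult)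
    also have "(\<integral>\<^sup>+x. P (x + h) \<partial>lborel) = (\<integral>\<^sup>+x. P x \<partial>lborel)"
      by (rule nn_integral_lborel_translate) measurable
    also have "(\<integral>\<^sup>+x. P x \<partial>lborel) + (\<integral>\<^sup>+x. P x \<partial>lborel) = ennreal (48 / r\<^sup>2) * cut_mass r u + ennreal (320 / r\<^sup>2) * poisson_mass r u"
    proof -
      have "ennreal (48 / r\<^sup>2) = ennreal (24 / r\<^sup>2) + ennreal (24 / r\<^sup>2)" "ennreal (320 / r\<^sup>2) = ennreal (160 / r\<^sup>2) + ennreal (160 / r\<^sup>2)"
        by (simp_all add: ennreal_plus[symmetric] add_divide_distrib[symmetric] del: ennreal_plus)
      then show ?thesis unfolding IP by (simp add: distrib_right add_ac)
    qed
    also have "(\<integral>\<^sup>+x. ennreal ((2^n)\<^sup>2 * F u x) \<partial>lborel) = dq (half_cos u) n + dq (half_sin u) n"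
      unfolding F_def h_def by (simp add: dq_half_sum)
    also have "4 * (dq (half_cos u) n + dq (half_sin u) n) \<le> 4 * half_angle_energy u"
      unfolding half_angle_energy_def by (intro mult_left_mono SUP_upper) auto
    finally show ?thesis by (simp add: add_right_mono)
  qed
  then have "(SUP n. 4 * (dq (half_cos (cutoff r u)) n + dq (half_sin (cutoff r u)) n))
     \<le> 4 * half_angle_energy u + (ennreal (48 / r\<^sup>2) * cut_mass r u + ennreal (320 / r\<^sup>2) * poisson_mass r u)"
    by (intro SUP_least)
  then show ?thesis unfolding half_angle_energy_def by (simp add: SUP_mult_left_ennreal)
qed

lemma ennreal_affine:
  "0 \<le> a \<Longrightarrow> 0 \<le> c \<Longrightarrow> 0 \<le> b \<Longrightarrow> ennreal (a + c * b) = ennreal a + ennreal c * ennreal b"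
  by (simp add: ennreal_mult)

text \<open>The exact value is \<open>pi / r\<close>, from the arctangent on each half-line; it is
  rounded up to avoid carrying \<open>pi\<close> along.\<close>

lemma nn_integral_inverse_square_shift:
  assumes r: "r > 0"
  shows "(\<integral>\<^sup>+x. ennreal (1 / (r\<^sup>2 + (x - a)\<^sup>2)) \<partial>lborel) \<le> ennreal (4 / r)"
proof -
  define f where "f x = 1 / (r\<^sup>2 + x\<^sup>2)" for x :: real
  have [measurable]: "f \<in> borel_measurable borel" unfolding f_def by measurable
  have pos: "r\<^sup>2 + x\<^sup>2 > 0" for x using r by (intro add_pos_nonneg) auto
  have half: "(\<integral>\<^sup>+x. ennreal (f x) * indicator {0..} x \<partial>lborel) = ennreal (pi / 2 / r - arctan (0 / r) / r)"
  proof (rule nn_integral_FTC_atLeast)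
    show "DERIV (\<lambda>x. arctan (x / r) / r) x :> f x" for x
    proof -
      have "((1 / r) / (1 + (x / r)\<^sup>2)) / r = f x"
      proof -
        have "1 + (x / r)\<^sup>2 = (r\<^sup>2 + x\<^sup>2) / r\<^sup>2" using r by (simp add: power_divide add_divide_distrib)
        then show ?thesis unfolding f_def using r by (simp add: power2_eq_square)
      qed
      moreover have "DERIV (\<lambda>x. arctan (x / r) / r) x :> ((1 / r) / (1 + (x / r)\<^sup>2)) / r"
        using r by (auto intro!: derivative_eq_intros simp: divide_inverse)
      ultimately show ?thesis by simp
    qed
    have "filterlim (\<lambda>x. x / r) at_top at_top" using r by real_asymp
    then have "((\<lambda>x. arctan (x / r)) \<longlongrightarrow> pi / 2) at_top" by (rule filterlim_compose[OF tendsto_arctan_at_top])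
    then show "((\<lambda>x. arctan (x / r) / r) \<longlongrightarrow> pi / 2 / r) at_top" using r by (intro tendsto_divide tendsto_const) auto
    show "0 \<le> f x" for x using pos[of x] by (simp add: f_def)
  qed measurable
  have "(\<integral>\<^sup>+x. ennreal (f x) * indicator {..0} x \<partial>lborel) = (\<integral>\<^sup>+x. ennreal (f x) * indicator {0..} x \<partial>lborel)"
    by (subst nn_integral_real_affine[of _ "-1" 0]) (auto simp: f_def indicator_def intro!: nn_integral_cong)
  note neg = this[unfolded half]
  have "(\<integral>\<^sup>+x. ennreal (1 / (r\<^sup>2 + (x - a)\<^sup>2)) \<partial>lborel) = (\<integral>\<^sup>+x. ennreal (f (x + (- a))) \<partial>lborel)" by (simp add: f_def)
  also have "\<dots> = (\<integral>\<^sup>+x. ennreal (f x) \<partial>lborel)"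
    by (rule nn_integral_lborel_translate[of "\<lambda>x. ennreal (f x)"]) measurable
  also have "\<dots> \<le> (\<integral>\<^sup>+x. ennreal (f x) * indicator {0..} x + ennreal (f x) * indicator {..0} x \<partial>lborel)"
    by (intro nn_integral_mono) (auto simp: indicator_def)
  also have "\<dots> = ennreal (pi / 2 / r) + ennreal (pi / 2 / r)"
    by (subst nn_integral_add) (simp_all add: half neg)
  also have "\<dots> = ennreal (pi / r)" using r by (simp add: ennreal_plus[symmetric] del: ennreal_plus)
  also have "\<dots> \<le> ennreal (4 / r)" using r pi_less_4 by (intro ennreal_leI divide_right_mono) auto
  finally show ?thesis .
qed

lemma nn_integral_inverse_square: "r > 0 \<Longrightarrow> (\<integral>\<^sup>+x. ennreal (1 / (r\<^sup>2 + x\<^sup>2)) \<partial>lborel) \<le> ennreal (4 / r)"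
  using nn_integral_inverse_square_shift[of r 0] by simp

lemma poisson_mass_finite:
  assumes u: "profile u" and r: "r > 0"
  shows "poisson_mass r u < \<infinity>"
proof -
  have "poisson_mass r u \<le> (\<integral>\<^sup>+x. 2 * ennreal (1 / (r\<^sup>2 + x\<^sup>2)) \<partial>lborel)"
    unfolding poisson_mass_def
  proof (intro nn_integral_mono)
    fix x
    have "u x / (r\<^sup>2 + x\<^sup>2) \<le> 2 * (1 / (r\<^sup>2 + x\<^sup>2))" using u by (auto simp: profile_def intro!: divide_right_mono)
    then have "ennreal (u x / (r\<^sup>2 + x\<^sup>2)) \<le> ennreal (2 * (1 / (r\<^sup>2 + x\<^sup>2)))" by (rule ennreal_leI)
    then show "ennreal (u x / (r\<^sup>2 + x\<^sup>2)) \<le> 2 * ennreal (1 / (r\<^sup>2 + x\<^sup>2))" by (subst (asm) ennreal_mult) auto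
  qed
  also have "\<dots> = 2 * (\<integral>\<^sup>+x. ennreal (1 / (r\<^sup>2 + x\<^sup>2)) \<partial>lborel)" by (rule nn_integral_cmult) measurable
  also have "\<dots> \<le> 2 * ennreal (4 / r)" by (intro mult_left_mono nn_integral_inverse_square r) auto
  also have "\<dots> < \<infinity>" by (simp add: ennreal_mult_less_top)
  finally show ?thesis .
qed

text \<open>The error is brought into a sum of products of a function of \<open>s\<close> and a
  function of \<open>t\<close>, so that its double integral factors into \<open>cut_mass\<close> and
  \<open>poisson_mass\<close>. Increments of the ramp are bounded both by \<open>d / r\<close> and
  by 1, and on the support of the ramp \<open>r^2 + d^2\<close> controls the Poisson weight at the
  other point. The constant is \<open>288 = 2 * 8 * 2 * 9\<close>.\<close>

lemma cutoff_kernel_pointwise: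
  assumes u: "\<And>x. 0 \<le> u x" and r: "r > 0"
  shows "\<bar>cutoff r u s - cutoff r u t\<bar>\<^sup>2 / \<bar>s - t\<bar>\<^sup>2 \<le> \<bar>u s - u t\<bar>\<^sup>2 / \<bar>s - t\<bar>\<^sup>2
    + 288 * (((ramp r s)\<^sup>2 * u s) * (u t / (r\<^sup>2 + t\<^sup>2)) + ((ramp r t)\<^sup>2 * u t) * (u s / (r\<^sup>2 + s\<^sup>2)))"
proof (cases "s = t")
  case True
  then show ?thesis using u by simp
next
  case False
  define d where "d = \<bar>s - t\<bar>"
  have d: "d > 0" using False by (simp add: d_def)
  define x where "x = ramp r s" define y where "y = ramp r t"
  have pos: "r\<^sup>2 + z\<^sup>2 > 0" for z using r by (intro add_pos_nonneg) auto
  have xy: "(x - y)\<^sup>2 \<le> d\<^sup>2 * (2 / (r\<^sup>2 + d\<^sup>2))"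
  proof -
    have "\<bar>x - y\<bar> \<le> \<bar>d / r\<bar>" using ramp_lipschitz[OF r, of s t] r by (simp add: x_def y_def d_def)
    then have "(x - y)\<^sup>2 \<le> (d / r)\<^sup>2" by (rule abs_le_square_iff[THEN iffD1])
    then have 1: "(x - y)\<^sup>2 * r\<^sup>2 \<le> d\<^sup>2" using r by (simp add: power_divide field_simps)
    have "\<bar>x - y\<bar> \<le> \<bar>1\<bar>" using ramp_bounds[of r s] ramp_bounds[of r t] by (auto simp: x_def y_def abs_le_iff)
    then have "(x - y)\<^sup>2 \<le> 1\<^sup>2" by (rule abs_le_square_iff[THEN iffD1])
    then have "(x - y)\<^sup>2 * d\<^sup>2 \<le> 1 * d\<^sup>2" by (intro mult_right_mono) auto
    with 1 have "(x - y)\<^sup>2 * (r\<^sup>2 + d\<^sup>2) \<le> 2 * d\<^sup>2" by (simp add: distrib_left)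
    then show ?thesis using pos[of d] by (simp add: field_simps)
  qed
  have far: "(ramp r z)\<^sup>2 * (1 / (r\<^sup>2 + d\<^sup>2)) \<le> (ramp r z)\<^sup>2 * (9 / (r\<^sup>2 + z'\<^sup>2))" if z: "\<bar>z - z'\<bar> = d" for z z'
  proof (cases "\<bar>z\<bar> \<le> 2 * r")
    case True
    have "\<bar>z'\<bar> \<le> \<bar>d + 2 * r\<bar>" using True z r d by (auto simp: abs_if split: if_splits)
    then have "z'\<^sup>2 \<le> (d + 2 * r)\<^sup>2" by (rule abs_le_square_iff[THEN iffD1])
    also have "\<dots> \<le> 2 * d\<^sup>2 + 8 * r\<^sup>2" using zero_le_power2[of "d - 2 * r"] by (simp add: power2_eq_square algebra_simps)
    also have "\<dots> \<le> 9 * d\<^sup>2 + 8 * r\<^sup>2" by simp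
    finally have "r\<^sup>2 + z'\<^sup>2 \<le> 9 * (r\<^sup>2 + d\<^sup>2)" by (simp add: distrib_left)
    then have "1 / (r\<^sup>2 + d\<^sup>2) \<le> 9 / (r\<^sup>2 + z'\<^sup>2)" using pos[of d] pos[of z'] by (simp add: field_simps)
    then show ?thesis by (intro mult_left_mono) auto
  next
    case False then show ?thesis using r by (simp add: ramp_outside)
  qed
  define a where "a = u s" define b where "b = u t"
  have ab: "a \<ge> 0" "b \<ge> 0" using u by (auto simp: a_def b_def)
  have "(cut_angle r s - cut_angle r t)\<^sup>2 \<le> 8 * (x - y)\<^sup>2 * (x\<^sup>2 + y\<^sup>2)" unfolding x_def y_def by (rule cut_angle_diff)
  also have "\<dots> \<le> 8 * (d\<^sup>2 * (2 / (r\<^sup>2 + d\<^sup>2))) * (x\<^sup>2 + y\<^sup>2)" by (intro mult_right_mono mult_left_mono xy) auto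
  also have "\<dots> = d\<^sup>2 * (16 * (x\<^sup>2 * (1 / (r\<^sup>2 + d\<^sup>2)) + y\<^sup>2 * (1 / (r\<^sup>2 + d\<^sup>2))))" by (simp add: algebra_simps add_divide_distrib)
  also have "\<dots> \<le> d\<^sup>2 * (16 * (x\<^sup>2 * (9 / (r\<^sup>2 + t\<^sup>2)) + y\<^sup>2 * (9 / (r\<^sup>2 + s\<^sup>2))))"
    unfolding x_def y_def by (intro mult_left_mono add_mono far) (auto simp: d_def)
  finally have cut_angle: "(cut_angle r s - cut_angle r t)\<^sup>2 \<le> d\<^sup>2 * (16 * (x\<^sup>2 * (9 / (r\<^sup>2 + t\<^sup>2)) + y\<^sup>2 * (9 / (r\<^sup>2 + s\<^sup>2))))" .
  have "(cutoff r u s - cutoff r u t)\<^sup>2 \<le> (a - b)\<^sup>2 + 2 * (cut_angle r s - cut_angle r t)\<^sup>2 * (a * b)"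
    unfolding a_def b_def using u by (rule cutoff_difference)
  also have "\<dots> \<le> (a - b)\<^sup>2 + 2 * (d\<^sup>2 * (16 * (x\<^sup>2 * (9 / (r\<^sup>2 + t\<^sup>2)) + y\<^sup>2 * (9 / (r\<^sup>2 + s\<^sup>2))))) * (a * b)"
    using ab by (intro add_left_mono mult_right_mono mult_left_mono cut_angle) auto
  also have "\<dots> = (a - b)\<^sup>2 + d\<^sup>2 * (288 * ((x\<^sup>2 * a) * (b / (r\<^sup>2 + t\<^sup>2)) + (y\<^sup>2 * b) * (a / (r\<^sup>2 + s\<^sup>2))))"
    by (simp add: algebra_simps)
  finally have "(cutoff r u s - cutoff r u t)\<^sup>2 / d\<^sup>2 \<le> ((a - b)\<^sup>2 + d\<^sup>2 * (288 * ((x\<^sup>2 * a) * (b / (r\<^sup>2 + t\<^sup>2)) + (y\<^sup>2 * b) * (a / (r\<^sup>2 + s\<^sup>2))))) / d\<^sup>2"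
    by (intro divide_right_mono) auto
  also have "\<dots> = (a - b)\<^sup>2 / d\<^sup>2 + 288 * ((x\<^sup>2 * a) * (b / (r\<^sup>2 + t\<^sup>2)) + (y\<^sup>2 * b) * (a / (r\<^sup>2 + s\<^sup>2)))"
    using d by (simp add: add_divide_distrib)
  finally show ?thesis by (simp add: a_def b_def x_def y_def d_def)
qed

definition gagliardo :: "(real \<Rightarrow> real) \<Rightarrow> ennreal" where
  "gagliardo f = (\<integral>\<^sup>+t. (\<integral>\<^sup>+s. ennreal (\<bar>f s - f t\<bar>\<^sup>2 / \<bar>s - t\<bar>\<^sup>2) \<partial>lborel) \<partial>lborel)"

lemma Hdot_gagliardo: "Hdot_half_sq f = ennreal (1 / (2 * pi)) * gagliardo f"
  by (simp add: Hdot_half_sq_def gagliardo_def)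

text \<open>Both mixed products integrate to the same value, hence \<open>576 = 2 * 288\<close>;
  with \<open>1 / (2 * pi) \<le> 1 / 4\<close> this becomes 144.\<close>

lemma Hdot_cutoff:
  assumes u: "profile u" and r: "r > 0"
  shows "Hdot_half_sq (cutoff r u) \<le> Hdot_half_sq u + 144 * (cut_mass r u * poisson_mass r u)"
proof -
  have ub: "0 \<le> u x" for x using u by (simp add: profile_def)
  have [measurable]: "u \<in> borel_measurable borel" "cutoff r u \<in> borel_measurable borel"
    using u profile_cutoff(1)[OF u] r by (auto dest: profile_measurable)
  define A where "A x = ennreal ((ramp r x)\<^sup>2 * u x)" for x
  define B where "B x = ennreal (u x / (r\<^sup>2 + x\<^sup>2))" for x
  have [measurable]: "A \<in> borel_measurable borel" "B \<in> borel_measurable borel" unfolding A_def B_def by measurable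
  have "gagliardo (cutoff r u) \<le> (\<integral>\<^sup>+t. (\<integral>\<^sup>+s. ennreal (\<bar>u s - u t\<bar>\<^sup>2 / \<bar>s - t\<bar>\<^sup>2) + 288 * (B t * A s + A t * B s) \<partial>lborel) \<partial>lborel)"
    unfolding gagliardo_def
  proof (intro nn_integral_mono)
    fix s t
    have nn: "0 \<le> u z / (r\<^sup>2 + z\<^sup>2)" for z using ub[of z] by simp
    have aux: "288 * (ennreal b * ennreal a + ennreal c * ennreal d) = ennreal (288 * (a * b + c * d))"
      if "0 \<le> a" "0 \<le> b" "0 \<le> c" "0 \<le> d" for a b c d
      using that by (simp add: ennreal_mult mult.commute)
    have "288 * (B t * A s + A t * B s) = ennreal (288 * (((ramp r s)\<^sup>2 * u s) * (u t / (r\<^sup>2 + t\<^sup>2)) + ((ramp r t)\<^sup>2 * u t) * (u s / (r\<^sup>2 + s\<^sup>2))))"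
      unfolding A_def B_def using ub nn by (intro aux) auto
    then have "ennreal (\<bar>u s - u t\<bar>\<^sup>2 / \<bar>s - t\<bar>\<^sup>2) + 288 * (B t * A s + A t * B s)
      = ennreal (\<bar>u s - u t\<bar>\<^sup>2 / \<bar>s - t\<bar>\<^sup>2
    + 288 * (((ramp r s)\<^sup>2 * u s) * (u t / (r\<^sup>2 + t\<^sup>2)) + ((ramp r t)\<^sup>2 * u t) * (u s / (r\<^sup>2 + s\<^sup>2))))"
      using ub nn by (subst ennreal_plus) auto
    then show "ennreal (\<bar>cutoff r u s - cutoff r u t\<bar>\<^sup>2 / \<bar>s - t\<bar>\<^sup>2) \<le> ennreal (\<bar>u s - u t\<bar>\<^sup>2 / \<bar>s - t\<bar>\<^sup>2) + 288 * (B t * A s + A t * B s)"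
      using ennreal_leI[OF cutoff_kernel_pointwise[of u r s t, OF ub r]] by simp
  qed
  also have "\<dots> = gagliardo u + 288 * ((\<integral>\<^sup>+t. B t \<partial>lborel) * (\<integral>\<^sup>+s. A s \<partial>lborel) + (\<integral>\<^sup>+t. A t \<partial>lborel) * (\<integral>\<^sup>+s. B s \<partial>lborel))"
    unfolding gagliardo_def by (simp add: nn_integral_add nn_integral_cmult nn_integral_multc)
  also have "\<dots> = gagliardo u + 576 * (cut_mass r u * poisson_mass r u)"
  proof -
    have "(288::ennreal) * (y * x + x * y) = 576 * (x * y)" for x y :: ennreal
      by (simp add: mult.commute[of y x] flip: mult_2 mult.assoc)
    then show ?thesis unfolding cut_mass_def poisson_mass_def A_def B_def by simp
  qed
  finally have "Hdot_half_sq (cutoff r u) \<le> ennreal (1 / (2 * pi)) * (gagliardo u + 576 * (cut_mass r u * poisson_mass r u))"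
    unfolding Hdot_gagliardo by (rule mult_left_mono) simp
  also have "\<dots> = Hdot_half_sq u + (ennreal (1 / (2 * pi)) * 576) * (cut_mass r u * poisson_mass r u)"
    by (simp add: Hdot_gagliardo distrib_left mult.assoc)
  also have "\<dots> \<le> Hdot_half_sq u + 144 * (cut_mass r u * poisson_mass r u)"
  proof (intro add_left_mono mult_right_mono)
    have "ennreal (1 / (2 * pi)) * ennreal 576 \<le> ennreal (1 / 4) * ennreal 576"
      using pi_ge_two by (intro mult_right_mono ennreal_leI frac_le) auto
    also have "\<dots> = ennreal 144" by (subst ennreal_mult[symmetric]) auto
    finally show "ennreal (1 / (2 * pi)) * 576 \<le> 144" by simp
  qed simp
  finally show ?thesis .
qed

text \<open>The mean value theorem for the sine, whose slope on \<open>{0..y}\<close> is at least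
  \<open>cos y\<close>.\<close>

lemma x_cos_le_sin:
  assumes "0 \<le> y" "y \<le> pi / 2"
  shows "y * cos y \<le> sin y"
proof (cases "y = 0")
  case False
  then obtain z where z: "0 < z" "z < y" "sin y - sin 0 = (y - 0) * cos z"
    using MVT2[of 0 y sin cos] assms by (auto intro: DERIV_sin)
  have "cos z \<ge> cos y" using z assms by (intro cos_monotone_0_pi_le) auto
  then show ?thesis using z assms by (simp add: mult_left_mono)
qed simp

text \<open>For \<open>y = x / 2\<close> the double angle formula and
  \<open>y * cos y \<le> sin y\<close> give \<open>sin x \<ge> 2 * y * (cos y)^2\<close>, and the
  squared cosine is at least \<open>1 / 2\<close>.\<close>

lemma half_le_sin:
  assumes "0 \<le> x" "x \<le> pi / 2"
  shows "x / 2 \<le> sin x"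
proof (cases "x = 0")
  case False
  define y where "y = x / 2"
  have y: "0 < y" "y \<le> pi / 4" using assms False by (auto simp: y_def)
  have c: "cos y \<ge> 0" using y pi_gt_zero by (intro cos_ge_zero) linarith+
  have "y * cos y \<le> sin y" using y pi_gt_zero by (intro x_cos_le_sin) linarith+
  then have "2 * (y * cos y) * cos y \<le> 2 * sin y * cos y" using c by (intro mult_right_mono) auto
  also have "\<dots> = sin x" using sin_double[of y] by (simp add: y_def)
  finally have 1: "2 * y * (cos y)\<^sup>2 \<le> sin x" by (simp add: power2_eq_square mult.assoc)
  have "cos (pi / 4) \<le> cos y" using y pi_gt_zero by (intro cos_monotone_0_pi_le) linarith+
  then have "(cos (pi / 4))\<^sup>2 \<le> (cos y)\<^sup>2" by (intro power_mono) (simp_all add: cos_45)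
  then have "1 / 2 \<le> (cos y)\<^sup>2" by (simp add: cos_45 power_divide)
  then have "2 * y * (1 / 2) \<le> 2 * y * (cos y)\<^sup>2" using y by (intro mult_left_mono) auto
  with 1 show ?thesis by (simp add: y_def)
qed simp

text \<open>Cutting removes at least a quarter of the squared L2 norm of \<open>ramp^2 * u\<close>,
  since \<open>1 - cos^4 \<ge> sin^2\<close> and \<open>sin x \<ge> x / 2\<close>. Cauchy-Schwarz on
  the support of the ramp, of length \<open>4 * r\<close>, turns this into
  \<open>cut_mass^2 / (16 * r)\<close>. This saving, quadratic in the removed mass, pays for the
  errors of the cut.\<close>

lemma L2_cutoff:
  assumes u: "profile u" and r: "r > 0"
  shows "L2_norm_sq (cutoff r u) + ennreal (1 / (16 * r)) * (cut_mass r u)\<^sup>2 \<le> L2_norm_sq u"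
    and "(cut_mass r u)\<^sup>2 \<le> ennreal (16 * r) * L2_norm_sq u"
proof -
  have ub: "0 \<le> u x" for x using u by (simp add: profile_def)
  have [measurable]: "u \<in> borel_measurable borel" "cutoff r u \<in> borel_measurable borel"
    using u profile_cutoff(1)[OF u] r by (auto dest: profile_measurable)
  define G where "G = (\<integral>\<^sup>+x. ennreal (((ramp r x)\<^sup>2 * u x)\<^sup>2) \<partial>lborel)"
  have "cut_mass r u = (\<integral>\<^sup>+x. ennreal ((ramp r x)\<^sup>2 * u x) * indicator {-2*r..2*r} x \<partial>lborel)"
    unfolding cut_mass_def
  proof (intro nn_integral_cong)
    fix x show "ennreal ((ramp r x)\<^sup>2 * u x) = ennreal ((ramp r x)\<^sup>2 * u x) * indicator {-2*r..2*r} x"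
      using ramp_outside[OF r, of x] by (cases "x \<in> {-2*r..2*r}") auto
  qed
  then have "(cut_mass r u)\<^sup>2 \<le> (\<integral>\<^sup>+x. (ennreal ((ramp r x)\<^sup>2 * u x))\<^sup>2 \<partial>lborel) * (\<integral>\<^sup>+x. (indicator {-2*r..2*r} x)\<^sup>2 \<partial>lborel)"
    by (simp only:) (rule Cauchy_Schwarz_nn_integral; measurable)
  also have "(\<integral>\<^sup>+x. (ennreal ((ramp r x)\<^sup>2 * u x))\<^sup>2 \<partial>lborel) = G"
    unfolding G_def using ub by (intro nn_integral_cong) (simp add: ennreal_power)
  also have "(\<integral>\<^sup>+x. (indicator {-2*r..2*r} x)\<^sup>2 \<partial>lborel) = (\<integral>\<^sup>+x. indicator {-2*r..2*r} x \<partial>lborel)"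
    by (intro nn_integral_cong) (auto simp: indicator_def)
  also have "\<dots> = ennreal (4 * r)" using r by simp
  finally have mG: "(cut_mass r u)\<^sup>2 \<le> G * ennreal (4 * r)" .
  have "L2_norm_sq (cutoff r u) + ennreal (1/4) * G = (\<integral>\<^sup>+x. ennreal ((cutoff r u x)\<^sup>2) + ennreal (1/4) * ennreal (((ramp r x)\<^sup>2 * u x)\<^sup>2) \<partial>lborel)"
    unfolding L2_norm_sq_def G_def by (simp add: nn_integral_add nn_integral_cmult)
  also have "\<dots> \<le> L2_norm_sq u"
    unfolding L2_norm_sq_def
  proof (intro nn_integral_mono)
    fix x
    define c where "c = (cos (cut_angle r x))\<^sup>2"
    have c: "0 \<le> c" "c \<le> 1" by (auto simp: c_def abs_square_le_1)
    have "(ramp r x)\<^sup>2 / 2 \<le> cut_angle r x / 2" 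
      using mult_right_mono[OF pi_ge_two, of "(ramp r x)\<^sup>2"] by (simp add: cut_angle_def)
    also have "\<dots> \<le> sin (cut_angle r x)" by (intro half_le_sin cut_angle_bounds)
    finally have "((ramp r x)\<^sup>2 / 2)\<^sup>2 \<le> (sin (cut_angle r x))\<^sup>2" by (intro power_mono) auto
    then have "((ramp r x)\<^sup>2)\<^sup>2 / 4 \<le> 1 - c" by (simp add: c_def sin_squared_eq power_divide)
    moreover have "c\<^sup>2 \<le> c" using c by (simp add: power2_eq_square mult_left_le)
    ultimately have "c\<^sup>2 + ((ramp r x)\<^sup>2)\<^sup>2 / 4 \<le> 1" by linarith
    then have "(c\<^sup>2 + ((ramp r x)\<^sup>2)\<^sup>2 / 4) * (u x)\<^sup>2 \<le> 1 * (u x)\<^sup>2" by (intro mult_right_mono) auto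
    then have "(cutoff r u x)\<^sup>2 + 1/4 * ((ramp r x)\<^sup>2 * u x)\<^sup>2 \<le> (u x)\<^sup>2"
      by (simp add: cutoff_def c_def power_mult_distrib algebra_simps)
    from ennreal_leI[OF this] show "ennreal ((cutoff r u x)\<^sup>2) + ennreal (1/4) * ennreal (((ramp r x)\<^sup>2 * u x)\<^sup>2) \<le> ennreal ((norm (u x))\<^sup>2)"
      using ennreal_affine[of "(cutoff r u x)\<^sup>2" "1/4" "((ramp r x)\<^sup>2 * u x)\<^sup>2"] by simp
  qed
  finally have 1: "L2_norm_sq (cutoff r u) + ennreal (1/4) * G \<le> L2_norm_sq u" .
  have "ennreal (1 / (16 * r)) * (cut_mass r u)\<^sup>2 \<le> ennreal (1 / (16 * r)) * (G * ennreal (4 * r))" by (intro mult_left_mono mG) simp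
  also have "\<dots> = (ennreal (1 / (16 * r)) * ennreal (4 * r)) * G" by (simp add: mult_ac)
  also have "ennreal (1 / (16 * r)) * ennreal (4 * r) = ennreal (1/4)" using r by (subst ennreal_mult[symmetric]) auto
  finally have "L2_norm_sq (cutoff r u) + ennreal (1 / (16 * r)) * (cut_mass r u)\<^sup>2 \<le> L2_norm_sq (cutoff r u) + ennreal (1/4) * G" by (rule add_left_mono)
  with 1 show "L2_norm_sq (cutoff r u) + ennreal (1 / (16 * r)) * (cut_mass r u)\<^sup>2 \<le> L2_norm_sq u" by (rule order_trans[rotated])
  have "ennreal (1/4) * G \<le> L2_norm_sq u" by (rule order_trans[OF _ 1]) simp
  then have "ennreal (16 * r) * (ennreal (1/4) * G) \<le> ennreal (16 * r) * L2_norm_sq u" by (rule mult_left_mono) simp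
  also have "ennreal (16 * r) * (ennreal (1/4) * G) = G * ennreal (4 * r)"
    using r by (subst mult.assoc[symmetric], subst ennreal_mult[symmetric]) (auto simp: mult.commute)
  finally show "(cut_mass r u)\<^sup>2 \<le> ennreal (16 * r) * L2_norm_sq u" using mG by (rule order_trans[rotated])
qed

text \<open>The removed part is at most \<open>4 * ramp^2 * u\<close>, and the Poisson weight is at
  most \<open>1 / r^2\<close>. The cost of the cut can thereby be expressed through the Poisson mass
  of what remains.\<close>

lemma poisson_mass_cutoff:
  assumes u: "profile u" and r: "r > 0"
  shows "poisson_mass r u \<le> poisson_mass r (cutoff r u) + ennreal (4 / r\<^sup>2) * cut_mass r u"
proof -
  have ub: "0 \<le> u x" for x using u by (simp add: profile_def)
  have pb: "0 \<le> cutoff r u x" for x using profile_cutoff(3)[OF u r] .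
  have [measurable]: "u \<in> borel_measurable borel" "cutoff r u \<in> borel_measurable borel"
    using u profile_cutoff(1)[OF u] r by (auto dest: profile_measurable)
  have "poisson_mass r u \<le> (\<integral>\<^sup>+x. ennreal (cutoff r u x / (r\<^sup>2 + x\<^sup>2)) + ennreal (4 / r\<^sup>2) * ennreal ((ramp r x)\<^sup>2 * u x) \<partial>lborel)"
    unfolding poisson_mass_def
  proof (intro nn_integral_mono)
    fix x
    define y where "y = ramp r x"
    have y: "0 \<le> y" "y \<le> 1" using ramp_bounds by (auto simp: y_def)
    have pos: "r\<^sup>2 + x\<^sup>2 > 0" using r by (intro add_pos_nonneg) auto
    have "(sin (cut_angle r x))\<^sup>2 \<le> (cut_angle r x)\<^sup>2" using abs_sin_x_le_abs_x[of "cut_angle r x"] by (rule abs_le_square_iff[THEN iffD1])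
    also have "\<dots> = (pi / 2)\<^sup>2 * (y\<^sup>2 * y\<^sup>2)" by (simp add: cut_angle_def y_def power_mult_distrib power2_eq_square)
    also have "\<dots> \<le> 2\<^sup>2 * (y\<^sup>2 * 1)" using pi_less_4 y by (intro mult_mono power_mono) (auto simp: power_le_one)
    finally have "(sin (cut_angle r x))\<^sup>2 * u x \<le> 4 * y\<^sup>2 * u x" using ub by (intro mult_right_mono) auto
    then have "u x \<le> cutoff r u x + 4 * (y\<^sup>2 * u x)" by (simp add: cutoff_def sin_squared_eq algebra_simps)
    then have "u x / (r\<^sup>2 + x\<^sup>2) \<le> (cutoff r u x + 4 * (y\<^sup>2 * u x)) / (r\<^sup>2 + x\<^sup>2)" using pos by (intro divide_right_mono) auto
    also have "\<dots> = cutoff r u x / (r\<^sup>2 + x\<^sup>2) + 4 * (y\<^sup>2 * u x) / (r\<^sup>2 + x\<^sup>2)" by (rule add_divide_distrib)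
    also have "4 * (y\<^sup>2 * u x) / (r\<^sup>2 + x\<^sup>2) \<le> 4 * (y\<^sup>2 * u x) / r\<^sup>2" using ub r by (intro divide_left_mono) (auto intro!: mult_pos_pos add_pos_nonneg)
    finally have "u x / (r\<^sup>2 + x\<^sup>2) \<le> cutoff r u x / (r\<^sup>2 + x\<^sup>2) + 4 / r\<^sup>2 * (y\<^sup>2 * u x)" by simp
    then have "ennreal (u x / (r\<^sup>2 + x\<^sup>2)) \<le> ennreal (cutoff r u x / (r\<^sup>2 + x\<^sup>2) + 4 / r\<^sup>2 * (y\<^sup>2 * u x))" by (rule ennreal_leI)
    also have "\<dots> = ennreal (cutoff r u x / (r\<^sup>2 + x\<^sup>2)) + ennreal (4 / r\<^sup>2) * ennreal ((ramp r x)\<^sup>2 * u x)"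
      unfolding y_def using pb[of x] ub[of x] pos by (intro ennreal_affine) auto
    finally show "ennreal (u x / (r\<^sup>2 + x\<^sup>2)) \<le> ennreal (cutoff r u x / (r\<^sup>2 + x\<^sup>2)) + ennreal (4 / r\<^sup>2) * ennreal ((ramp r x)\<^sup>2 * u x)" .
  qed
  also have "\<dots> = poisson_mass r (cutoff r u) + ennreal (4 / r\<^sup>2) * cut_mass r u"
    unfolding poisson_mass_def cut_mass_def by (simp add: nn_integral_add nn_integral_cmult)
  finally show ?thesis .
qed

text \<open>The saving \<open>X^2 / (16 * r)\<close> is split: one half absorbs the errors quadratic
  in the removed mass \<open>X\<close>, the other half, by completing the square, those linear in
  \<open>X\<close>. The final cost no longer involves \<open>X\<close>.\<close>

lemma cutoff_energy:
  assumes u: "profile u" and r: "r \<ge> 18432" and fin: "profile_energy u < \<infinity>"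
  obtains v where "poisson_mass r (cutoff r u) = ennreal v" "v \<ge> 0"
    "profile_energy (cutoff r u) \<le> profile_energy u + ennreal (30000000 * (r * v\<^sup>2 + 1 / r^3))"
proof -
  have r0: "r > 0" "r \<ge> 1" using r by auto
  have p: "profile (cutoff r u)" by (rule profile_cutoff(1)[OF u r0(1)])
  have "L2_norm_sq u < \<infinity>" using fin by (simp add: profile_energy_def)
  then have "ennreal (16 * r) * L2_norm_sq u < \<infinity>" by (simp add: ennreal_mult_less_top)
  with L2_cutoff(2)[OF u r0(1)] have "(cut_mass r u)\<^sup>2 < \<infinity>" by (rule le_less_trans)
  then have "cut_mass r u < \<infinity>" by (simp add: power2_eq_square ennreal_mult_less_top) (metis ennreal_top_mult less_top not_less_zero top_neq_ennreal zero_less_iff_neq_zero)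
  then obtain X where X: "cut_mass r u = ennreal X" "X \<ge> 0" by (cases "cut_mass r u") auto
  obtain V where V: "poisson_mass r u = ennreal V" "V \<ge> 0" using poisson_mass_finite[OF u r0(1)] by (cases "poisson_mass r u") auto
  obtain v where v: "poisson_mass r (cutoff r u) = ennreal v" "v \<ge> 0" using poisson_mass_finite[OF p r0(1)] by (cases "poisson_mass r (cutoff r u)") auto
  obtain E where E: "profile_energy u = ennreal E" "E \<ge> 0" using fin by (cases "profile_energy u") auto
  have Vv: "V \<le> v + 4 * X / r\<^sup>2"
    using poisson_mass_cutoff[OF u r0(1)] X V v unfolding X(1) V(1) v(1)
    by (simp add: ennreal_mult[symmetric] ennreal_plus[symmetric] del: ennreal_plus)
  have "profile_energy (cutoff r u) + ennreal (1 / (16 * r)) * (cut_mass r u)\<^sup>2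
     = 4 * half_angle_energy (cutoff r u) + Hdot_half_sq (cutoff r u) + (L2_norm_sq (cutoff r u) + ennreal (1 / (16 * r)) * (cut_mass r u)\<^sup>2)"
    by (simp add: profile_energy_def add.assoc)
  also have "\<dots> \<le> (4 * half_angle_energy u + (ennreal (48 / r\<^sup>2) * cut_mass r u + ennreal (320 / r\<^sup>2) * poisson_mass r u))
     + (Hdot_half_sq u + 144 * (cut_mass r u * poisson_mass r u)) + L2_norm_sq u"
    by (intro add_mono half_angle_energy_cutoff Hdot_cutoff L2_cutoff u r0)
  also have "\<dots> = profile_energy u + (ennreal (48 / r\<^sup>2) * cut_mass r u + ennreal (320 / r\<^sup>2) * poisson_mass r u + 144 * (cut_mass r u * poisson_mass r u))"
    by (simp add: profile_energy_def add_ac)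
  also have "\<dots> = ennreal (E + (48 / r\<^sup>2 * X + 320 / r\<^sup>2 * V + 144 * (X * V)))"
  proof -
    have "ennreal c + (ennreal a * ennreal x + ennreal b * ennreal y + 144 * (ennreal x * ennreal y))
      = ennreal (c + (a * x + b * y + 144 * (x * y)))" if "0 \<le> a" "0 \<le> b" "0 \<le> c" "0 \<le> x" "0 \<le> y" for a b c x y
      using that by (simp add: ennreal_mult)
    then show ?thesis unfolding X(1) V(1) E(1) using X(2) V(2) E(2) by simp
  qed
  finally have main: "profile_energy (cutoff r u) + ennreal (1 / (16 * r)) * (cut_mass r u)\<^sup>2 \<le> ennreal (E + (48 / r\<^sup>2 * X + 320 / r\<^sup>2 * V + 144 * (X * V)))" .
  then have "profile_energy (cutoff r u) < \<infinity>" by (auto simp: less_top[symmetric] top_unique)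
  then obtain e where e: "profile_energy (cutoff r u) = ennreal e" "e \<ge> 0" by (cases "profile_energy (cutoff r u)") auto
  have "ennreal (e + 1 / (16 * r) * X\<^sup>2) \<le> ennreal (E + (48 / r\<^sup>2 * X + 320 / r\<^sup>2 * V + 144 * (X * V)))"
    using main ennreal_affine[of e "1 / (16 * r)" "X\<^sup>2"] e(2) r0 X(2) unfolding e(1) X(1) by (simp add: ennreal_power)
  then have 1: "e + X\<^sup>2 / (16 * r) \<le> E + (48 / r\<^sup>2 * X + 320 / r\<^sup>2 * V + 144 * (X * V))"
    using E X V r0 by (subst (asm) ennreal_le_iff) auto
  define q where "q = 1 / r\<^sup>2"
  have q: "q > 0" "q \<le> 1" using r0 by (auto simp: q_def)
  have Vq: "V \<le> v + 4 * X * q" using Vv by (simp add: q_def)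
  \<comment> \<open>Inserting the bound \<open>Vq\<close> for \<open>V\<close> produces the
    coefficients \<open>1328 = 48 + 4 * 320\<close> and \<open>576 = 4 * 144\<close>.\<close>
  have "X * V \<le> X * (v + 4 * X * q)" using Vq X by (intro mult_left_mono) auto
  moreover have "320 * q * V \<le> 320 * q * (v + 4 * X * q)" using Vq q by (intro mult_left_mono) auto
  moreover have "q * (X * q) \<le> 1 * (X * q)" using q X by (intro mult_right_mono) auto
  ultimately have 2: "e + X\<^sup>2 / (16 * r) \<le> E + X * (144 * v + 1328 * q) + 576 * q * X\<^sup>2 + 320 * q * v"
    using 1 by (simp add: q_def[symmetric] algebra_simps power2_eq_square)
      (simp add: q_def algebra_simps power2_eq_square)
  \<comment> \<open>The threshold \<open>18432 = 32 * 576\<close> for \<open>r\<close> is chosen for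
    this inequality.\<close>
  have "576 * q \<le> 1 / (32 * r)" unfolding q_def using r by (simp add: field_simps power2_eq_square)
  then have "576 * q * X\<^sup>2 \<le> 1 / (32 * r) * X\<^sup>2" by (rule mult_right_mono) simp
  moreover have "X\<^sup>2 / (16 * r) = 1 / (32 * r) * X\<^sup>2 + 1 / (32 * r) * X\<^sup>2" by simp
  ultimately have 3: "e \<le> E + (X * (144 * v + 1328 * q) - 1 / (32 * r) * X\<^sup>2) + 320 * q * v" using 2 by linarith
  define a where "a = 144 * v + 1328 * q"
  have "0 \<le> (X - 16 * r * a)\<^sup>2 / (32 * r)" using r0 by simp
  also have "\<dots> = 1 / (32 * r) * X\<^sup>2 - X * a + 8 * r * a\<^sup>2" using r0 by (simp add: power2_eq_square field_simps)
  finally have 4: "X * a - 1 / (32 * r) * X\<^sup>2 \<le> 8 * r * a\<^sup>2" by linarith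
  have "a\<^sup>2 \<le> 2 * (144 * v)\<^sup>2 + 2 * (1328 * q)\<^sup>2"
    using zero_le_power2[of "144 * v - 1328 * q"] unfolding a_def by (simp add: power2_eq_square algebra_simps)
  then have 5: "8 * r * a\<^sup>2 \<le> 8 * r * (2 * (144 * v)\<^sup>2 + 2 * (1328 * q)\<^sup>2)" using r0 by (intro mult_left_mono) auto
  have 6: "320 * q * v \<le> 160 * (r * v\<^sup>2 + r * q\<^sup>2)"
  proof -
    have "2 * (q * v) \<le> v\<^sup>2 + q\<^sup>2" using zero_le_power2[of "v - q"] by (simp add: power2_eq_square algebra_simps)
    also have "\<dots> \<le> r * (v\<^sup>2 + q\<^sup>2)" using mult_right_mono[of 1 r "v\<^sup>2 + q\<^sup>2"] r0 by simp
    finally show ?thesis by (simp add: algebra_simps)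
  qed
  have rq: "r * q\<^sup>2 = 1 / r^3" using r0 by (simp add: q_def power2_eq_square power3_eq_cube)
  have "e \<le> E + 8 * r * (2 * (144 * v)\<^sup>2 + 2 * (1328 * q)\<^sup>2) + 160 * (r * v\<^sup>2 + r * q\<^sup>2)"
    using 3 4 5 6 unfolding a_def by linarith
  \<comment> \<open>\<open>331936 = 16 * 144^2 + 160\<close> and
    \<open>28217504 = 16 * 1328^2 + 160\<close>; both are then rounded up to a single
    constant.\<close>
  also have "\<dots> = E + 331936 * (r * v\<^sup>2) + 28217504 * (r * q\<^sup>2)" by (simp add: power_mult_distrib algebra_simps)
  also have "\<dots> \<le> E + 30000000 * (r * v\<^sup>2 + r * q\<^sup>2)"
    using mult_nonneg_nonneg[of r "v\<^sup>2"] mult_nonneg_nonneg[of r "q\<^sup>2"] r0 by (simp add: algebra_simps)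
  finally have "e \<le> E + 30000000 * (r * v\<^sup>2 + 1 / r^3)" by (simp add: rq)
  then have "ennreal e \<le> ennreal (E + 30000000 * (r * v\<^sup>2 + 1 / r^3))" by (rule ennreal_leI)
  also have "\<dots> = profile_energy u + ennreal (30000000 * (r * v\<^sup>2 + 1 / r^3))" using E r0 by (subst ennreal_plus) auto
  finally have "profile_energy (cutoff r u) \<le> profile_energy u + ennreal (30000000 * (r * v\<^sup>2 + 1 / r^3))" unfolding e(1) .
  then show ?thesis by (rule that[OF v])
qed

section \<open>Closing a gap\<close>

text \<open>For nonnegative \<open>f\<close> and \<open>g\<close> with \<open>f * g = 0\<close> this
  is, up to the factor -4, the mixed part of the Gagliardo integral of \<open>f + g\<close>.\<close>

definition interaction :: "(real \<Rightarrow> real) \<Rightarrow> (real \<Rightarrow> real) \<Rightarrow> ennreal" where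
  "interaction f g = (\<integral>\<^sup>+t. \<integral>\<^sup>+s. ennreal (f t * g s / (s - t)\<^sup>2) \<partial>lborel \<partial>lborel)"

text \<open>Where \<open>f * g\<close> vanishes, the product of the increments of \<open>f\<close>
  and \<open>g\<close> is \<open>- (f s * g t + f t * g s)\<close>. The mixed terms are therefore
  negative, which is the attraction of positive bumps, and the two of them agree after exchanging
  the variables. They stand on the left to avoid differences of possibly infinite
  quantities.\<close>

lemma gagliardo_add_disjoint:
  assumes [measurable]: "f \<in> borel_measurable borel" "g \<in> borel_measurable borel"
    and f: "\<And>x. 0 \<le> f x" and g: "\<And>x. 0 \<le> g x" and fg: "\<And>x. f x * g x = 0"
  shows "gagliardo (\<lambda>x. f x + g x) + 4 * interaction f g = gagliardo f + gagliardo g"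
proof -
  have sw: "interaction f g = (\<integral>\<^sup>+t. \<integral>\<^sup>+s. ennreal (f s * g t / (s - t)\<^sup>2) \<partial>lborel \<partial>lborel)"
    unfolding interaction_def by (subst lborel_pair.Fubini') (auto simp: power2_commute)
  have "gagliardo f + gagliardo g = (\<integral>\<^sup>+t. \<integral>\<^sup>+s. ennreal (\<bar>f s - f t\<bar>\<^sup>2 / \<bar>s - t\<bar>\<^sup>2) + ennreal (\<bar>g s - g t\<bar>\<^sup>2 / \<bar>s - t\<bar>\<^sup>2) \<partial>lborel \<partial>lborel)"
    unfolding gagliardo_def by (simp add: nn_integral_add)
  also have "\<dots> = (\<integral>\<^sup>+t. \<integral>\<^sup>+s. ennreal (\<bar>(f s + g s) - (f t + g t)\<bar>\<^sup>2 / \<bar>s - t\<bar>\<^sup>2)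
      + (2 * ennreal (f t * g s / (s - t)\<^sup>2) + 2 * ennreal (f s * g t / (s - t)\<^sup>2)) \<partial>lborel \<partial>lborel)"
  proof (intro nn_integral_cong)
    fix s t
    have "\<bar>f s - f t\<bar>\<^sup>2 + \<bar>g s - g t\<bar>\<^sup>2 = \<bar>(f s + g s) - (f t + g t)\<bar>\<^sup>2 + (2 * (f t * g s) + 2 * (f s * g t))"
      using fg[of s] fg[of t] by (auto simp: power2_eq_square algebra_simps)
    then have "\<bar>f s - f t\<bar>\<^sup>2 / \<bar>s - t\<bar>\<^sup>2 + \<bar>g s - g t\<bar>\<^sup>2 / \<bar>s - t\<bar>\<^sup>2
       = \<bar>(f s + g s) - (f t + g t)\<bar>\<^sup>2 / \<bar>s - t\<bar>\<^sup>2 + (2 * (f t * g s / (s - t)\<^sup>2) + 2 * (f s * g t / (s - t)\<^sup>2))"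
      by (simp add: add_divide_distrib[symmetric])
    from arg_cong[OF this, of ennreal]
    show "ennreal (\<bar>f s - f t\<bar>\<^sup>2 / \<bar>s - t\<bar>\<^sup>2) + ennreal (\<bar>g s - g t\<bar>\<^sup>2 / \<bar>s - t\<bar>\<^sup>2)
      = ennreal (\<bar>(f s + g s) - (f t + g t)\<bar>\<^sup>2 / \<bar>s - t\<bar>\<^sup>2) + (2 * ennreal (f t * g s / (s - t)\<^sup>2) + 2 * ennreal (f s * g t / (s - t)\<^sup>2))"
      using f g by (simp add: ennreal_mult[of 2, symmetric, simplified] ennreal_plus[symmetric] del: ennreal_plus power2_abs)
  qed
  also have "\<dots> = gagliardo (\<lambda>x. f x + g x) + (2 * interaction f g + 2 * interaction f g)"
  proof -
    have "(\<integral>\<^sup>+t. \<integral>\<^sup>+s. ennreal (\<bar>(f s + g s) - (f t + g t)\<bar>\<^sup>2 / \<bar>s - t\<bar>\<^sup>2)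
      + (2 * ennreal (f t * g s / (s - t)\<^sup>2) + 2 * ennreal (f s * g t / (s - t)\<^sup>2)) \<partial>lborel \<partial>lborel)
      = gagliardo (\<lambda>x. f x + g x) + (2 * interaction f g + 2 * (\<integral>\<^sup>+t. \<integral>\<^sup>+s. ennreal (f s * g t / (s - t)\<^sup>2) \<partial>lborel \<partial>lborel))"
      unfolding gagliardo_def interaction_def by (simp add: nn_integral_add nn_integral_cmult)
    then show ?thesis unfolding sw[symmetric] .
  qed
  also have "2 * interaction f g + 2 * interaction f g = 4 * interaction f g"
    by (simp flip: distrib_right)
  finally show ?thesis by simp
qed

text \<open>Finiteness allows the interaction to be cancelled later. As the supports are separated,
  \<open>(s - t)^2\<close> dominates \<open>r^2 + (s - t)^2\<close> up to a factor, and
  \<open>2 * f t * g s \<le> (f t)^2 + (g s)^2\<close> leaves integrals of squares against an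
  integrable kernel.\<close>

lemma interaction_finite:
  assumes [measurable]: "f \<in> borel_measurable borel" "g \<in> borel_measurable borel"
    and f: "\<And>x. 0 \<le> f x" "\<And>x. - r < x \<Longrightarrow> f x = 0" and g: "\<And>x. 0 \<le> g x" "\<And>x. x < r \<Longrightarrow> g x = 0" and r: "r > 0"
    and fin: "L2_norm_sq f < \<infinity>" "L2_norm_sq g < \<infinity>"
  shows "interaction f g < \<infinity>"
proof -
  define K where "K s t = ennreal (1 / (r\<^sup>2 + (s - t)\<^sup>2))" for s t :: real
  have [measurable]: "(\<lambda>x. K (a x) (b x)) \<in> borel_measurable M" if [measurable]: "a \<in> borel_measurable M" "b \<in> borel_measurable M" for a b M
    unfolding K_def by measurable
  have "interaction f g \<le> (\<integral>\<^sup>+t. \<integral>\<^sup>+s. ennreal ((f t)\<^sup>2) * K s t + ennreal ((g s)\<^sup>2) * K s t \<partial>lborel \<partial>lborel)"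
    unfolding interaction_def
  proof (intro nn_integral_mono)
    fix s t
    show "ennreal (f t * g s / (s - t)\<^sup>2) \<le> ennreal ((f t)\<^sup>2) * K s t + ennreal ((g s)\<^sup>2) * K s t"
    proof (cases "f t * g s = 0")
      case False
      then have st: "t \<le> - r" "r \<le> s" using f(2)[of t] g(2)[of s] by (auto simp: not_less[symmetric])
      then have "r * r \<le> (s - t) * (s - t)" using r by (intro mult_mono) auto
      then have rs: "r\<^sup>2 + (s - t)\<^sup>2 \<le> 2 * (s - t)\<^sup>2" by (simp add: power2_eq_square)
      have pos: "(s - t)\<^sup>2 > 0" "r\<^sup>2 + (s - t)\<^sup>2 > 0" using st r by (auto intro: add_pos_nonneg)
      have "2 * (f t * g s) \<le> (f t)\<^sup>2 + (g s)\<^sup>2"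
        using zero_le_power2[of "f t - g s"] by (simp add: power2_eq_square algebra_simps)
      then have "f t * g s / (s - t)\<^sup>2 \<le> ((f t)\<^sup>2 + (g s)\<^sup>2) / 2 / (s - t)\<^sup>2" by (intro divide_right_mono) auto
      also have "\<dots> = ((f t)\<^sup>2 + (g s)\<^sup>2) / (2 * (s - t)\<^sup>2)" by simp
      also have "\<dots> \<le> ((f t)\<^sup>2 + (g s)\<^sup>2) / (r\<^sup>2 + (s - t)\<^sup>2)" using pos rs by (intro divide_left_mono mult_pos_pos) auto
      also have "\<dots> = (f t)\<^sup>2 * (1 / (r\<^sup>2 + (s - t)\<^sup>2)) + (g s)\<^sup>2 * (1 / (r\<^sup>2 + (s - t)\<^sup>2))" by (simp add: add_divide_distrib)
      finally have "ennreal (f t * g s / (s - t)\<^sup>2) \<le> ennreal ((f t)\<^sup>2 * (1 / (r\<^sup>2 + (s - t)\<^sup>2)) + (g s)\<^sup>2 * (1 / (r\<^sup>2 + (s - t)\<^sup>2)))" by (rule ennreal_leI)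
      then show ?thesis using pos unfolding K_def by (simp only: ennreal_mult[symmetric] zero_le_power2 zero_le_divide_1_iff less_imp_le)
          (simp add: ennreal_plus[symmetric] ennreal_mult[symmetric] del: ennreal_plus)
    qed auto
  qed
  also have "\<dots> = (\<integral>\<^sup>+t. \<integral>\<^sup>+s. ennreal ((f t)\<^sup>2) * K s t \<partial>lborel \<partial>lborel) + (\<integral>\<^sup>+t. \<integral>\<^sup>+s. ennreal ((g s)\<^sup>2) * K s t \<partial>lborel \<partial>lborel)"
    by (simp add: nn_integral_add)
  also have "(\<integral>\<^sup>+t. \<integral>\<^sup>+s. ennreal ((g s)\<^sup>2) * K s t \<partial>lborel \<partial>lborel) = (\<integral>\<^sup>+s. \<integral>\<^sup>+t. ennreal ((g s)\<^sup>2) * K t s \<partial>lborel \<partial>lborel)"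
    by (subst lborel_pair.Fubini') (auto simp: K_def power2_commute)
  also have "(\<integral>\<^sup>+t. \<integral>\<^sup>+s. ennreal ((f t)\<^sup>2) * K s t \<partial>lborel \<partial>lborel) + \<dots> \<le> L2_norm_sq f * ennreal (4 / r) + L2_norm_sq g * ennreal (4 / r)"
  proof (intro add_mono)
    have "(\<integral>\<^sup>+t. \<integral>\<^sup>+s. ennreal ((h t)\<^sup>2) * K s t \<partial>lborel \<partial>lborel) \<le> L2_norm_sq h * ennreal (4 / r)"
      if [measurable]: "h \<in> borel_measurable borel" for h :: "real \<Rightarrow> real"
    proof -
      have "(\<integral>\<^sup>+t. \<integral>\<^sup>+s. ennreal ((h t)\<^sup>2) * K s t \<partial>lborel \<partial>lborel) = (\<integral>\<^sup>+t. ennreal ((h t)\<^sup>2) * (\<integral>\<^sup>+s. K s t \<partial>lborel) \<partial>lborel)"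
        by (intro nn_integral_cong nn_integral_cmult) measurable
      also have "\<dots> \<le> (\<integral>\<^sup>+t. ennreal ((h t)\<^sup>2) * ennreal (4 / r) \<partial>lborel)"
        unfolding K_def by (intro nn_integral_mono mult_left_mono nn_integral_inverse_square_shift r) simp
      also have "\<dots> = L2_norm_sq h * ennreal (4 / r)"
        unfolding L2_norm_sq_def by (subst nn_integral_multc) auto
      finally show ?thesis .
    qed
    then show "(\<integral>\<^sup>+t. \<integral>\<^sup>+s. ennreal ((f t)\<^sup>2) * K s t \<partial>lborel \<partial>lborel) \<le> L2_norm_sq f * ennreal (4 / r)"
      "(\<integral>\<^sup>+t. \<integral>\<^sup>+s. ennreal ((g t)\<^sup>2) * K s t \<partial>lborel \<partial>lborel) \<le> L2_norm_sq g * ennreal (4 / r)" by auto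
  qed
  also have "\<dots> < \<infinity>" using fin by (simp add: ennreal_mult_less_top)
  finally show ?thesis .
qed

lemma gagliardo_translate:
  assumes [measurable]: "f \<in> borel_measurable borel"
  shows "gagliardo (\<lambda>x. f (x + a)) = gagliardo f"
proof -
  have "(\<integral>\<^sup>+s. ennreal (\<bar>f (s + a) - f (t + a)\<bar>\<^sup>2 / \<bar>s - t\<bar>\<^sup>2) \<partial>lborel) = (\<integral>\<^sup>+s. ennreal (\<bar>f s - f (t + a)\<bar>\<^sup>2 / \<bar>s - (t + a)\<bar>\<^sup>2) \<partial>lborel)" for t
    using nn_integral_lborel_translate[of "\<lambda>s. ennreal (\<bar>f s - f (t + a)\<bar>\<^sup>2 / \<bar>s - (t + a)\<bar>\<^sup>2)" a] by simp
  then have "gagliardo (\<lambda>x. f (x + a)) = (\<integral>\<^sup>+t. \<integral>\<^sup>+s. ennreal (\<bar>f s - f (t + a)\<bar>\<^sup>2 / \<bar>s - (t + a)\<bar>\<^sup>2) \<partial>lborel \<partial>lborel)"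
    by (simp add: gagliardo_def)
  also have "\<dots> = gagliardo f"
    unfolding gagliardo_def by (rule nn_integral_lborel_translate[of "\<lambda>t. \<integral>\<^sup>+s. ennreal (\<bar>f s - f t\<bar>\<^sup>2 / \<bar>s - t\<bar>\<^sup>2) \<partial>lborel"]) measurable
  finally show ?thesis .
qed

text \<open>Deletes an interval of length \<open>r\<close> on which \<open>p\<close> is meant to vanish.\<close>

definition glue :: "real \<Rightarrow> (real \<Rightarrow> real) \<Rightarrow> real \<Rightarrow> real" where
  "glue r p x = (if x \<le> 0 then p x else p (x + r))"

text \<open>Half the rate at which the interaction of the parts left and right of the origin grows
  when they approach each other: the kernel is \<open>-1/2\<close> times the derivative of
  \<open>d^-2\<close>.\<close>

definition cubic_interaction :: "(real \<Rightarrow> real) \<Rightarrow> ennreal" where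
  "cubic_interaction p = (\<integral>\<^sup>+t. \<integral>\<^sup>+s. ennreal ((if t \<le> 0 then p t else 0) * (if s \<le> 0 then 0 else p s) / (s - t)^3) \<partial>lborel \<partial>lborel)"

text \<open>By convexity the graph of \<open>d^-2\<close> lies above its tangent; here the tangent
  at \<open>d\<close> is evaluated at \<open>d - r\<close>.\<close>

lemma inverse_square_gain:
  assumes "0 < (r::real)" "r < d"
  shows "1 / d\<^sup>2 + 2 * r / d^3 \<le> 1 / (d - r)\<^sup>2"
proof -
  have "(d + 2 * r) * (d - r)\<^sup>2 \<le> d^3"
  proof -
    have "d^3 - (d + 2 * r) * (d - r)\<^sup>2 = r\<^sup>2 * (3 * d - 2 * r)" by (simp add: power2_eq_square power3_eq_cube algebra_simps)
    also have "\<dots> \<ge> 0" using assms by simp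
    finally show ?thesis by simp
  qed
  then have "(d + 2 * r) / d^3 \<le> 1 / (d - r)\<^sup>2" using assms by (simp add: field_simps)
  moreover have "(d + 2 * r) / d^3 = 1 / d\<^sup>2 + 2 * r / d^3" using assms by (simp add: add_divide_distrib power2_eq_square power3_eq_cube)
  ultimately show ?thesis by simp
qed

text \<open>The seminorm of each part is unchanged by translation, so only the interaction matters,
  and it grows by at least \<open>2 * r * cubic_interaction p\<close>. With the factor 4 from
  \<open>gagliardo_add_disjoint\<close> and the normalisation this is
  \<open>8 * r / (2 * pi)\<close>, which exceeds \<open>r\<close> because
  \<open>pi < 4\<close>.\<close>

lemma Hdot_glue:
  assumes p: "profile p" and r: "r > 0" and pz: "\<And>x. \<bar>x\<bar> \<le> r \<Longrightarrow> p x = 0" and fin: "L2_norm_sq p < \<infinity>"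
  shows "Hdot_half_sq (glue r p) + ennreal r * cubic_interaction p \<le> Hdot_half_sq p"
proof -
  have pb: "0 \<le> p x" for x using p by (simp add: profile_def)
  have [measurable]: "p \<in> borel_measurable borel" using p by (rule profile_measurable)
  define f where "f x = (if x \<le> 0 then p x else 0)" for x
  define g where "g x = (if x \<le> 0 then 0 else p x)" for x
  have [measurable]: "f \<in> borel_measurable borel" "g \<in> borel_measurable borel" unfolding f_def g_def by measurable
  have f: "0 \<le> f x" "- r < x \<Longrightarrow> f x = 0" for x using pb pz[of x] r by (auto simp: f_def)
  have g: "0 \<le> g x" "x \<le> r \<Longrightarrow> g x = 0" for x using pb pz[of x] r by (auto simp: g_def)
  define g' where "g' x = g (x + r)" for x
  have [measurable]: "g' \<in> borel_measurable borel" unfolding g'_def by measurable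
  have pfg: "p = (\<lambda>x. f x + g x)" by (auto simp: f_def g_def)
  have glue: "glue r p = (\<lambda>x. f x + g' x)"
  proof
    fix x show "glue r p x = f x + g' x"
      using pz[of "x + r"] r by (cases "x \<le> - r") (auto simp: glue_def f_def g'_def g_def)
  qed
  have L: "L2_norm_sq f \<le> L2_norm_sq p" "L2_norm_sq g \<le> L2_norm_sq p"
    unfolding L2_norm_sq_def by (intro nn_integral_mono; simp add: f_def g_def)+
  have Ifin: "interaction f g < \<infinity>"
    using L fin g by (intro interaction_finite[OF _ _ f _ _ r]) (auto intro: le_less_trans)
  have 1: "gagliardo p + 4 * interaction f g = gagliardo f + gagliardo g"
    unfolding pfg by (rule gagliardo_add_disjoint) (use f g in \<open>auto simp: f_def g_def\<close>)
  have 2: "gagliardo (glue r p) + 4 * interaction f g' = gagliardo f + gagliardo g'"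
    unfolding glue by (rule gagliardo_add_disjoint) (use f g r in \<open>auto simp: f_def g'_def\<close>)
  have 3: "gagliardo g' = gagliardo g" unfolding g'_def by (rule gagliardo_translate) measurable
  have "interaction f g + ennreal (2 * r) * cubic_interaction p
    = (\<integral>\<^sup>+t. \<integral>\<^sup>+s. ennreal (f t * g s / (s - t)\<^sup>2) + ennreal (2 * r) * ennreal (f t * g s / (s - t)^3) \<partial>lborel \<partial>lborel)"
    unfolding interaction_def cubic_interaction_def f_def[symmetric] g_def[symmetric] by (simp add: nn_integral_add nn_integral_cmult)
  also have "\<dots> \<le> (\<integral>\<^sup>+t. \<integral>\<^sup>+s. ennreal (f t * g s / (s - r - t)\<^sup>2) \<partial>lborel \<partial>lborel)"
  proof (intro nn_integral_mono)
    fix s t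
    show "ennreal (f t * g s / (s - t)\<^sup>2) + ennreal (2 * r) * ennreal (f t * g s / (s - t)^3) \<le> ennreal (f t * g s / (s - r - t)\<^sup>2)"
    proof (cases "f t * g s = 0")
      case False
      then have st: "t \<le> - r" "r < s" using f(2)[of t] g(2)[of s] by (auto simp: not_less[symmetric])
      then have d: "r < s - t" using r by simp
      have fg: "0 \<le> f t * g s" using f g by simp
      have "f t * g s * (1 / (s - t)\<^sup>2 + 2 * r / (s - t)^3) \<le> f t * g s * (1 / (s - t - r)\<^sup>2)"
        by (intro mult_left_mono inverse_square_gain r d fg)
      then have "f t * g s / (s - t)\<^sup>2 + 2 * r * (f t * g s / (s - t)^3) \<le> f t * g s / (s - r - t)\<^sup>2"
        by (simp add: algebra_simps)
      then have "ennreal (f t * g s / (s - t)\<^sup>2 + 2 * r * (f t * g s / (s - t)^3)) \<le> ennreal (f t * g s / (s - r - t)\<^sup>2)" by (rule ennreal_leI)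
      then show ?thesis using fg r d by (subst (asm) ennreal_affine) auto
    qed auto
  qed
  also have "\<dots> = interaction f g'"
  proof -
    have "(\<integral>\<^sup>+s. ennreal (f t * g (s + r) / (s - t)\<^sup>2) \<partial>lborel) = (\<integral>\<^sup>+s. ennreal (f t * g s / (s - r - t)\<^sup>2) \<partial>lborel)" for t
      using nn_integral_lborel_translate[of "\<lambda>s. ennreal (f t * g s / (s - r - t)\<^sup>2)" r] by simp
    then show ?thesis by (simp add: interaction_def g'_def)
  qed
  finally have 4: "interaction f g + ennreal (2 * r) * cubic_interaction p \<le> interaction f g'" .
  have "gagliardo (glue r p) + 4 * (interaction f g + ennreal (2 * r) * cubic_interaction p) \<le> gagliardo (glue r p) + 4 * interaction f g'"
    by (intro add_left_mono mult_left_mono 4) simp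
  also have "\<dots> = gagliardo p + 4 * interaction f g" using 1 2 3 by simp
  finally have "(gagliardo (glue r p) + 4 * (ennreal (2 * r) * cubic_interaction p)) + 4 * interaction f g \<le> gagliardo p + 4 * interaction f g"
    by (simp add: distrib_left add_ac)
  moreover have "4 * interaction f g \<noteq> top" using Ifin by (auto simp: ennreal_mult_eq_top_iff)
  ultimately have "gagliardo (glue r p) + 4 * (ennreal (2 * r) * cubic_interaction p) \<le> gagliardo p"
    by (simp add: add.commute[of _ "4 * interaction f g"])
  then have "ennreal (1 / (2 * pi)) * (gagliardo (glue r p) + 4 * (ennreal (2 * r) * cubic_interaction p)) \<le> ennreal (1 / (2 * pi)) * gagliardo p"
    by (rule mult_left_mono) simp
  then have 5: "Hdot_half_sq (glue r p) + (ennreal (1 / (2 * pi)) * (4 * ennreal (2 * r))) * cubic_interaction p \<le> Hdot_half_sq p"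
    by (simp add: Hdot_gagliardo distrib_left mult.assoc)
  have "ennreal r \<le> ennreal (1 / (2 * pi) * (8 * r))"
  proof (rule ennreal_leI)
    have "r * pi \<le> r * 4" using r pi_less_4 by (intro mult_left_mono) auto
    then show "r \<le> 1 / (2 * pi) * (8 * r)" by (simp add: field_simps)
  qed
  also have "\<dots> = ennreal (1 / (2 * pi)) * ennreal (8 * r)" using r by (intro ennreal_mult) auto
  also have "ennreal (8 * r) = 4 * ennreal (2 * r)" using r by (simp add: ennreal_mult)
  finally have "ennreal r * cubic_interaction p \<le> (ennreal (1 / (2 * pi)) * (4 * ennreal (2 * r))) * cubic_interaction p" by (rule mult_right_mono) simp
  then show ?thesis using 5 by (meson add_left_mono order_trans)
qed

text \<open>The two pieces of \<open>G\<close> are dominated by \<open>F\<close> on the disjoint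
  sets \<open>{..a}\<close> and \<open>{a + r<..}\<close>, so no part of \<open>F\<close> is counted
  twice.\<close>

lemma nn_integral_glue_le:
  fixes F G :: "real \<Rightarrow> ennreal"
  assumes [measurable]: "F \<in> borel_measurable borel" and r: "r > 0"
    and G: "\<And>x. x \<le> a \<Longrightarrow> G x \<le> F x" "\<And>x. a < x \<Longrightarrow> G x \<le> F (x + r)"
  shows "(\<integral>\<^sup>+x. G x \<partial>lborel) \<le> (\<integral>\<^sup>+x. F x \<partial>lborel)"
proof -
  have "(\<integral>\<^sup>+x. G x \<partial>lborel) \<le> (\<integral>\<^sup>+x. F x * indicator {..a} x + F (x + r) * indicator {a + r<..} (x + r) \<partial>lborel)"
    using G by (intro nn_integral_mono) (auto simp: indicator_def)
  also have "\<dots> = (\<integral>\<^sup>+x. F x * indicator {..a} x \<partial>lborel) + (\<integral>\<^sup>+x. F (x + r) * indicator {a + r<..} (x + r) \<partial>lborel)"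
    by (rule nn_integral_add) measurable
  also have "(\<integral>\<^sup>+x. F (x + r) * indicator {a + r<..} (x + r) \<partial>lborel) = (\<integral>\<^sup>+x. F x * indicator {a + r<..} x \<partial>lborel)"
    by (rule nn_integral_lborel_translate[of "\<lambda>x. F x * indicator {a + r<..} x"]) measurable
  also have "(\<integral>\<^sup>+x. F x * indicator {..a} x \<partial>lborel) + \<dots> = (\<integral>\<^sup>+x. F x * indicator {..a} x + F x * indicator {a + r<..} x \<partial>lborel)"
    by (rule nn_integral_add[symmetric]) measurable
  also have "\<dots> \<le> (\<integral>\<^sup>+x. F x \<partial>lborel)" using r by (intro nn_integral_mono) (auto simp: indicator_def)
  finally show ?thesis .
qed

lemma profile_glue:
  assumes p: "profile p" and r: "r > 0" and pz: "\<And>x. \<bar>x\<bar> \<le> r \<Longrightarrow> p x = 0"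
  shows "profile (glue r p)"
proof -
  have c: "continuous_on UNIV p" and b: "\<And>x. 0 \<le> p x \<and> p x \<le> 2" using p by (auto simp: profile_def)
  have "continuous_on ({..0} \<union> {0..}) (\<lambda>x. if x \<le> 0 then p x else p (x + r))"
    using r pz by (intro continuous_on_If continuous_on_subset[OF c] continuous_on_compose2[OF c]) (auto intro!: continuous_intros)
  moreover have "{..0} \<union> {0..} = (UNIV :: real set)" by auto
  ultimately show ?thesis using b by (auto simp: profile_def glue_def[abs_def])
qed

lemma profile_energy_glue:
  assumes p: "profile p" and r: "r \<ge> 1" and pz: "\<And>x. \<bar>x\<bar> \<le> r \<Longrightarrow> p x = 0" and fin: "L2_norm_sq p < \<infinity>"
  shows "profile_energy (glue r p) + ennreal r * cubic_interaction p \<le> profile_energy p"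
proof -
  have r0: "r > 0" using r by simp
  have [measurable]: "p \<in> borel_measurable borel" "glue r p \<in> borel_measurable borel"
    using p profile_glue[OF p r0 pz] by (auto dest: profile_measurable)
  have "L2_norm_sq (glue r p) \<le> L2_norm_sq p"
    unfolding L2_norm_sq_def using r0 by (intro nn_integral_glue_le[of _ r 0]) (auto simp: glue_def)
  moreover have "dq (half_cos (glue r p)) n + dq (half_sin (glue r p)) n \<le> half_angle_energy p" for n
  proof -
    define h :: real where "h = 1 / 2^n"
    have h: "0 < h" "h \<le> 1" by (auto simp: h_def)
    define F where "F v x = ennreal ((2^n)\<^sup>2 * ((half_cos v (x + h) - half_cos v x)\<^sup>2 + (half_sin v (x + h) - half_sin v x)\<^sup>2))" for v x
    have [measurable]: "F p \<in> borel_measurable borel" unfolding F_def by measurable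
    have hc: "half_cos (glue r p) x = (if x \<le> 0 then half_cos p x else half_cos p (x + r))"
         "half_sin (glue r p) x = (if x \<le> 0 then half_sin p x else half_sin p (x + r))" for x
      by (auto simp: half_cos_def half_sin_def glue_def)
    have z: "half_cos p x = 1 \<and> half_sin p x = 0" if "\<bar>x\<bar> \<le> r" for x
      using pz[OF that] by (simp add: half_cos_def half_sin_def)
    have "(\<integral>\<^sup>+x. F (glue r p) x \<partial>lborel) \<le> (\<integral>\<^sup>+x. F p x \<partial>lborel)"
    \<comment> \<open>The seam is placed at \<open>- h\<close> because increments starting between
      \<open>- h\<close> and 0 straddle the gluing point. For such \<open>x\<close> the profile
      \<open>p\<close> vanishes at \<open>x\<close> and at \<open>x + r\<close> alike, as
      \<open>h \<le> 1 \<le> r\<close>, so the comparison with the shifted increment is still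
      valid.\<close>
    proof (rule nn_integral_glue_le[of _ r "- h"])
      fix x assume "x \<le> - h" then show "F (glue r p) x \<le> F p x" using h by (simp add: F_def hc)
    next
      fix x assume x: "- h < x"
      show "F (glue r p) x \<le> F p (x + r)"
      proof (cases "x \<le> 0")
        case True
        then have "\<bar>x\<bar> \<le> r" "\<bar>x + r\<bar> \<le> r" using x h r by auto
        then show ?thesis using True x z[of x] z[of "x + r"] by (simp add: F_def hc add_ac)
      next
        case False then show ?thesis using h by (simp add: F_def hc add_ac)
      qed
    qed (use r0 in auto)
    then have "dq (half_cos (glue r p)) n + dq (half_sin (glue r p)) n \<le> dq (half_cos p) n + dq (half_sin p) n"
      by (simp add: dq_half_sum F_def h_def)
    also have "\<dots> \<le> half_angle_energy p" unfolding half_angle_energy_def by (rule SUP_upper) simp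
    finally show ?thesis .
  qed
  then have "half_angle_energy (glue r p) \<le> half_angle_energy p" unfolding half_angle_energy_def[of "glue r p"] by (intro SUP_least)
  ultimately have "4 * half_angle_energy (glue r p) + (Hdot_half_sq (glue r p) + ennreal r * cubic_interaction p) + L2_norm_sq (glue r p)
    \<le> 4 * half_angle_energy p + Hdot_half_sq p + L2_norm_sq p"
    by (intro add_mono mult_left_mono Hdot_glue p r0 pz fin) auto
  then show ?thesis by (simp add: profile_energy_def add_ac)
qed

section \<open>Weighing the gain of closing a gap against the cost of the cut\<close>

lemma profile_energy_translate:
  assumes [measurable]: "u \<in> borel_measurable borel"
  shows "profile_energy (\<lambda>x. u (x + a)) = profile_energy u"
proof -
  have d: "dq (\<lambda>x. f (x + a)) n = dq f n" if [measurable]: "f \<in> borel_measurable borel" for f n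
    unfolding dq_def using nn_integral_lborel_translate[of "\<lambda>x. ennreal ((2^n * (f (x + 1/2^n) - f x))\<^sup>2)" a]
    by (simp add: add_ac)
  have "half_cos (\<lambda>x. u (x + a)) = (\<lambda>x. half_cos u (x + a))" "half_sin (\<lambda>x. u (x + a)) = (\<lambda>x. half_sin u (x + a))"
    by (auto simp: half_cos_def half_sin_def)
  then have "half_angle_energy (\<lambda>x. u (x + a)) = half_angle_energy u" by (simp add: half_angle_energy_def d)
  moreover have "L2_norm_sq (\<lambda>x. u (x + a)) = L2_norm_sq u"
    unfolding L2_norm_sq_def by (rule nn_integral_lborel_translate[of "\<lambda>x. ennreal ((norm (u x))\<^sup>2)"]) measurable
  ultimately show ?thesis by (simp add: profile_energy_def Hdot_gagliardo gagliardo_translate)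
qed

lemma profile_translate: "profile u \<Longrightarrow> profile (\<lambda>x. u (x + a))"
  by (auto simp: profile_def intro!: continuous_on_compose2[of UNIV u] continuous_intros)

lemma half_continuous:
  assumes "profile u"
  shows "continuous_on UNIV (half_cos u)" "continuous_on UNIV (half_sin u)"
  using assms unfolding profile_def half_cos_def[abs_def] half_sin_def[abs_def] by (auto intro!: continuous_intros)

lemma dq_half_le:
  assumes "profile_energy u \<le> ennreal E" "0 \<le> E"
  shows "dq (half_cos u) n + dq (half_sin u) n \<le> ennreal (E / 4)"
proof -
  have "4 * (dq (half_cos u) n + dq (half_sin u) n) \<le> 4 * half_angle_energy u"
    unfolding half_angle_energy_def by (intro mult_left_mono SUP_upper) auto
  also have "\<dots> \<le> profile_energy u" by (simp add: profile_energy_def add.assoc)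
  finally have *: "4 * (dq (half_cos u) n + dq (half_sin u) n) \<le> ennreal E" using assms(1) by (rule order_trans)
  have q: "x = ennreal (1/4) * (4 * x)" for x :: ennreal
  proof -
    have "ennreal (1/4) * 4 = ennreal (1/4 * 4)" by (subst ennreal_mult) auto
    then show ?thesis by (simp add: mult.assoc[symmetric])
  qed
  have "dq (half_cos u) n + dq (half_sin u) n = ennreal (1/4) * (4 * (dq (half_cos u) n + dq (half_sin u) n))" by (rule q)
  also have "\<dots> \<le> ennreal (1/4) * ennreal E" by (intro mult_left_mono *) simp
  also have "\<dots> = ennreal (E / 4)" using assms(2) by (subst ennreal_mult[symmetric]) auto
  finally show ?thesis .
qed

text \<open>Since \<open>u = 2 * (half_sin u)^2\<close> and \<open>half_sin u \<le> 1\<close>, the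
  Hoelder bound for \<open>half_sin u\<close> passes to \<open>u\<close>, with a factor
  \<open>16 = 4 * 2^2\<close> between the squared increments.\<close>

lemma profile_hoelder:
  assumes u: "profile u" and E: "profile_energy u \<le> ennreal E" "0 \<le> E"
  shows "(u x - u y)\<^sup>2 \<le> 4 * E * \<bar>x - y\<bar>"
proof -
  define a where "a = half_sin u x" define b where "b = half_sin u y"
  have ub: "0 \<le> u z \<and> u z \<le> 2" for z using u by (simp add: profile_def)
  have "dq (half_sin u) n \<le> ennreal (E / 4)" for n
    using dq_half_le[OF E, of n] by (rule order_trans[rotated]) simp
  then have h: "(a - b)\<^sup>2 \<le> E / 4 * \<bar>x - y\<bar>"
    unfolding a_def b_def using E(2) by (intro hoelder_of_dq half_continuous u) auto
  have ab: "0 \<le> a" "a \<le> 1" "0 \<le> b" "b \<le> 1" using ub[of x] ub[of y] by (auto simp: a_def b_def half_sin_def)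
  have "u x = 2 * a\<^sup>2" "u y = 2 * b\<^sup>2" using ub by (auto simp: a_def b_def half_sin_def)
  then have "(u x - u y)\<^sup>2 = 4 * (a + b)\<^sup>2 * (a - b)\<^sup>2" by (simp add: power2_eq_square algebra_simps)
  moreover have "(a + b)\<^sup>2 \<le> 2\<^sup>2" using ab by (intro power_mono) auto
  then have "4 * (a + b)\<^sup>2 * (a - b)\<^sup>2 \<le> 4 * 2\<^sup>2 * (a - b)\<^sup>2" by (intro mult_right_mono mult_left_mono) auto
  ultimately have "(u x - u y)\<^sup>2 \<le> 16 * (a - b)\<^sup>2" by simp
  also have "\<dots> \<le> 16 * (E / 4 * \<bar>x - y\<bar>)" by (intro mult_left_mono h) simp
  finally show ?thesis by simp
qed

text \<open>The yardstick with which both the gain and the cost are compared.\<close>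

definition tail_moment :: "(real \<Rightarrow> real) \<Rightarrow> ennreal" where
  "tail_moment p = (\<integral>\<^sup>+t. ennreal (p t / \<bar>t\<bar>^3) \<partial>lborel)"

text \<open>On each side \<open>p \<ge> 1\<close> on an interval of length \<open>d\<close> that
  begins at distance \<open>4 * r\<close>. A point of the support on one side is no farther from the
  interval on the other side than 6 times its own modulus, whence \<open>216 = 6^3\<close>;
  averaging over both sides gives 432. The intervals themselves lie within \<open>5 * r\<close>,
  whence \<open>125 = 5^3\<close>.\<close>

lemma cubic_interaction_lower_bound:
  assumes p: "profile p" and r: "r > 0" and pz: "\<And>x. \<bar>x\<bar> \<le> r \<Longrightarrow> p x = 0"
    and d: "0 < d" "d \<le> r" and wall: "\<And>x. 4 * r \<le> \<bar>x\<bar> \<Longrightarrow> \<bar>x\<bar> \<le> 4 * r + d \<Longrightarrow> 1 \<le> p x"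
  shows "ennreal (d / 432) * tail_moment p \<le> cubic_interaction p" "ennreal (d / (125 * r^3)) \<le> tail_moment p"
proof -
  have pb: "0 \<le> p x" for x using p by (simp add: profile_def)
  have [measurable]: "p \<in> borel_measurable borel" using p by (rule profile_measurable)
  define f where "f x = (if x \<le> 0 then p x else 0)" for x
  define g where "g x = (if x \<le> 0 then 0 else p x)" for x
  have [measurable]: "f \<in> borel_measurable borel" "g \<in> borel_measurable borel" unfolding f_def g_def by measurable
  have fg: "0 \<le> f x" "0 \<le> g x" for x using pb by (auto simp: f_def g_def)
  have f: "x \<le> - r" if "f x \<noteq> 0" for x
  proof (rule ccontr)
    assume "\<not> x \<le> - r"
    then show False using that pz[of x] r by (cases "x \<le> 0") (auto simp: f_def)
  qed
  have g: "r \<le> x" if "g x \<noteq> 0" for x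
  proof (rule ccontr)
    assume "\<not> r \<le> x"
    then show False using that pz[of x] r by (cases "x \<le> 0") (auto simp: g_def)
  qed
  have cub: "cubic_interaction p = (\<integral>\<^sup>+t. \<integral>\<^sup>+s. ennreal (f t * g s / (s - t)^3) \<partial>lborel \<partial>lborel)"
    by (simp add: cubic_interaction_def f_def g_def)
  have comp: "a / (216 * y^3) \<le> a * b / (s - t)^3" if "0 \<le> a" "1 \<le> b" "0 < s - t" "s - t \<le> 6 * y" for a b s t y :: real
  proof -
    have "(s - t)^3 \<le> (6 * y)^3" using that by (intro power_mono) auto
    then have "(s - t)^3 \<le> 216 * y^3" by (simp add: power_mult_distrib)
    then have "a / (216 * y^3) \<le> a / (s - t)^3" using that by (intro divide_left_mono mult_pos_pos) auto
    also have "\<dots> \<le> a * b / (s - t)^3" using that mult_left_mono[of 1 b a] by (intro divide_right_mono) auto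
    finally show ?thesis .
  qed
  have int: "(\<integral>\<^sup>+x. ennreal c * indicator {a..a+d} x \<partial>lborel) = ennreal (d * c)" if "c \<ge> 0" for a c
    using d that by (subst nn_integral_cmult_indicator) (auto simp: ennreal_mult[symmetric] mult.commute)
  define c where "c = d / 216"
  have c: "c > 0" using d by (simp add: c_def)
  have right: "(\<integral>\<^sup>+s. ennreal (c * (g s / \<bar>s\<bar>^3)) \<partial>lborel) \<le> cubic_interaction p"
  proof -
    have "(\<integral>\<^sup>+s. ennreal (c * (g s / \<bar>s\<bar>^3)) \<partial>lborel)
      = (\<integral>\<^sup>+s. \<integral>\<^sup>+t. ennreal (g s / (216 * \<bar>s\<bar>^3)) * indicator {- (4*r) - d..- (4*r) - d + d} t \<partial>lborel \<partial>lborel)"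
      using fg by (subst int) (auto simp: c_def)
    also have "\<dots> \<le> (\<integral>\<^sup>+s. \<integral>\<^sup>+t. ennreal (f t * g s / (s - t)^3) \<partial>lborel \<partial>lborel)"
    proof (intro nn_integral_mono)
      fix s t
      show "ennreal (g s / (216 * \<bar>s\<bar>^3)) * indicator {- (4*r) - d..- (4*r) - d + d} t \<le> ennreal (f t * g s / (s - t)^3)"
      proof (cases "t \<in> {- (4*r) - d..- (4*r) - d + d} \<and> g s \<noteq> 0")
        case True
        then have s: "r \<le> s" using g by auto
        have t: "f t = p t" "1 \<le> p t" using True r wall[of t] by (auto simp: f_def)
        have "g s / (216 * \<bar>s\<bar>^3) \<le> g s * f t / (s - t)^3"
          using True s t r d fg by (intro comp) auto
        then show ?thesis using True by (simp add: mult.commute ennreal_leI)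
      qed auto
    qed
    also have "\<dots> = cubic_interaction p" unfolding cub by (rule lborel_pair.Fubini') measurable
    finally show ?thesis .
  qed
  have left: "(\<integral>\<^sup>+t. ennreal (c * (f t / \<bar>t\<bar>^3)) \<partial>lborel) \<le> cubic_interaction p"
  proof -
    have "(\<integral>\<^sup>+t. ennreal (c * (f t / \<bar>t\<bar>^3)) \<partial>lborel)
      = (\<integral>\<^sup>+t. \<integral>\<^sup>+s. ennreal (f t / (216 * \<bar>t\<bar>^3)) * indicator {4*r..4*r + d} s \<partial>lborel \<partial>lborel)"
      using fg by (subst int) (auto simp: c_def)
    also have "\<dots> \<le> cubic_interaction p"
      unfolding cub
    proof (intro nn_integral_mono)
      fix s t
      show "ennreal (f t / (216 * \<bar>t\<bar>^3)) * indicator {4*r..4*r + d} s \<le> ennreal (f t * g s / (s - t)^3)"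
      proof (cases "s \<in> {4*r..4*r + d} \<and> f t \<noteq> 0")
        case True
        then have t: "t \<le> - r" using f by auto
        have s: "g s = p s" "1 \<le> p s" using True r wall[of s] by (auto simp: g_def)
        have "f t / (216 * \<bar>t\<bar>^3) \<le> f t * g s / (s - t)^3"
          using True s t r d fg by (intro comp) auto
        then show ?thesis using True by (simp add: ennreal_leI)
      qed auto
    qed
    finally show ?thesis .
  qed
  have h: "ennreal (1/2) * x + ennreal (1/2) * x = x" for x
  proof -
    have "ennreal (1/2) + ennreal (1/2) = 1" by (subst ennreal_plus[symmetric]) auto
    then show ?thesis by (simp flip: distrib_right)
  qed
  have "ennreal (d / 432) * tail_moment p = (\<integral>\<^sup>+t. ennreal (d / 432) * ennreal (p t / \<bar>t\<bar>^3) \<partial>lborel)"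
    unfolding tail_moment_def by (rule nn_integral_cmult[symmetric]) measurable
  also have "\<dots> = (\<integral>\<^sup>+t. ennreal (1/2) * ennreal (c * (f t / \<bar>t\<bar>^3)) + ennreal (1/2) * ennreal (c * (g t / \<bar>t\<bar>^3)) \<partial>lborel)"
  proof (intro nn_integral_cong)
    fix x
    have "ennreal (d / 432) * ennreal q = ennreal (1/2) * ennreal (c * q)" if "q \<ge> 0" for q
      by (subst (1 2) ennreal_mult[symmetric]) (use c_def d that in auto)
    from this[of "p x / \<bar>x\<bar>^3", OF divide_nonneg_nonneg[OF pb zero_le_power[OF abs_ge_zero]]] show "ennreal (d / 432) * ennreal (p x / \<bar>x\<bar>^3)
      = ennreal (1/2) * ennreal (c * (f x / \<bar>x\<bar>^3)) + ennreal (1/2) * ennreal (c * (g x / \<bar>x\<bar>^3))"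
      using pb[of x] by (cases "x \<le> 0") (simp_all add: f_def g_def)
  qed
  also have "\<dots> = ennreal (1/2) * (\<integral>\<^sup>+t. ennreal (c * (f t / \<bar>t\<bar>^3)) \<partial>lborel) + ennreal (1/2) * (\<integral>\<^sup>+t. ennreal (c * (g t / \<bar>t\<bar>^3)) \<partial>lborel)"
    by (subst nn_integral_add) (auto intro!: arg_cong2[where f="(+)"] nn_integral_cmult)
  also have "\<dots> \<le> ennreal (1/2) * cubic_interaction p + ennreal (1/2) * cubic_interaction p" by (intro add_mono mult_left_mono left right) auto
  finally show "ennreal (d / 432) * tail_moment p \<le> cubic_interaction p" by (simp only: h)
  have "ennreal (d * (1 / (125 * r^3))) = (\<integral>\<^sup>+x. ennreal (1 / (125 * r^3)) * indicator {4*r..4*r+d} x \<partial>lborel)"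
    using r by (intro int[symmetric]) auto
  also have "\<dots> \<le> tail_moment p"
    unfolding tail_moment_def
  proof (intro nn_integral_mono)
    fix x
    show "ennreal (1 / (125 * r^3)) * indicator {4*r..4*r+d} x \<le> ennreal (p x / \<bar>x\<bar>^3)"
    proof (cases "x \<in> {4*r..4*r+d}")
      case True
      then have x: "0 < \<bar>x\<bar>" "\<bar>x\<bar> \<le> 5 * r" "1 \<le> p x" using r d wall[of x] by auto
      then have "\<bar>x\<bar>^3 \<le> (5 * r)^3" by (intro power_mono) auto
      then have "\<bar>x\<bar>^3 \<le> 125 * r^3" by (simp add: power_mult_distrib)
      then have "1 / (125 * r^3) \<le> p x / \<bar>x\<bar>^3" using x r by (intro frac_le) auto
      then show ?thesis using True by (simp add: ennreal_leI)
    qed simp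
  qed
  finally show "ennreal (d / (125 * r^3)) \<le> tail_moment p" by simp
qed

text \<open>Cauchy-Schwarz twice: \<open>p / x^2\<close> is the geometric mean of
  \<open>p / |x|^3\<close> and \<open>p / |x|\<close>, and the integral of \<open>p / |x|\<close> is
  controlled by the L2 norm because \<open>1 / |x|\<close> is square-integrable on
  \<open>|x| > r\<close>.\<close>

lemma poisson_mass_tail_bound:
  assumes p: "profile p" and r: "r > 0" and pz: "\<And>x. \<bar>x\<bar> \<le> r \<Longrightarrow> p x = 0"
    and L: "L2_norm_sq p \<le> ennreal E" "0 \<le> E"
  shows "(poisson_mass r p)\<^sup>2 \<le> tail_moment p * ennreal (sqrt (8 * E / r))"
proof -
  have pb: "0 \<le> p x" for x using p by (simp add: profile_def)
  have [measurable]: "p \<in> borel_measurable borel" using p by (rule profile_measurable)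
  define J where "J = (\<integral>\<^sup>+x. ennreal (p x / \<bar>x\<bar>) \<partial>lborel)"
  have xr: "r < \<bar>x\<bar>" if "p x \<noteq> 0" for x using pz[of x] that by fastforce
  have "J = (\<integral>\<^sup>+x. ennreal (p x) * ennreal (if \<bar>x\<bar> \<le> r then 0 else 1 / \<bar>x\<bar>) \<partial>lborel)"
    unfolding J_def using pb pz by (intro nn_integral_cong) (auto simp: ennreal_mult[symmetric])
  then have "J\<^sup>2 \<le> (\<integral>\<^sup>+x. (ennreal (p x))\<^sup>2 \<partial>lborel) * (\<integral>\<^sup>+x. (ennreal (if \<bar>x\<bar> \<le> r then 0 else 1 / \<bar>x\<bar>))\<^sup>2 \<partial>lborel)"
    by (simp only:) (rule Cauchy_Schwarz_nn_integral; measurable)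
  also have "(\<integral>\<^sup>+x. (ennreal (p x))\<^sup>2 \<partial>lborel) = L2_norm_sq p"
    unfolding L2_norm_sq_def using pb by (simp add: ennreal_power)
  also have "(\<integral>\<^sup>+x. (ennreal (if \<bar>x\<bar> \<le> r then 0 else 1 / \<bar>x\<bar>))\<^sup>2 \<partial>lborel) \<le> (\<integral>\<^sup>+x. ennreal 2 * ennreal (1 / (r\<^sup>2 + x\<^sup>2)) \<partial>lborel)"
  proof (intro nn_integral_mono)
    fix x
    show "(ennreal (if \<bar>x\<bar> \<le> r then 0 else 1 / \<bar>x\<bar>))\<^sup>2 \<le> ennreal 2 * ennreal (1 / (r\<^sup>2 + x\<^sup>2))"
    proof (cases "\<bar>x\<bar> \<le> r")
      case False
      then have "r * r \<le> \<bar>x\<bar> * \<bar>x\<bar>" using r by (intro mult_mono) auto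
      then have "r\<^sup>2 + x\<^sup>2 \<le> 2 * x\<^sup>2" by (simp add: power2_eq_square)
      moreover have "0 < r\<^sup>2 + x\<^sup>2" "0 < x\<^sup>2" using r False by (auto intro: add_pos_nonneg)
      ultimately have "(1 / \<bar>x\<bar>)\<^sup>2 \<le> 2 * (1 / (r\<^sup>2 + x\<^sup>2))" by (simp add: power_divide field_simps)
      then have "ennreal ((1 / \<bar>x\<bar>)\<^sup>2) \<le> ennreal (2 * (1 / (r\<^sup>2 + x\<^sup>2)))" by (rule ennreal_leI)
      also have "\<dots> = ennreal 2 * ennreal (1 / (r\<^sup>2 + x\<^sup>2))" by (rule ennreal_mult) auto
      finally show ?thesis using False by (simp add: ennreal_power)
    qed (simp add: power2_eq_square)
  qed
  also have "\<dots> = ennreal 2 * (\<integral>\<^sup>+x. ennreal (1 / (r\<^sup>2 + x\<^sup>2)) \<partial>lborel)" by (rule nn_integral_cmult) measurable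
  also have "\<dots> \<le> ennreal 2 * ennreal (4 / r)" by (intro mult_left_mono nn_integral_inverse_square r) auto
  also have "\<dots> = ennreal (8 / r)" using r by (subst ennreal_mult[symmetric]) auto
  finally have "J\<^sup>2 \<le> L2_norm_sq p * ennreal (8 / r)" by (simp add: mult_left_mono)
  also have "\<dots> \<le> ennreal E * ennreal (8 / r)" by (intro mult_right_mono L) auto
  also have "\<dots> = ennreal (8 * E / r)" using L(2) r by (subst ennreal_mult[symmetric]) (auto simp: mult.commute)
  finally have J2: "J\<^sup>2 \<le> ennreal (8 * E / r)" .
  have J: "J \<le> ennreal (sqrt (8 * E / r))"
  proof (cases J)
    case (real j)
    with J2 have "j\<^sup>2 \<le> 8 * E / r" using L(2) r by (simp add: ennreal_power)
    then have "j \<le> sqrt (8 * E / r)" by (rule real_le_rsqrt)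
    then show ?thesis using real by (simp add: ennreal_leI)
  next
    case top then show ?thesis using J2 by (simp add: power2_eq_square ennreal_mult_top top_unique)
  qed
  have "poisson_mass r p \<le> (\<integral>\<^sup>+x. ennreal (sqrt (p x / \<bar>x\<bar>^3)) * ennreal (sqrt (p x / \<bar>x\<bar>)) \<partial>lborel)"
    unfolding poisson_mass_def
  proof (intro nn_integral_mono)
    fix x
    show "ennreal (p x / (r\<^sup>2 + x\<^sup>2)) \<le> ennreal (sqrt (p x / \<bar>x\<bar>^3)) * ennreal (sqrt (p x / \<bar>x\<bar>))"
    proof (cases "p x = 0")
      case False
      have x: "0 < \<bar>x\<bar>" using xr[OF False] r by simp
      have "sqrt (p x / \<bar>x\<bar>^3) * sqrt (p x / \<bar>x\<bar>) = sqrt ((p x / \<bar>x\<bar>\<^sup>2)\<^sup>2)"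
        by (simp add: real_sqrt_mult[symmetric] power2_eq_square power3_eq_cube mult_ac)
      also have "\<dots> = p x / x\<^sup>2" using pb[of x] by (simp only: real_sqrt_abs) simp
      finally have eq: "sqrt (p x / \<bar>x\<bar>^3) * sqrt (p x / \<bar>x\<bar>) = p x / x\<^sup>2" .
      have "p x / (r\<^sup>2 + x\<^sup>2) \<le> p x / x\<^sup>2" using x pb[of x] by (intro divide_left_mono mult_pos_pos add_nonneg_pos) auto
      then have "ennreal (p x / (r\<^sup>2 + x\<^sup>2)) \<le> ennreal (sqrt (p x / \<bar>x\<bar>^3) * sqrt (p x / \<bar>x\<bar>))" unfolding eq by (rule ennreal_leI)
      also have "\<dots> = ennreal (sqrt (p x / \<bar>x\<bar>^3)) * ennreal (sqrt (p x / \<bar>x\<bar>))" using pb[of x] by (intro ennreal_mult) auto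
      finally show ?thesis .
    qed simp
  qed
  then have "(poisson_mass r p)\<^sup>2 \<le> (\<integral>\<^sup>+x. ennreal (sqrt (p x / \<bar>x\<bar>^3)) * ennreal (sqrt (p x / \<bar>x\<bar>)) \<partial>lborel)\<^sup>2" by (intro power_mono) auto
  also have "\<dots> \<le> (\<integral>\<^sup>+x. (ennreal (sqrt (p x / \<bar>x\<bar>^3)))\<^sup>2 \<partial>lborel) * (\<integral>\<^sup>+x. (ennreal (sqrt (p x / \<bar>x\<bar>)))\<^sup>2 \<partial>lborel)"
    by (rule Cauchy_Schwarz_nn_integral; measurable)
  also have "\<dots> = tail_moment p * J" unfolding tail_moment_def J_def using pb by (simp add: ennreal_power)
  also have "\<dots> \<le> tail_moment p * ennreal (sqrt (8 * E / r))" by (intro mult_left_mono J) auto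
  finally show ?thesis .
qed

text \<open>Cutting costs at most a constant times \<open>r V\<^sup>2 + r\<^sup>-\<^sup>3\<close>, where \<open>V\<close> is the Poisson mass of the remaining
  profile. Moving the two parts together gains at least \<open>r\<close> times a multiple of the tail moment \<open>N\<close>, while
  \<open>V\<^sup>2 \<le> N sqrt (8 E / r)\<close> and \<open>r\<^sup>-\<^sup>3\<close> is bounded by a multiple of \<open>N\<close>. So the gain wins for large \<open>r\<close>.\<close>

lemma surgery:
  assumes E: "E > 0"
  obtains R where "R \<ge> 1" "\<And>u r. profile u \<Longrightarrow> profile_energy u \<le> ennreal E \<Longrightarrow> R \<le> r \<Longrightarrow> u (- 4 * r) = 2 \<Longrightarrow> u (4 * r) = 2
    \<Longrightarrow> profile_energy (glue r (cutoff r u)) \<le> profile_energy u"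
proof -
  \<comment> \<open>Chosen such that, by Hoelder continuity, \<open>u \<ge> 1\<close> within
    distance \<open>d\<close> of a peak.\<close>
  define d where "d = min 1 (1 / (4 * E))"
  have d: "0 < d" "d \<le> 1" "4 * E * d \<le> 1" using E by (auto simp: d_def min_def field_simps)
  define C :: real where "C = 30000000"
  \<comment> \<open>The three bounds serve, in this order, the hypothesis of
    \<open>cutoff_energy\<close>, the estimate that the \<open>r^-3\<close> part of the cost takes
    at most half of the gain (\<open>108000 = 125 * 864\<close>), and the same for the part with
    \<open>v^2\<close>. The number \<open>864 = 2 * 432\<close> stands for half of the gain.\<close>
  define R where "R = max 18432 (max (108000 * C / d\<^sup>2) (8 * E * (864 * C / d)\<^sup>2))"
  show ?thesis
  proof (rule that[of R])
    show "R \<ge> 1" by (simp add: R_def)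
    fix u r assume u: "profile u" and profile_energy: "profile_energy u \<le> ennreal E" and rR: "R \<le> r" and w: "u (- 4 * r) = 2" "u (4 * r) = 2"
    have r: "r \<ge> 18432" "r \<ge> 108000 * C / d\<^sup>2" "r \<ge> 8 * E * (864 * C / d)\<^sup>2" using rR by (auto simp: R_def)
    then have r0: "r > 0" "r \<ge> 1" by auto
    define p where "p = cutoff r u"
    have p: "profile p" unfolding p_def by (rule profile_cutoff(1)[OF u r0(1)])
    have pz: "p x = 0" if "\<bar>x\<bar> \<le> r" for x unfolding p_def by (rule profile_cutoff(4)[OF u r0(1) that])
    have fin: "profile_energy u < \<infinity>" using profile_energy by (auto simp: less_top[symmetric] top_unique)
    have wall: "1 \<le> p x" if x: "4 * r \<le> \<bar>x\<bar>" "\<bar>x\<bar> \<le> 4 * r + d" for x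
    proof -
      obtain y where y: "u y = 2" "\<bar>x - y\<bar> \<le> d"
      proof (cases "x \<ge> 0")
        case True then show ?thesis using x w by (intro that[of "4 * r"]) auto
      next
        case False then show ?thesis using x w by (intro that[of "- 4 * r"]) auto
      qed
      have "(u x - 2)\<^sup>2 \<le> 4 * E * \<bar>x - y\<bar>" using profile_hoelder[OF u profile_energy, of x y] E y by simp
      also have "\<dots> \<le> 4 * E * d" using y E by (intro mult_left_mono) auto
      finally have "\<bar>u x - 2\<bar>\<^sup>2 \<le> 1\<^sup>2" using d by simp
      then have "\<bar>u x - 2\<bar> \<le> 1" by (rule power2_le_imp_le) simp
      then show ?thesis using profile_cutoff(5)[OF u r0(1), of x] x r0 by (simp add: p_def)
    qed
    have dr: "d \<le> r" using d r0 by simp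
    have cub: "ennreal (d / 432) * tail_moment p \<le> cubic_interaction p" "ennreal (d / (125 * r^3)) \<le> tail_moment p"
      using cubic_interaction_lower_bound[of p r d] p r0(1) pz d(1) dr wall by blast+
    obtain v where v: "poisson_mass r p = ennreal v" "v \<ge> 0" and EC: "profile_energy p \<le> profile_energy u + ennreal (C * (r * v\<^sup>2 + 1 / r^3))"
      using cutoff_energy[OF u r(1) fin] unfolding p_def C_def by blast
    have "L2_norm_sq p \<le> L2_norm_sq u"
      using L2_cutoff(1)[OF u r0(1)] unfolding p_def by (rule order_trans[rotated]) simp
    also have "\<dots> \<le> profile_energy u" by (simp add: profile_energy_def)
    also have "\<dots> \<le> ennreal E" by (rule profile_energy)
    finally have L: "L2_norm_sq p \<le> ennreal E" .
    then have Lf: "L2_norm_sq p < \<infinity>" by (auto simp: less_top[symmetric] top_unique)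
    have ENg: "profile_energy (glue r p) + ennreal r * cubic_interaction p \<le> profile_energy p" by (rule profile_energy_glue[OF p r0(2) pz Lf])
    have ENp: "profile_energy p < \<infinity>" using EC fin by (auto simp: less_top[symmetric] top_unique)
    have "ennreal r * cubic_interaction p \<le> profile_energy p" using ENg by (rule order_trans[rotated]) simp
    then have "cubic_interaction p < \<infinity>" using ENp r0 by (auto simp: less_top[symmetric] top_unique ennreal_mult_top)
    then obtain c where c: "cubic_interaction p = ennreal c" "c \<ge> 0" by (cases "cubic_interaction p") auto
    have "tail_moment p < \<infinity>"
      using cub(1) d(1) unfolding c(1) by (cases "tail_moment p") (auto simp: ennreal_mult_top top_unique)
    then obtain n where n: "tail_moment p = ennreal n" "n \<ge> 0" by (cases "tail_moment p") auto
    have cn: "d / 432 * n \<le> c" using cub(1) n c d unfolding n(1) c(1) by (simp add: ennreal_mult[symmetric])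
    have nd: "d / (125 * r^3) \<le> n" using cub(2) n unfolding n(1) by (subst (asm) ennreal_le_iff) auto
    have vn: "v\<^sup>2 \<le> n * sqrt (8 * E / r)"
      using poisson_mass_tail_bound[OF p r0(1) pz L] E v n r0 unfolding v(1) n(1)
      by (simp add: ennreal_power ennreal_mult[symmetric])
    have "sqrt (8 * E / r) \<le> d / (864 * C)"
    proof (rule real_le_lsqrt)
      have KK: "(864 * C / d)\<^sup>2 * (d / (864 * C))\<^sup>2 = 1" using d by (simp add: power_mult_distrib[symmetric] C_def)
      have "8 * E = 8 * E * (864 * C / d)\<^sup>2 * (d / (864 * C))\<^sup>2" unfolding mult.assoc KK by simp
      also have "\<dots> \<le> r * (d / (864 * C))\<^sup>2" by (intro mult_right_mono r) auto
      finally show "8 * E / r \<le> (d / (864 * C))\<^sup>2" using r0 by (simp only: divide_le_eq mult.commute) simp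
    qed (use d E r0 in \<open>auto simp: C_def\<close>)
    then have "n * sqrt (8 * E / r) \<le> n * (d / (864 * C))" using n by (intro mult_left_mono) auto
    with vn have "v\<^sup>2 \<le> n * (d / (864 * C))" by (rule order_trans)
    then have "C * r * v\<^sup>2 \<le> C * r * (n * (d / (864 * C)))" using r0 by (intro mult_left_mono) (auto simp: C_def)
    also have "\<dots> = r * (d / 864 * n)" by (simp add: C_def)
    finally have a1: "C * r * v\<^sup>2 \<le> r * (d / 864 * n)" .
    have "1 / r^3 \<le> 125 / d * n" using nd d r0 by (simp add: field_simps)
    then have "C * (1 / r^3) \<le> C * (125 / d * n)" by (intro mult_left_mono) (auto simp: C_def)
    also have "\<dots> = 108000 * C / d\<^sup>2 * (d / 864 * n)" using d by (simp add: power2_eq_square)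
    also have "\<dots> \<le> r * (d / 864 * n)" using r(2) d n by (intro mult_right_mono) auto
    finally have a2: "C * (1 / r^3) \<le> r * (d / 864 * n)" .
    have "r * (d / 432 * n) \<le> r * c" using cn r0 by (intro mult_left_mono) auto
    moreover have "C * (r * v\<^sup>2 + 1 / r^3) = C * r * v\<^sup>2 + C * (1 / r^3)" by (simp add: distrib_left)
    moreover have "r * (d / 432 * n) = r * (d / 864 * n) + r * (d / 864 * n)" by simp
    ultimately have "C * (r * v\<^sup>2 + 1 / r^3) \<le> r * c" using a1 a2 by linarith
    then have le: "profile_energy u + ennreal (C * (r * v\<^sup>2 + 1 / r^3)) \<le> profile_energy u + ennreal (r * c)" by (intro add_left_mono ennreal_leI)
    have "ennreal r * cubic_interaction p = ennreal (r * c)" unfolding c(1) using r0 c by (intro ennreal_mult[symmetric]) auto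
    then have "profile_energy (glue r p) + ennreal (r * c) \<le> profile_energy p" using ENg by simp
    also note EC
    also note le
    finally have "profile_energy (glue r p) + ennreal (r * c) \<le> profile_energy u + ennreal (r * c)" .
    then show "profile_energy (glue r (cutoff r u)) \<le> profile_energy u" unfolding p_def[symmetric]
      by (simp add: add.commute[of _ "ennreal (r * c)"])
  qed
qed

section \<open>Shortening long gaps until the spread of the peaks is bounded\<close>

definition alternates :: "(real \<Rightarrow> real) \<Rightarrow> nat \<Rightarrow> (nat \<Rightarrow> real) \<Rightarrow> bool" where
  "alternates u N z \<longleftrightarrow> (\<forall>j<N. z j < z (Suc j)) \<and> (\<forall>j\<le>N. u (z j) = (if even j then 2 else 0))"

lemma alternates_mono:
  assumes "alternates u N z" "i \<le> j" "j \<le> N"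
  shows "z i \<le> z j"
  using assms(2,3)
proof (induction j rule: dec_induct)
  case (step n)
  then have "z n < z (Suc n)" using assms(1) by (auto simp: alternates_def)
  with step show ?case by simp
qed simp

text \<open>After centring, the two peaks sit at \<open>- 4 * r\<close> and \<open>4 * r\<close>,
  outside the cut, so all prescribed values away from the gap persist. The old zero between them may
  be lost, but the cut creates one at the origin, which takes its place. Everything to the right
  moves left by \<open>r\<close>.\<close>

lemma shorten_gap:
  assumes u: "profile u" and z: "alternates u (2 * k) z" and i: "i < k"
    and r: "r > 0" "z (2 * i + 2) - z (2 * i) = 8 * r"
  defines "c \<equiv> (z (2 * i) + z (2 * i + 2)) / 2"
  obtains z' where "alternates (glue r (cutoff r (\<lambda>x. u (x + c)))) (2 * k) z'" "z' (2 * k) - z' 0 = z (2 * k) - z 0 - r"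
proof -
  define v where "v x = u (x + c)" for x
  have v: "profile v" unfolding v_def by (rule profile_translate[OF u])
  define w where "w = glue r (cutoff r v)"
  define z' where "z' j = (if j \<le> 2 * i then z j - c else if j = 2 * i + 1 then 0 else z j - c - r)" for j
  have c1: "z (2 * i) - c = - 4 * r" "z (2 * i + 2) - c = 4 * r" using r(2) unfolding c_def by (auto simp: field_simps)
  have zs: "z j < z (Suc j)" if "j < 2 * k" for j using z that by (simp add: alternates_def)
  have zv: "u (z j) = (if even j then 2 else 0)" if "j \<le> 2 * k" for j using z that by (simp add: alternates_def)
  have lo: "z j - c \<le> - 4 * r" if "j \<le> 2 * i" for j
    using alternates_mono[OF z that] i c1(1) by simp
  have hi: "4 * r \<le> z j - c" if "2 * i + 2 \<le> j" "j \<le> 2 * k" for j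
    using alternates_mono[OF z that] c1(2) by simp
  have "alternates w (2 * k) z'"
    unfolding alternates_def
  proof (intro conjI allI impI)
    fix j assume j: "j < 2 * k"
    consider "Suc j \<le> 2 * i" | "j = 2 * i" | "j = 2 * i + 1" | "2 * i + 2 \<le> j" by linarith
    then show "z' j < z' (Suc j)"
    proof cases
      case 1 then show ?thesis using zs[OF j] by (simp add: z'_def)
    next
      case 2 then show ?thesis using c1 r by (simp add: z'_def)
    next
      case 3 then show ?thesis using c1 r by (simp add: z'_def)
    next
      case 4 then show ?thesis using zs[OF j] by (simp add: z'_def)
    qed
  next
    fix j assume j: "j \<le> 2 * k"
    consider "j \<le> 2 * i" | "j = 2 * i + 1" | "2 * i + 2 \<le> j" by linarith
    then show "w (z' j) = (if even j then 2 else 0)"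
    proof cases
      case 1
      have "w (z' j) = cutoff r v (z j - c)" using 1 lo[OF 1] r by (simp add: w_def glue_def z'_def)
      also have "\<dots> = v (z j - c)" using lo[OF 1] r by (intro profile_cutoff(5)[OF v r(1)]) auto
      finally show ?thesis using zv[OF j] by (simp add: v_def)
    next
      case 2
      have "w (z' j) = cutoff r v 0" using 2 by (simp add: w_def glue_def z'_def)
      also have "\<dots> = 0" using r by (intro profile_cutoff(4)[OF v r(1)]) auto
      finally show ?thesis using 2 by simp
    next
      case 3
      have "w (z' j) = cutoff r v (z j - c)" using 3 hi[OF 3 j] r by (simp add: w_def glue_def z'_def)
      also have "\<dots> = v (z j - c)" using hi[OF 3 j] r by (intro profile_cutoff(5)[OF v r(1)]) auto
      finally show ?thesis using zv[OF j] by (simp add: v_def)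
    qed
  qed
  moreover have "z' (2 * k) - z' 0 = z (2 * k) - z 0 - r" using i by (simp add: z'_def)
  ultimately show ?thesis using that unfolding w_def v_def by blast
qed

text \<open>If the spread exceeds \<open>k * 8 * R\<close>, one of the \<open>k\<close> distances
  between consecutive peaks exceeds \<open>8 * R\<close>, and the surgery applies with
  \<open>r\<close> an eighth of that distance. Each surgery shortens the spread by at least
  \<open>R \<ge> 1\<close>, which makes induction on an integer bound for the spread
  possible.\<close>

lemma bounded_spread:
  assumes E: "E > 0"
  obtains M where "\<And>u z. profile u \<Longrightarrow> profile_energy u \<le> ennreal E \<Longrightarrow> alternates u (2 * k) z \<Longrightarrow>
    \<exists>u' z'. profile u' \<and> profile_energy u' \<le> profile_energy u \<and> alternates u' (2 * k) z' \<and> z' (2 * k) - z' 0 \<le> M"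
proof -
  obtain R where R: "R \<ge> 1" and surg: "\<And>u r. profile u \<Longrightarrow> profile_energy u \<le> ennreal E \<Longrightarrow> R \<le> r \<Longrightarrow> u (- 4 * r) = 2 \<Longrightarrow> u (4 * r) = 2
    \<Longrightarrow> profile_energy (glue r (cutoff r u)) \<le> profile_energy u"
    using surgery[OF E] by blast
  define M where "M = real k * (8 * R)"
  have "\<exists>u' z'. profile u' \<and> profile_energy u' \<le> profile_energy u \<and> alternates u' (2 * k) z' \<and> z' (2 * k) - z' 0 \<le> M"
    if "profile u" "profile_energy u \<le> ennreal E" "alternates u (2 * k) z" "z (2 * k) - z 0 \<le> real n" for u z n
    using that
  proof (induction n arbitrary: u z)
    case 0
    have "0 \<le> M" using R by (simp add: M_def)
    then show ?case using 0 by (intro exI[of _ u] exI[of _ z]) auto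
  next
    case (Suc n)
    show ?case
    proof (cases "z (2 * k) - z 0 \<le> M")
      case True then show ?thesis using Suc.prems by blast
    next
      case False
      have "\<exists>i<k. 8 * R < z (2 * i + 2) - z (2 * i)"
      proof (rule ccontr)
        assume "\<not> ?thesis"
        then have "z (2 * i + 2) - z (2 * i) \<le> 8 * R" if "i < k" for i using that not_less by blast
        then have "(\<Sum>i<k. z (2 * Suc i) - z (2 * i)) \<le> (\<Sum>i<k. 8 * R)" by (intro sum_mono) simp
        then have "z (2 * k) - z 0 \<le> M" by (simp only: sum_lessThan_telescope[of "\<lambda>i. z (2 * i)"]) (simp add: M_def)
        with False show False by simp
      qed
      then obtain i where i: "i < k" "8 * R < z (2 * i + 2) - z (2 * i)" by blast
      define r where "r = (z (2 * i + 2) - z (2 * i)) / 8"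
      have r: "R \<le> r" "r > 0" "z (2 * i + 2) - z (2 * i) = 8 * r" using i R by (auto simp: r_def)
      define c where "c = (z (2 * i) + z (2 * i + 2)) / 2"
      define v where "v x = u (x + c)" for x
      have v: "profile v" unfolding v_def by (rule profile_translate[OF Suc.prems(1)])
      have ENv: "profile_energy v = profile_energy u" unfolding v_def by (rule profile_energy_translate[OF profile_measurable[OF Suc.prems(1)]])
      define w where "w = glue r (cutoff r v)"
      have zz: "u (z (2 * i)) = 2" "u (z (2 * i + 2)) = 2" using Suc.prems(3) i(1) by (auto simp: alternates_def)
      have "- 4 * r + c = z (2 * i)" "4 * r + c = z (2 * i + 2)" using r(3) unfolding c_def by (auto simp: field_simps)
      then have "v (- 4 * r) = 2" "v (4 * r) = 2" unfolding v_def using zz by simp_all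
      then have ENw: "profile_energy w \<le> profile_energy u" unfolding w_def using surg[OF v _ r(1)] Suc.prems(2) ENv by simp
      have w: "profile w" unfolding w_def
        by (rule profile_glue[OF profile_cutoff(1)[OF v r(2)] r(2) profile_cutoff(4)[OF v r(2)]])
      obtain z' where z': "alternates w (2 * k) z'" "z' (2 * k) - z' 0 = z (2 * k) - z 0 - r"
        using shorten_gap[OF Suc.prems(1,3) i(1) r(2,3)] unfolding w_def v_def[abs_def] c_def by blast
      have "z' (2 * k) - z' 0 \<le> real n" using z'(2) Suc.prems(4) r R by simp
      then obtain u' z'' where "profile u'" "profile_energy u' \<le> profile_energy w" "alternates u' (2 * k) z''" "z'' (2 * k) - z'' 0 \<le> M"
        using Suc.IH[OF w order_trans[OF ENw Suc.prems(2)] z'(1)] by blast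
      then show ?thesis using ENw order_trans by blast
    qed
  qed
  moreover have "\<exists>n. x \<le> real n" for x :: real using real_arch_simple by blast
  ultimately show ?thesis using that by meson
qed

section \<open>Compactness\<close>

lemma liminf_add_le_ennreal:
  fixes f g :: "nat \<Rightarrow> ennreal"
  shows "liminf f + liminf g \<le> liminf (\<lambda>n. f n + g n)"
proof -
  have inc: "incseq (\<lambda>n. INF m\<in>{n..}. h m)" for h :: "nat \<Rightarrow> ennreal"
    by (intro incseq_SucI INF_superset_mono) auto
  have "liminf f + liminf g = (SUP n. (INF m\<in>{n..}. f m) + (INF m\<in>{n..}. g m))"
    unfolding liminf_SUP_INF by (rule ennreal_SUP_add[symmetric]) (rule inc)+
  also have "\<dots> \<le> (SUP n. INF m\<in>{n..}. f m + g m)"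
    by (intro SUP_mono) (auto intro!: INF_greatest add_mono INF_lower)
  finally show ?thesis by (simp add: liminf_SUP_INF)
qed

lemma liminf_mult_le_ennreal:
  fixes f :: "nat \<Rightarrow> ennreal"
  shows "c * liminf f \<le> liminf (\<lambda>n. c * f n)"
  unfolding liminf_SUP_INF SUP_mult_left_ennreal
  by (intro SUP_mono) (auto intro!: INF_greatest mult_left_mono INF_lower)

lemma nn_integral_fatou:
  fixes f :: "nat \<Rightarrow> 'a \<Rightarrow> real"
  assumes [measurable]: "\<And>k. f k \<in> borel_measurable M" and lim: "\<And>x. (\<lambda>k. f k x) \<longlonglongrightarrow> F x"
  shows "(\<integral>\<^sup>+x. ennreal (F x) \<partial>M) \<le> liminf (\<lambda>k. \<integral>\<^sup>+x. ennreal (f k x) \<partial>M)"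
proof -
  have "(\<integral>\<^sup>+x. ennreal (F x) \<partial>M) = (\<integral>\<^sup>+x. liminf (\<lambda>k. ennreal (f k x)) \<partial>M)"
    by (intro nn_integral_cong lim_imp_Liminf[symmetric] tendsto_ennrealI lim) auto
  also have "\<dots> \<le> liminf (\<lambda>k. \<integral>\<^sup>+x. ennreal (f k x) \<partial>M)" by (rule nn_integral_liminf) measurable
  finally show ?thesis .
qed

text \<open>Every term is an integral, or a supremum of integrals, of a nonnegative continuous
  expression in values of the function, so Fatou applies under mere pointwise convergence. For the
  Dirichlet part this is the benefit of \<open>dq\<close>.\<close>

lemma profile_energy_lower_semicontinuous:
  assumes [measurable]: "\<And>k. u k \<in> borel_measurable borel" and lim: "\<And>x. (\<lambda>k. u k x) \<longlonglongrightarrow> v x"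
  shows "profile_energy v \<le> liminf (\<lambda>k. profile_energy (u k))"
proof -
  have [measurable]: "v \<in> borel_measurable borel" by (rule borel_measurable_LIMSEQ_real[OF lim]) measurable
  have L: "L2_norm_sq v \<le> liminf (\<lambda>k. L2_norm_sq (u k))"
    unfolding L2_norm_sq_def by (intro nn_integral_fatou tendsto_intros lim) measurable
  have "gagliardo v \<le> (\<integral>\<^sup>+t. liminf (\<lambda>k. \<integral>\<^sup>+s. ennreal (\<bar>u k s - u k t\<bar>\<^sup>2 / \<bar>s - t\<bar>\<^sup>2) \<partial>lborel) \<partial>lborel)"
    unfolding gagliardo_def
  proof (intro nn_integral_mono nn_integral_fatou)
    fix s t
    have "(\<lambda>k. \<bar>u k s - u k t\<bar>\<^sup>2 * inverse (\<bar>s - t\<bar>\<^sup>2)) \<longlonglongrightarrow> \<bar>v s - v t\<bar>\<^sup>2 * inverse (\<bar>s - t\<bar>\<^sup>2)"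
      by (intro tendsto_intros lim)
    then show "(\<lambda>k. \<bar>u k s - u k t\<bar>\<^sup>2 / \<bar>s - t\<bar>\<^sup>2) \<longlonglongrightarrow> \<bar>v s - v t\<bar>\<^sup>2 / \<bar>s - t\<bar>\<^sup>2"
      by (simp add: divide_inverse)
  qed measurable
  also have "\<dots> \<le> liminf (\<lambda>k. gagliardo (u k))"
    unfolding gagliardo_def by (rule nn_integral_liminf) measurable
  finally have "Hdot_half_sq v \<le> ennreal (1 / (2 * pi)) * liminf (\<lambda>k. gagliardo (u k))"
    unfolding Hdot_gagliardo by (rule mult_left_mono) simp
  also have "\<dots> \<le> liminf (\<lambda>k. Hdot_half_sq (u k))" unfolding Hdot_gagliardo by (rule liminf_mult_le_ennreal)
  finally have H: "Hdot_half_sq v \<le> liminf (\<lambda>k. Hdot_half_sq (u k))" .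
  have dq: "dq (half_cos v) n + dq (half_sin v) n \<le> liminf (\<lambda>k. half_angle_energy (u k))" for n
  proof -
    have "dq (half_cos v) n + dq (half_sin v) n \<le> liminf (\<lambda>k. dq (half_cos (u k)) n) + liminf (\<lambda>k. dq (half_sin (u k)) n)"
      unfolding dq_def by (intro add_mono nn_integral_fatou; (measurable)?) (auto simp: half_cos_def half_sin_def intro!: tendsto_intros lim)
    also have "\<dots> \<le> liminf (\<lambda>k. dq (half_cos (u k)) n + dq (half_sin (u k)) n)" by (rule liminf_add_le_ennreal)
    also have "\<dots> \<le> liminf (\<lambda>k. half_angle_energy (u k))" unfolding half_angle_energy_def by (intro Liminf_mono always_eventually allI SUP_upper) auto
    finally show ?thesis .
  qed
  have D: "half_angle_energy v \<le> liminf (\<lambda>k. half_angle_energy (u k))" unfolding half_angle_energy_def[of v] by (intro SUP_least dq)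
  have "profile_energy v \<le> 4 * liminf (\<lambda>k. half_angle_energy (u k)) + liminf (\<lambda>k. Hdot_half_sq (u k)) + liminf (\<lambda>k. L2_norm_sq (u k))"
    unfolding profile_energy_def by (intro add_mono mult_left_mono D H L) auto
  also have "\<dots> \<le> liminf (\<lambda>k. 4 * half_angle_energy (u k)) + liminf (\<lambda>k. Hdot_half_sq (u k)) + liminf (\<lambda>k. L2_norm_sq (u k))"
    by (intro add_right_mono liminf_mult_le_ennreal)
  also have "\<dots> \<le> liminf (\<lambda>k. 4 * half_angle_energy (u k) + Hdot_half_sq (u k)) + liminf (\<lambda>k. L2_norm_sq (u k))"
    by (intro add_right_mono liminf_add_le_ennreal)
  also have "\<dots> \<le> liminf (\<lambda>k. profile_energy (u k))" unfolding profile_energy_def by (rule liminf_add_le_ennreal)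
  finally show ?thesis .
qed

text \<open>Arzela-Ascoli in pointwise form: a subsequence converges on the rationals, and the
  uniform Hoelder bound spreads the convergence to the line. The bound on the points
  \<open>z\<close> keeps the peaks from escaping, and neighbouring limit points stay distinct
  because the limit takes the values 2 and 0 there.\<close>

lemma profile_compactness:
  fixes u :: "nat \<Rightarrow> real \<Rightarrow> real"
  assumes u: "\<And>n. profile (u n)" and E: "\<And>n. profile_energy (u n) \<le> ennreal E" "0 \<le> E"
    and z: "\<And>n. alternates (u n) N (z n)" and zb: "\<And>n j. j \<le> N \<Longrightarrow> \<bar>z n j\<bar> \<le> M"
  obtains v \<zeta> r where "profile v" "alternates v N \<zeta>" "strict_mono (r :: nat \<Rightarrow> nat)" "\<And>x. (\<lambda>n. u (r n) x) \<longlonglongrightarrow> v x"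
proof -
  have ub: "0 \<le> u n x \<and> u n x \<le> 2" for n x using u by (simp add: profile_def)
  have H: "\<bar>u n x - u n y\<bar> \<le> sqrt (4 * E * \<bar>x - y\<bar>)" for n x y
    using real_le_rsqrt[OF profile_hoelder[OF u E, of n x y]] real_sqrt_le_mono[OF profile_hoelder[OF u E, of n x y]] by simp
  obtain r1 where r1: "strict_mono (r1 :: nat \<Rightarrow> nat)" and l1: "\<And>x. x \<in> \<rat> \<Longrightarrow> \<exists>l. (\<lambda>n. u (r1 n) x) \<longlonglongrightarrow> l"
    using function_convergent_subsequence[of "\<rat> :: real set" u 2] countable_rat ub by auto
  obtain r2 where r2: "strict_mono (r2 :: nat \<Rightarrow> nat)" and l2: "\<And>j. j \<in> {..N} \<Longrightarrow> \<exists>l. (\<lambda>n. z (r1 (r2 n)) j) \<longlonglongrightarrow> l"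
    using function_convergent_subsequence[of "{..N}" "\<lambda>n. z (r1 n)" M] zb by auto
  define r where "r n = r1 (r2 n)" for n
  have r: "strict_mono r" using strict_mono_o[OF r1 r2] by (simp add: r_def[abs_def] o_def)
  have lq: "\<exists>l. (\<lambda>n. u (r n) x) \<longlonglongrightarrow> l" if "x \<in> \<rat>" for x
    using l1[OF that] LIMSEQ_subseq_LIMSEQ[OF _ r2] by (fastforce simp: r_def o_def)
  have conv: "convergent (\<lambda>n. u (r n) x)" for x
  proof (rule Cauchy_convergent, rule metric_CauchyI)
    fix e :: real assume e: "e > 0"
    have "((\<lambda>d. sqrt (4 * E * d)) \<longlongrightarrow> sqrt (4 * E * 0)) (at_right 0)" by (intro tendsto_intros)
    then have "\<forall>\<^sub>F d in at_right 0. sqrt (4 * E * d) < e / 3" using e by (intro order_tendstoD(2)) auto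
    then obtain d where d: "d > 0" "\<And>y. 0 < y \<Longrightarrow> y < d \<Longrightarrow> sqrt (4 * E * y) < e / 3"
      unfolding eventually_at_right_field by auto
    obtain q where q: "q \<in> \<rat>" "x < q" "q < x + d" using Rats_dense_in_real[of x "x + d"] d(1) by auto
    have small: "\<bar>u n x - u n q\<bar> < e / 3" for n
      using H[of n x q] d(2)[of "\<bar>x - q\<bar>"] q by auto
    have "Cauchy (\<lambda>n. u (r n) q)" using lq[OF q(1)] by (meson LIMSEQ_imp_Cauchy)
    then obtain n0 where n0: "\<And>m n. m \<ge> n0 \<Longrightarrow> n \<ge> n0 \<Longrightarrow> dist (u (r m) q) (u (r n) q) < e / 3"
      using e unfolding Cauchy_def by (metis divide_pos_pos zero_less_numeral)
    show "\<exists>n0. \<forall>m\<ge>n0. \<forall>n\<ge>n0. dist (u (r m) x) (u (r n) x) < e"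
    proof (intro exI allI impI)
      fix m n assume "n0 \<le> m" "n0 \<le> n"
      from n0[OF this] have "\<bar>u (r m) q - u (r n) q\<bar> < e / 3" by (simp add: dist_real_def)
      then show "dist (u (r m) x) (u (r n) x) < e"
        using small[of "r m"] small[of "r n"] unfolding dist_real_def abs_less_iff by (auto simp: field_simps)
    qed
  qed
  define v where "v x = lim (\<lambda>n. u (r n) x)" for x
  have uv: "(\<lambda>n. u (r n) x) \<longlonglongrightarrow> v x" for x using conv[of x] by (simp add: v_def convergent_LIMSEQ_iff)
  have vH: "\<bar>v x - v y\<bar> \<le> sqrt (4 * E * \<bar>x - y\<bar>)" for x y
  proof (rule LIMSEQ_le_const2)
    show "(\<lambda>n. \<bar>u (r n) x - u (r n) y\<bar>) \<longlonglongrightarrow> \<bar>v x - v y\<bar>" by (intro tendsto_intros uv)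
  qed (use H in auto)
  have "isCont v x" for x
    unfolding isCont_def
  proof (rule LIM_zero_cancel, rule Lim_null_comparison)
    show "\<forall>\<^sub>F y in at x. norm (v y - v x) \<le> sqrt (4 * E * \<bar>y - x\<bar>)" using vH by (intro always_eventually) auto
    have "((\<lambda>y. sqrt (4 * E * \<bar>y - x\<bar>)) \<longlongrightarrow> sqrt (4 * E * \<bar>x - x\<bar>)) (at x)" by (intro tendsto_intros)
    then show "((\<lambda>y. sqrt (4 * E * \<bar>y - x\<bar>)) \<longlongrightarrow> 0) (at x)" by simp
  qed
  then have "continuous_on UNIV v" by (simp add: continuous_at_imp_continuous_on)
  moreover have "0 \<le> v x \<and> v x \<le> 2" for x
    using LIMSEQ_le_const[OF uv[of x], of 0] LIMSEQ_le_const2[OF uv[of x], of 2] ub by auto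
  ultimately have v: "profile v" by (simp add: profile_def)
  have "\<forall>j\<in>{..N}. \<exists>l. (\<lambda>n. z (r n) j) \<longlonglongrightarrow> l" using l2 by (simp add: r_def)
  then obtain \<zeta> where \<zeta>: "\<And>j. j \<le> N \<Longrightarrow> (\<lambda>n. z (r n) j) \<longlonglongrightarrow> \<zeta> j" using bchoice[of "{..N}"] by (metis atMost_iff)
  have val: "v (\<zeta> j) = (if even j then 2 else 0)" if j: "j \<le> N" for j
  proof -
    define c :: real where "c = (if even j then 2 else 0)"
    have c: "u n (z n j) = c" for n using z[of n] j by (simp add: alternates_def c_def)
    have "(\<lambda>n. u (r n) (\<zeta> j) - c) \<longlonglongrightarrow> 0"
    proof (rule Lim_null_comparison)
      show "\<forall>\<^sub>F n in sequentially. norm (u (r n) (\<zeta> j) - c) \<le> sqrt (4 * E * \<bar>\<zeta> j - z (r n) j\<bar>)"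
        using H[of _ "\<zeta> j" "z _ j"] c by (intro always_eventually allI) (metis real_norm_def)
      have "(\<lambda>n. sqrt (4 * E * \<bar>\<zeta> j - z (r n) j\<bar>)) \<longlonglongrightarrow> sqrt (4 * E * \<bar>\<zeta> j - \<zeta> j\<bar>)" by (intro tendsto_intros \<zeta> j)
      then show "(\<lambda>n. sqrt (4 * E * \<bar>\<zeta> j - z (r n) j\<bar>)) \<longlonglongrightarrow> 0" by simp
    qed
    then have "(\<lambda>n. u (r n) (\<zeta> j)) \<longlonglongrightarrow> c" by (rule LIM_zero_cancel)
    then show ?thesis using uv[of "\<zeta> j"] LIMSEQ_unique unfolding c_def by blast
  qed
  have "\<zeta> j < \<zeta> (Suc j)" if j: "j < N" for j
  proof -
    have "z n j \<le> z n (Suc j)" for n using z[of n] j by (auto simp: alternates_def intro: less_imp_le)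
    then have "\<zeta> j \<le> \<zeta> (Suc j)" using j by (intro LIMSEQ_le[OF \<zeta>[of j] \<zeta>[of "Suc j"]]) auto
    moreover have "\<zeta> j \<noteq> \<zeta> (Suc j)" using val[of j] val[of "Suc j"] j by (metis Suc_leI even_Suc less_imp_le numeral_One zero_neq_numeral)
    ultimately show ?thesis by simp
  qed
  then have "alternates v N \<zeta>" using val by (simp add: alternates_def)
  then show ?thesis using that v r uv by blast
qed

text \<open>Almost minimising profiles are traded for ones of bounded spread without raising the
  energy. Translating the first peak to the origin then bounds all marked points, and compactness
  with lower semicontinuity concludes.\<close>

lemma profile_energy_minimiser_exists:
  assumes v0: "profile v0" "alternates v0 (2 * k) z0" "profile_energy v0 < \<infinity>"
  obtains u z where "profile u" "alternates u (2 * k) z" "\<And>v z'. profile v \<Longrightarrow> alternates v (2 * k) z' \<Longrightarrow> profile_energy u \<le> profile_energy v"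
proof -
  define K where "K = {v. profile v \<and> (\<exists>z. alternates v (2 * k) z)}"
  define I where "I = (INF v\<in>K. profile_energy v)"
  have "I \<le> profile_energy v0" unfolding I_def using v0 by (intro INF_lower) (auto simp: K_def)
  then have "I < \<infinity>" using v0(3) by (rule le_less_trans)
  then obtain i where i: "I = ennreal i" "i \<ge> 0" by (cases I) auto
  \<comment> \<open>A level above the infimum that fixes the constants of the surgery for the whole
    minimising sequence.\<close>
  define E where "E = i + 1"
  have E: "E > 0" using i by (simp add: E_def)
  obtain M where M: "\<And>u z. profile u \<Longrightarrow> profile_energy u \<le> ennreal E \<Longrightarrow> alternates u (2 * k) z \<Longrightarrow>
    \<exists>u' z'. profile u' \<and> profile_energy u' \<le> profile_energy u \<and> alternates u' (2 * k) z' \<and> z' (2 * k) - z' 0 \<le> M"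
    using bounded_spread[OF E, of k] by blast
  have "\<exists>u z. profile u \<and> profile_energy u \<le> ennreal (i + 1 / (real n + 1)) \<and> alternates u (2 * k) z \<and> (\<forall>j\<le>2 * k. \<bar>z j\<bar> \<le> M)" for n
  proof -
    have "I < ennreal (i + 1 / (real n + 1))" unfolding i(1) using i(2) by (intro ennreal_lessI) (auto intro: add_nonneg_pos)
    then obtain v where v: "v \<in> K" "profile_energy v < ennreal (i + 1 / (real n + 1))" unfolding I_def by (auto simp: INF_less_iff)
    have "i + 1 / (real n + 1) \<le> E" by (simp add: E_def)
    then have "profile_energy v \<le> ennreal E" using v(2) by (meson ennreal_leI le_less_trans less_imp_le not_less)
    then obtain u' z' where u': "profile u'" "profile_energy u' \<le> profile_energy v" "alternates u' (2 * k) z'" "z' (2 * k) - z' 0 \<le> M"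
      using v(1) M unfolding K_def by blast
    have b: "\<bar>z' j - z' 0\<bar> \<le> M" if "j \<le> 2 * k" for j
      using alternates_mono[OF u'(3), of 0 j] alternates_mono[OF u'(3), of j "2 * k"] that u'(4) by simp
    show ?thesis
    proof (intro exI conjI)
      show "profile (\<lambda>x. u' (x + z' 0))" by (rule profile_translate[OF u'(1)])
      show "profile_energy (\<lambda>x. u' (x + z' 0)) \<le> ennreal (i + 1 / (real n + 1))"
        using profile_energy_translate[OF profile_measurable[OF u'(1)]] u'(2) v(2) by simp
      show "alternates (\<lambda>x. u' (x + z' 0)) (2 * k) (\<lambda>j. z' j - z' 0)" using u'(3) by (simp add: alternates_def)
      show "\<forall>j\<le>2 * k. \<bar>z' j - z' 0\<bar> \<le> M" using b by blast
    qed
  qed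
  then obtain u z where u: "\<And>n. profile (u n)" and profile_energy: "\<And>n. profile_energy (u n) \<le> ennreal (i + 1 / (real n + 1))"
    and z: "\<And>n. alternates (u n) (2 * k) (z n)" and zb: "\<And>n j. j \<le> 2 * k \<Longrightarrow> \<bar>z n j\<bar> \<le> M" by metis
  have "i + 1 / (real n + 1) \<le> E" for n by (simp add: E_def)
  then have ENE: "profile_energy (u n) \<le> ennreal E" for n using profile_energy[of n] by (meson ennreal_leI order_trans)
  obtain v \<zeta> r where v: "profile v" "alternates v (2 * k) \<zeta>" and r: "strict_mono (r :: nat \<Rightarrow> nat)" and uv: "\<And>x. (\<lambda>n. u (r n) x) \<longlonglongrightarrow> v x"
    using profile_compactness[of u E "2 * k" z M] u ENE less_imp_le[OF E] z zb by blast
  have "profile_energy v \<le> liminf (\<lambda>n. profile_energy (u (r n)))" by (rule profile_energy_lower_semicontinuous[OF profile_measurable[OF u] uv])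
  also have "\<dots> \<le> liminf (\<lambda>n. ennreal (i + 1 / (real (r n) + 1)))" by (intro Liminf_mono always_eventually allI profile_energy)
  also have "\<dots> = ennreal (i + 0)"
  proof (rule lim_imp_Liminf)
    have "(\<lambda>n. 1 / (real n + 1)) \<longlonglongrightarrow> 0" by real_asymp
    from LIMSEQ_subseq_LIMSEQ[OF this r] have "(\<lambda>n. 1 / (real (r n) + 1)) \<longlonglongrightarrow> 0" by (simp add: o_def)
    then show "(\<lambda>n. ennreal (i + 1 / (real (r n) + 1))) \<longlonglongrightarrow> ennreal (i + 0)" by (intro tendsto_ennrealI tendsto_intros)
  qed simp
  finally have "profile_energy v \<le> I" by (simp add: i(1))
  moreover have "I \<le> profile_energy w" if "profile w" "alternates w (2 * k) z'" for w z'
    unfolding I_def using that by (intro INF_lower) (auto simp: K_def)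
  ultimately show ?thesis using that[OF v] order_trans by blast
qed

section \<open>From profiles to circle-valued maps\<close>

lemma ennreal_le_of_scaled:
  fixes x y :: ennreal
  assumes "\<And>c. 0 < c \<Longrightarrow> c < 1 \<Longrightarrow> ennreal c * x \<le> y"
  shows "x \<le> y"
proof (cases y)
  case (real b)
  have "x \<noteq> top" using assms[of "1/2"] real by (auto simp: ennreal_mult_top top_unique)
  then obtain a where a: "x = ennreal a" "a \<ge> 0" by (cases x) auto
  have "a \<le> b"
  proof (rule field_le_mult_one_interval)
    fix c :: real assume c: "0 < c" "c < 1"
    then show "c * a \<le> b" using assms[OF c] a real by (simp add: ennreal_mult[symmetric])
  qed
  then show ?thesis using a real by (simp add: ennreal_leI)
qed simp

text \<open>Since \<open>dq f n\<close> increases with \<open>n\<close>, a comparison of increments that is only asymptotically sharp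
  still yields a sharp comparison of energies.\<close>

lemma dq_le_asymptotic:
  assumes [measurable]: "f \<in> borel_measurable borel" "f' \<in> borel_measurable borel" and C: "C \<ge> 0"
    and inc: "\<And>n x. C / 2^n < 1 \<Longrightarrow> (1 - C / 2^n) * ((f (x + 1/2^n) - f x)\<^sup>2 + (f' (x + 1/2^n) - f' x)\<^sup>2) \<le> F n x"
    and [measurable]: "\<And>n. F n \<in> borel_measurable borel"
    and F: "\<And>n. (\<integral>\<^sup>+x. ennreal ((2^n)\<^sup>2 * F n x) \<partial>lborel) \<le> B"
  shows "dq f n + dq f' n \<le> B"
proof (rule ennreal_le_of_scaled)
  fix c :: real assume c: "0 < c" "c < 1"
  have "(\<lambda>n. C / 2^n) \<longlonglongrightarrow> 0" by (rule LIMSEQ_divide_realpow_zero) simp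
  then have "\<forall>\<^sub>F n in sequentially. C / 2^n < 1 - c" using c by (intro order_tendstoD(2)) auto
  then obtain n0 where n0: "\<And>m. m \<ge> n0 \<Longrightarrow> C / 2^m < 1 - c" by (auto simp: eventually_sequentially)
  \<comment> \<open>A step at least as fine as the given one and fine enough for the factor to
    exceed \<open>c\<close>; monotonicity of \<open>dq\<close> brings the bound back to
    \<open>n\<close>.\<close>
  define m where "m = max n n0"
  have m: "C / 2^m < 1 - c" by (rule n0) (simp add: m_def)
  define D where "D x = (f (x + 1/2^m) - f x)\<^sup>2 + (f' (x + 1/2^m) - f' x)\<^sup>2" for x
  have D0: "D x \<ge> 0" for x by (simp add: D_def)
  have [measurable]: "D \<in> borel_measurable borel" unfolding D_def by measurable
  have "ennreal c * (dq f n + dq f' n) \<le> ennreal c * (dq f m + dq f' m)"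
    using incseqD[OF incseq_dq[of f], of n m] incseqD[OF incseq_dq[of f'], of n m]
    by (intro mult_left_mono add_mono) (auto simp: m_def)
  also have "\<dots> = ennreal c * (\<integral>\<^sup>+x. ennreal ((2^m)\<^sup>2 * D x) \<partial>lborel)" by (simp add: dq_add D_def)
  also have "\<dots> = (\<integral>\<^sup>+x. ennreal c * ennreal ((2^m)\<^sup>2 * D x) \<partial>lborel)" by (rule nn_integral_cmult[symmetric]) measurable
  also have "\<dots> \<le> (\<integral>\<^sup>+x. ennreal ((2^m)\<^sup>2 * F m x) \<partial>lborel)"
  proof (intro nn_integral_mono)
    fix x
    have "c * D x \<le> (1 - C / 2^m) * D x" using m D0 by (intro mult_right_mono) auto
    also have "\<dots> \<le> F m x" unfolding D_def by (rule inc) (use m c in linarith)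
    finally have "(2^m)\<^sup>2 * (c * D x) \<le> (2^m)\<^sup>2 * F m x" by (intro mult_left_mono) auto
    then have "ennreal (c * ((2^m)\<^sup>2 * D x)) \<le> ennreal ((2^m)\<^sup>2 * F m x)" by (intro ennreal_leI) (simp add: mult_ac)
    then show "ennreal c * ennreal ((2^m)\<^sup>2 * D x) \<le> ennreal ((2^m)\<^sup>2 * F m x)"
      using c D0 by (subst ennreal_mult[symmetric]) auto
  qed
  also have "\<dots> \<le> B" by (rule F)
  finally show "ennreal c * (dq f n + dq f' n) \<le> B" .
qed

definition angle :: "(real \<Rightarrow> real) \<Rightarrow> real \<Rightarrow> real" where "angle u x = 2 * arcsin (half_sin u x)"

lemma angle_props:
  assumes "profile u"
  shows "0 \<le> angle u x" "angle u x \<le> pi" "sin (angle u x / 2) = half_sin u x" "cos (angle u x / 2) = half_cos u x"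
    "cos (angle u x) = 1 - u x" "u x = 2 \<Longrightarrow> angle u x = pi" "u x = 0 \<Longrightarrow> angle u x = 0" "continuous_on UNIV (angle u)"
proof -
  have ub: "0 \<le> u y \<and> u y \<le> 2" for y using assms by (simp add: profile_def)
  have s: "0 \<le> half_sin u y" "half_sin u y \<le> 1" for y using ub[of y] by (auto simp: half_sin_def)
  show "0 \<le> angle u x" using arcsin_le_arcsin[of 0 "half_sin u x"] s[of x] by (simp add: angle_def)
  show "angle u x \<le> pi" using arcsin_ubound[of "half_sin u x"] s[of x] by (simp add: angle_def)
  show 1: "sin (angle u x / 2) = half_sin u x" using s[of x] by (simp add: angle_def)
  show "cos (angle u x / 2) = half_cos u x"
    using s[of x] ub[of x] by (simp add: angle_def cos_arcsin) (simp add: half_cos_def half_sin_def)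
  show "cos (angle u x) = 1 - u x"
    using cos_double_sin[of "angle u x / 2"] 1 ub[of x] by (simp add: half_sin_def)
  show "u x = 2 \<Longrightarrow> angle u x = pi" "u x = 0 \<Longrightarrow> angle u x = 0" by (simp_all add: angle_def half_sin_def)
  show "continuous_on UNIV (angle u)"
    unfolding angle_def[abs_def] using half_continuous[OF assms] s
    by (intro continuous_intros) (auto intro: order_trans[of _ 0])
qed

text \<open>With \<open>t\<close> a quarter of the difference of the angles, \<open>\<kappa>\<close>
  equals \<open>4 * (sin t)^2\<close>, and the claim is the square of
  \<open>t * cos t \<le> sin t\<close> for \<open>|t|\<close>. The factor in front is
  \<open>(cos t)^2\<close>, which tends to 1 for small increments.\<close>

lemma angle_increment:
  assumes u: "profile u"
  defines "\<kappa> \<equiv> \<lambda>x y. (half_cos u x - half_cos u y)\<^sup>2 + (half_sin u x - half_sin u y)\<^sup>2"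
  shows "(1 - \<kappa> x y / 4) * (angle u x - angle u y)\<^sup>2 \<le> 4 * \<kappa> x y"
proof -
  define a where "a = angle u x / 2" define b where "b = angle u y / 2"
  define t where "t = (a - b) / 2"
  have "\<kappa> x y = (cos a - cos b)\<^sup>2 + (sin a - sin b)\<^sup>2"
    unfolding \<kappa>_def a_def b_def angle_props(3,4)[OF u] ..
  also have "\<dots> = 2 - 2 * cos (a - b)" by (simp add: cos_diff power2_diff sin_squared_eq algebra_simps)
  also have "a - b = 2 * t" by (simp add: t_def)
  also have "2 - 2 * cos (2 * t) = 4 * (sin t)\<^sup>2" by (simp add: cos_double_sin)
  finally have k: "\<kappa> x y = 4 * (sin t)\<^sup>2" .
  have t: "\<bar>t\<bar> \<le> pi / 2" using angle_props(1,2)[OF u, of x] angle_props(1,2)[OF u, of y] pi_gt_zero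
    by (simp add: t_def a_def b_def abs_le_iff)
  have "\<bar>t\<bar> * cos \<bar>t\<bar> \<le> sin \<bar>t\<bar>" using t by (intro x_cos_le_sin) auto
  moreover have "0 \<le> cos \<bar>t\<bar>" using t by (intro cos_ge_zero) auto
  ultimately have "(\<bar>t\<bar> * cos \<bar>t\<bar>)\<^sup>2 \<le> (sin \<bar>t\<bar>)\<^sup>2" by (intro power_mono) auto
  then have "t\<^sup>2 * (cos t)\<^sup>2 \<le> (sin t)\<^sup>2" by (simp add: power_mult_distrib abs_if split: if_splits)
  then have "(1 - (sin t)\<^sup>2) * (16 * t\<^sup>2) \<le> 16 * (sin t)\<^sup>2" by (simp add: cos_squared_eq mult.commute)
  moreover have "(angle u x - angle u y)\<^sup>2 = 16 * t\<^sup>2" by (simp add: t_def a_def b_def power2_eq_square algebra_simps)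
  ultimately show ?thesis by (simp add: k)
qed

lemma half_hoelder:
  assumes u: "profile u" and E: "profile_energy u \<le> ennreal E" "0 \<le> E"
  shows "(half_cos u x - half_cos u y)\<^sup>2 + (half_sin u x - half_sin u y)\<^sup>2 \<le> E / 2 * \<bar>x - y\<bar>"
proof -
  have "dq (half_cos u) n \<le> ennreal (E / 4)" "dq (half_sin u) n \<le> ennreal (E / 4)" for n
    using dq_half_le[OF E, of n] by (auto intro: order_trans[rotated])
  then have "(half_cos u x - half_cos u y)\<^sup>2 \<le> E / 4 * \<bar>x - y\<bar>" "(half_sin u x - half_sin u y)\<^sup>2 \<le> E / 4 * \<bar>x - y\<bar>"
    using E(2) by (intro hoelder_of_dq half_continuous u; simp)+
  then show ?thesis by simp
qed

text \<open>\<open>half_hoelder\<close> bounds the correction \<open>\<kappa> / 4\<close> of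
  \<open>angle_increment\<close> by \<open>(E / 8) / 2^n\<close>, the form asked for by
  \<open>dq_le_asymptotic\<close>, whose second function is taken to be zero.\<close>

lemma dq_angle:
  assumes u: "profile u" and E: "profile_energy u \<le> ennreal E" "0 \<le> E"
  shows "dq (angle u) n \<le> 4 * half_angle_energy u"
proof -
  have "dq (angle u) n + dq (\<lambda>_. 0) n \<le> 4 * half_angle_energy u"
  proof (rule dq_le_asymptotic[where C = "E / 8" and F = "\<lambda>n x. 4 * ((half_cos u (x + 1/2^n) - half_cos u x)\<^sup>2 + (half_sin u (x + 1/2^n) - half_sin u x)\<^sup>2)"])
  have [measurable]: "u \<in> borel_measurable borel" using u by (rule profile_measurable)
  show "angle u \<in> borel_measurable borel" using angle_props(8)[OF u] by (rule borel_measurable_continuous_onI)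
  show "0 \<le> E / 8" using E by simp
  show "(\<lambda>x. 4 * ((half_cos u (x + 1/2^n) - half_cos u x)\<^sup>2 + (half_sin u (x + 1/2^n) - half_sin u x)\<^sup>2)) \<in> borel_measurable borel" for n
    by measurable
  fix n x
  define k where "k = (half_cos u (x + 1/2^n) - half_cos u x)\<^sup>2 + (half_sin u (x + 1/2^n) - half_sin u x)\<^sup>2"
  have "k \<le> E / 2 * \<bar>x + 1/2^n - x\<bar>" unfolding k_def by (rule half_hoelder[OF u E])
  then have "E / 8 / 2^n \<ge> k / 4" by simp
  then have "(1 - E / 8 / 2^n) * (angle u (x + 1/2^n) - angle u x)\<^sup>2 \<le> (1 - k / 4) * (angle u (x + 1/2^n) - angle u x)\<^sup>2"
    by (intro mult_right_mono) auto
  also have "\<dots> \<le> 4 * k" unfolding k_def by (rule angle_increment[OF u])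
  finally show "(1 - E / 8 / 2^n) * ((angle u (x + 1/2^n) - angle u x)\<^sup>2 + (0 - 0)\<^sup>2) \<le> 4 * k" by simp
next
  have [measurable]: "u \<in> borel_measurable borel" using u by (rule profile_measurable)
  fix n
  have "(\<integral>\<^sup>+x. ennreal ((2^n)\<^sup>2 * (4 * ((half_cos u (x + 1/2^n) - half_cos u x)\<^sup>2 + (half_sin u (x + 1/2^n) - half_sin u x)\<^sup>2))) \<partial>lborel)
    = (\<integral>\<^sup>+x. 4 * ennreal ((2^n)\<^sup>2 * ((half_cos u (x + 1/2^n) - half_cos u x)\<^sup>2 + (half_sin u (x + 1/2^n) - half_sin u x)\<^sup>2)) \<partial>lborel)"
  proof (intro nn_integral_cong)
    have *: "ennreal (a * (4 * b)) = 4 * ennreal (a * b)" if "0 \<le> a" "0 \<le> b" for a b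
      using that by (simp add: ennreal_mult mult.left_commute)
    show "ennreal ((2^n)\<^sup>2 * (4 * ((half_cos u (x + 1/2^n) - half_cos u x)\<^sup>2 + (half_sin u (x + 1/2^n) - half_sin u x)\<^sup>2)))
      = 4 * ennreal ((2^n)\<^sup>2 * ((half_cos u (x + 1/2^n) - half_cos u x)\<^sup>2 + (half_sin u (x + 1/2^n) - half_sin u x)\<^sup>2))" for x
      by (rule *) auto
  qed
  also have "\<dots> = 4 * (dq (half_cos u) n + dq (half_sin u) n)"
    by (subst dq_half_sum) (auto intro!: nn_integral_cmult)
  also have "\<dots> \<le> 4 * half_angle_energy u" unfolding half_angle_energy_def by (intro mult_left_mono SUP_upper) auto
  finally show "(\<integral>\<^sup>+x. ennreal ((2^n)\<^sup>2 * (4 * ((half_cos u (x + 1/2^n) - half_cos u x)\<^sup>2 + (half_sin u (x + 1/2^n) - half_sin u x)\<^sup>2))) \<partial>lborel) \<le> 4 * half_angle_energy u" .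
qed simp
  then show ?thesis by (rule order_trans[rotated]) simp
qed

section \<open>Unfolding the angle to a lifting of prescribed degree\<close>

lemma set_integral_split:
  fixes g :: "real \<Rightarrow> real"
  assumes "set_integrable lborel {a..b} g" "a \<le> c" "c \<le> b"
  shows "(LINT x:{a..b}|lborel. g x) = (LINT x:{a..c}|lborel. g x) + (LINT x:{c..b}|lborel. g x)"
proof -
  have "{a..b} = {a..c} \<union> {c..b}" using assms by auto
  moreover have "(LINT x:{a..c} \<union> {c..b}|lborel. g x) = (LINT x:{a..c}|lborel. g x) + (LINT x:{c..b}|lborel. g x)"
  proof (rule set_integral_Un_AE)
    show "AE x in lborel. \<not> (x \<in> {a..c} \<and> x \<in> {c..b})"
      by (rule AE_mp[OF AE_lborel_singleton[of c]], rule AE_I2) auto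
  qed (use assms in \<open>auto intro: set_integrable_subset\<close>)
  ultimately show ?thesis by simp
qed

text \<open>Unfolding: beyond a point where \<open>\<phi>\<close> is a multiple of \<open>\<pi>\<close>, the lifting can be reflected
  without changing \<open>cos \<phi>\<close>, at no cost of energy.\<close>

lemma reflect_primitive:
  assumes \<phi>: "continuous_on UNIV \<phi>" "l2_primitive \<phi> g" and c: "\<phi> c = of_int n * pi"
  defines "\<psi> \<equiv> \<lambda>x. if x \<le> c then \<phi> x else 2 * of_int n * pi - \<phi> x"
  defines "h \<equiv> \<lambda>x. if x \<le> c then g x else - g x"
  shows "continuous_on UNIV \<psi>" "l2_primitive \<psi> h" "cos (\<psi> x) = cos (\<phi> x)" "(h x)\<^sup>2 = (g x)\<^sup>2"
proof -
  have [measurable]: "g \<in> borel_measurable borel" and g2: "integrable lborel (\<lambda>x. (g x)\<^sup>2)"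
    and fg: "\<And>a b. a \<le> b \<Longrightarrow> \<phi> b - \<phi> a = (LINT x:{a..b}|lborel. g x)"
    using \<phi>(2) by (auto simp: l2_primitive_def)
  have "continuous_on ({..c} \<union> {c..}) \<psi>" unfolding \<psi>_def
    using c by (intro continuous_on_If continuous_intros continuous_on_subset[OF \<phi>(1)]) auto
  moreover have "{..c} \<union> {c..} = (UNIV :: real set)" by auto
  ultimately show "continuous_on UNIV \<psi>" by simp
  have "cos (2 * of_int n * pi - y) = cos y" for y
    using cos_int_2pin[of n] sin_int_2pin[of n] by (simp add: cos_diff mult_ac)
  then show "cos (\<psi> x) = cos (\<phi> x)" by (simp add: \<psi>_def)
  show h2: "(h x)\<^sup>2 = (g x)\<^sup>2" for x by (simp add: h_def)
  have hm[measurable]: "h \<in> borel_measurable borel" unfolding h_def by measurable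
  have hi: "integrable lborel (\<lambda>x. (h x)\<^sup>2)" unfolding h2 by (rule g2)
  have hint: "set_integrable lborel {a..b} h" if "a \<le> b" for a b
    by (rule set_integral_square_le(1)[OF _ hi that]) measurable
  have left: "\<psi> b - \<psi> a = (LINT x:{a..b}|lborel. h x)" if "a \<le> b" "b \<le> c" for a b
  proof -
    have "(LINT x:{a..b}|lborel. h x) = (LINT x:{a..b}|lborel. g x)"
      using that by (intro set_lebesgue_integral_cong) (auto simp: h_def)
    then show ?thesis using fg[OF that(1)] that by (simp add: \<psi>_def)
  qed
  have right: "\<psi> b - \<psi> a = (LINT x:{a..b}|lborel. h x)" if "a \<le> b" "c \<le> a" for a b
  proof -
    have "\<psi> x = 2 * of_int n * pi - \<phi> x" if "c \<le> x" for x using that c by (cases "x = c") (auto simp: \<psi>_def)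
    then have "\<psi> b - \<psi> a = - (\<phi> b - \<phi> a)" using that by simp
    also have "\<dots> = (LINT x:{a..b}|lborel. - g x)" unfolding fg[OF that(1)] by (simp add: set_lebesgue_integral_def)
    also have "\<dots> = (LINT x:{a..b}|lborel. h x)"
      unfolding set_lebesgue_integral_def
    proof (rule integral_cong_AE)
      show "AE x in lborel. indicator {a..b} x *\<^sub>R (- g x) = indicator {a..b} x *\<^sub>R h x"
        by (rule AE_mp[OF AE_lborel_singleton[of c]], rule AE_I2) (use that in \<open>auto simp: h_def indicator_def\<close>)
    qed measurable
    finally show ?thesis .
  qed
  have "\<psi> b - \<psi> a = (LINT x:{a..b}|lborel. h x)" if ab: "a \<le> b" for a b
  proof -
    consider "b \<le> c" | "c \<le> a" | "a \<le> c" "c \<le> b" by linarith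
    then show ?thesis
    proof cases
      case 3
      then show ?thesis using left[of a c] right[of c b] set_integral_split[OF hint[OF ab] 3] by simp
    qed (use left right ab in auto)
  qed
  then show "l2_primitive \<psi> h" using hi by (simp add: l2_primitive_def)
qed

text \<open>At \<open>z j\<close> the lifting sits at height \<open>(j + 1) * pi\<close>, where it
  can be reflected, and the reflected branch reaches the next multiple of \<open>pi\<close> at
  \<open>z (Suc j)\<close>. For \<open>j = 2 * k\<close> the last branch is
  \<open>(2 * k + 2) * pi\<close> minus the angle, which gives degree \<open>k + 1\<close> once the
  angle decays.\<close>

lemma unfold_angle:
  assumes u: "profile u" and z: "alternates u N z" and g: "l2_primitive (angle u) g" and j: "j \<le> N"
  shows "\<exists>\<phi> h. continuous_on UNIV \<phi> \<and> l2_primitive \<phi> h \<and> (\<forall>x. cos (\<phi> x) = 1 - u x) \<and> (\<forall>x. (h x)\<^sup>2 = (g x)\<^sup>2)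
    \<and> (\<forall>x\<le>z 0. \<phi> x = angle u x)
    \<and> (\<forall>x\<ge>z j. \<phi> x = (if even j then real (j + 2) * pi - angle u x else real (j + 1) * pi + angle u x))"
  using j
proof (induction j)
  case 0
  have a0: "angle u (z 0) = of_int 1 * pi" using z angle_props(6)[OF u] by (simp add: alternates_def)
  note r = reflect_primitive[OF angle_props(8)[OF u] g a0]
  show ?case
  proof (rule exI, rule exI, intro conjI allI impI, rule r(1), rule r(2))
    show "(if x \<le> z 0 then g x else - g x)\<^sup>2 = (g x)\<^sup>2" for x by simp
    show "cos (if x \<le> z 0 then angle u x else 2 * of_int 1 * pi - angle u x) = 1 - u x" for x
      using r(3)[of x] angle_props(5)[OF u] by simp
  qed (use a0 in auto)
next
  case (Suc j)
  then obtain \<phi> h where \<phi>: "continuous_on UNIV \<phi>" "l2_primitive \<phi> h" "\<And>x. cos (\<phi> x) = 1 - u x" "\<And>x. (h x)\<^sup>2 = (g x)\<^sup>2"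
    "\<And>x. x \<le> z 0 \<Longrightarrow> \<phi> x = angle u x"
    "\<And>x. z j \<le> x \<Longrightarrow> \<phi> x = (if even j then real (j + 2) * pi - angle u x else real (j + 1) * pi + angle u x)"
    by auto
  have zj: "z j \<le> z (Suc j)" "z 0 \<le> z (Suc j)" using alternates_mono[OF z] Suc.prems by auto
  have "angle u (z (Suc j)) = (if even j then 0 else pi)"
    using z Suc.prems angle_props(6,7)[OF u] by (auto simp: alternates_def)
  \<comment> \<open>Both parities lead to the height \<open>(j + 2) * pi\<close>: for even
    \<open>j\<close> the angle is 0 here, for odd \<open>j\<close> it contributes a further
    \<open>pi\<close>.\<close>
  then have c: "\<phi> (z (Suc j)) = of_int (int (j + 2)) * pi"
    using \<phi>(6)[OF zj(1)] by (auto simp: algebra_simps)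
  note r = reflect_primitive[OF \<phi>(1,2) c]
  show ?case
  proof (rule exI, rule exI, intro conjI allI impI, rule r(1), rule r(2))
    show "(if x \<le> z (Suc j) then h x else - h x)\<^sup>2 = (g x)\<^sup>2" for x using \<phi>(4) by simp
    show "cos (if x \<le> z (Suc j) then \<phi> x else 2 * of_int (int (j + 2)) * pi - \<phi> x) = 1 - u x" for x
      using r(3)[of x] \<phi>(3) by simp
    show "(if x \<le> z (Suc j) then \<phi> x else 2 * of_int (int (j + 2)) * pi - \<phi> x) = angle u x" if "x \<le> z 0" for x
      using that \<phi>(5) zj by simp
    fix x assume x: "z (Suc j) \<le> x"
    then have "\<phi> x = (if even j then real (j + 2) * pi - angle u x else real (j + 1) * pi + angle u x)"
      using zj by (intro \<phi>(6)) simp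
    moreover have "(if x \<le> z (Suc j) then \<phi> x else 2 * of_int (int (j + 2)) * pi - \<phi> x) = 2 * of_int (int (j + 2)) * pi - \<phi> x"
      using x c by (cases "x = z (Suc j)") auto
    ultimately show "(if x \<le> z (Suc j) then \<phi> x else 2 * of_int (int (j + 2)) * pi - \<phi> x)
       = (if even (Suc j) then real (Suc j + 2) * pi - angle u x else real (Suc j + 1) * pi + angle u x)"
      by (auto simp: algebra_simps)
  qed
qed

text \<open>If \<open>|f y| \<ge> e\<close>, then \<open>|f| \<ge> e / 2\<close> on an interval of
  fixed length \<open>d\<close> to the right of \<open>y\<close>, which contributes at least
  \<open>d * (e / 2)^2\<close> to the integral of \<open>f^2\<close>. In the tail of a convergent
  integral this is impossible.\<close>

lemma hoelder_L2_tendsto_0: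
  fixes f :: "real \<Rightarrow> real"
  assumes [measurable]: "f \<in> borel_measurable borel"
    and H: "\<And>x y. \<bar>f x - f y\<bar> \<le> sqrt (C * \<bar>x - y\<bar>)" and i: "integrable lborel (\<lambda>x. (f x)\<^sup>2)"
  shows "(f \<longlongrightarrow> 0) at_top"
proof (rule tendstoI)
  fix e :: real assume e: "e > 0"
  have "((\<lambda>d. sqrt (C * d)) \<longlongrightarrow> sqrt (C * 0)) (at_right 0)" by (intro tendsto_intros)
  then have "\<forall>\<^sub>F d in at_right 0. sqrt (C * d) < e / 2" using e by (intro order_tendstoD(2)) auto
  then obtain d0 where d0: "d0 > 0" "\<And>y. 0 < y \<Longrightarrow> y < d0 \<Longrightarrow> sqrt (C * y) < e / 2"
    unfolding eventually_at_right_field by auto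
  define d where "d = d0 / 2"
  have d: "d > 0" and d2: "\<And>y. 0 < y \<Longrightarrow> y \<le> d \<Longrightarrow> sqrt (C * y) < e / 2" using d0 by (auto simp: d_def)
  define I where "I y = (LINT x|lborel. indicator {..y} x *\<^sub>R (f x)\<^sup>2)" for y
  have I: "(I \<longlongrightarrow> (LINT x|lborel. (f x)\<^sup>2)) at_top" unfolding I_def by (rule tendsto_integral_at_top[OF _ i]) simp
  have "filterlim (\<lambda>y. y + d) at_top at_top" by (rule filterlim_tendsto_add_at_top[OF tendsto_const filterlim_ident, of d, simplified add.commute])
  then have "((\<lambda>y. I (y + d)) \<longlongrightarrow> (LINT x|lborel. (f x)\<^sup>2)) at_top" by (rule filterlim_compose[OF I])
  then have "((\<lambda>y. I (y + d) - I y) \<longlongrightarrow> (LINT x|lborel. (f x)\<^sup>2) - (LINT x|lborel. (f x)\<^sup>2)) at_top" by (intro tendsto_diff I)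
  then have "((\<lambda>y. I (y + d) - I y) \<longlongrightarrow> 0) at_top" by simp
  then have "\<forall>\<^sub>F y in at_top. I (y + d) - I y < d * (e / 2)\<^sup>2" using d e by (intro order_tendstoD(2)) auto
  then show "\<forall>\<^sub>F y in at_top. dist (f y) 0 < e"
  proof eventually_elim
    case (elim y)
    show ?case
    proof (rule ccontr)
      assume "\<not> ?case"
      then have fy: "\<bar>f y\<bar> \<ge> e" by simp
      have ii: "integrable lborel (\<lambda>x. indicator {..a} x *\<^sub>R (f x)\<^sup>2)" for a by (rule integrable_mult_indicator[OF _ i]) simp
      have "d * (e / 2)\<^sup>2 = (LINT x|lborel. indicator {y<..y+d} x *\<^sub>R (e / 2)\<^sup>2)" using d by simp
      also have "\<dots> \<le> (LINT x|lborel. indicator {..y+d} x *\<^sub>R (f x)\<^sup>2 - indicator {..y} x *\<^sub>R (f x)\<^sup>2)"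
      proof (rule integral_mono)
        show "integrable lborel (\<lambda>x. indicator {y<..y+d} x *\<^sub>R (e / 2)\<^sup>2)" using d by simp
        show "integrable lborel (\<lambda>x. indicator {..y+d} x *\<^sub>R (f x)\<^sup>2 - indicator {..y} x *\<^sub>R (f x)\<^sup>2)" using ii by auto
        fix x
        show "indicator {y<..y+d} x *\<^sub>R (e / 2)\<^sup>2 \<le> indicator {..y+d} x *\<^sub>R (f x)\<^sup>2 - indicator {..y} x *\<^sub>R (f x)\<^sup>2"
        proof (cases "x \<in> {y<..y+d}")
          case True
          have "\<bar>f y - f x\<bar> < e / 2" using H[of y x] d2[of "\<bar>y - x\<bar>"] True by auto
          then have "\<bar>e / 2\<bar> \<le> \<bar>f x\<bar>" using fy e by linarith
          then have "(e / 2)\<^sup>2 \<le> (f x)\<^sup>2" by (rule abs_le_square_iff[THEN iffD1])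
          then show ?thesis using True by simp
        next
          case False then show ?thesis using d by (auto simp: indicator_def)
        qed
      qed
      also have "\<dots> = I (y + d) - I y" unfolding I_def using ii by (intro Bochner_Integration.integral_diff) auto
      finally show False using elim by simp
    qed
  qed
qed

lemma profile_tendsto_0:
  assumes u: "profile u" and fin: "profile_energy u < \<infinity>"
  shows "(u \<longlongrightarrow> 0) at_top" "(u \<longlongrightarrow> 0) at_bot"
proof -
  have [measurable]: "u \<in> borel_measurable borel" using u by (rule profile_measurable)
  obtain E where E: "profile_energy u \<le> ennreal E" "0 \<le> E" using fin by (cases "profile_energy u") auto
  have "L2_norm_sq u < \<infinity>" using fin by (simp add: profile_energy_def)
  then have i: "integrable lborel (\<lambda>x. (u x)\<^sup>2)"
    unfolding L2_norm_sq_def by (intro integrableI_nonneg) auto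
  have H: "\<bar>u x - u y\<bar> \<le> sqrt (4 * E * \<bar>x - y\<bar>)" for x y
    using real_sqrt_le_mono[OF profile_hoelder[OF u E, of x y]] by simp
  show "(u \<longlongrightarrow> 0) at_top" by (rule hoelder_L2_tendsto_0[OF _ H i]) measurable
  have "((\<lambda>x. u (- x)) \<longlongrightarrow> 0) at_top"
  proof (rule hoelder_L2_tendsto_0[where C = "4 * E"])
    show "\<bar>u (- x) - u (- y)\<bar> \<le> sqrt (4 * E * \<bar>x - y\<bar>)" for x y
      using H[of "- x" "- y"] by (simp add: abs_minus_commute)
    show "integrable lborel (\<lambda>x. (u (- x))\<^sup>2)" using lborel_integrable_real_affine[OF i, of "- 1" 0] by simp
  qed measurable
  then show "(u \<longlongrightarrow> 0) at_bot" by (simp add: filterlim_at_bot_mirror)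
qed

lemma angle_tendsto_0:
  assumes "profile u" "(u \<longlongrightarrow> 0) F"
  shows "(angle u \<longlongrightarrow> 0) F"
proof -
  have "isCont arcsin (sqrt (0 / 2))" by (rule isCont_arcsin) auto
  moreover have "((\<lambda>x. sqrt (u x / 2)) \<longlongrightarrow> sqrt (0 / 2)) F" by (intro tendsto_intros assms) auto
  ultimately have "((\<lambda>x. arcsin (sqrt (u x / 2))) \<longlongrightarrow> arcsin (sqrt (0 / 2))) F" by (rule isCont_tendsto_compose)
  then have "((\<lambda>x. 2 * arcsin (sqrt (u x / 2))) \<longlongrightarrow> 2 * arcsin (sqrt (0 / 2))) F" by (intro tendsto_intros)
  then show ?thesis by (simp add: angle_def[abs_def] half_sin_def)
qed

text \<open>Two liftings of one map differ by \<open>2 * pi\<close> times a continuous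
  integer-valued function, hence by a constant. The lifting picked by \<open>SOME\<close> can
  therefore be exchanged for any convenient one.\<close>

lemma winding_deg_eq:
  assumes l: "is_lifting m \<phi>" and P: "(\<phi> \<longlongrightarrow> P) at_top" and Q: "(\<phi> \<longlongrightarrow> Q) at_bot"
  shows "winding_deg m = (P - Q) / (2 * pi)"
proof -
  define \<psi> where "\<psi> = (SOME \<phi>. is_lifting m \<phi>)"
  have \<psi>: "is_lifting m \<psi>" unfolding \<psi>_def by (rule someI[of "is_lifting m", OF l])
  have "sin (\<psi> x) = sin (\<phi> x) \<and> cos (\<psi> x) = cos (\<phi> x)" for x
  proof -
    have "vector [cos (\<psi> x), sin (\<psi> x)] = (vector [cos (\<phi> x), sin (\<phi> x)] :: real^2)"
      using l \<psi> by (metis is_lifting_def)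
    then show ?thesis by (metis vector_2)
  qed
  then have "\<exists>n::int. \<psi> x = \<phi> x + 2 * pi * n" for x using sin_cos_eq_iff[of "\<psi> x" "\<phi> x"] by simp
  then obtain n :: "real \<Rightarrow> int" where n: "\<And>x. \<psi> x = \<phi> x + 2 * pi * n x" by metis
  define f where "f x = (\<psi> x - \<phi> x) / (2 * pi)" for x
  have fn: "f x = of_int (n x)" for x by (simp add: f_def n)
  have "f constant_on UNIV"
  proof (rule continuous_discrete_range_constant)
    show "continuous_on UNIV f" unfolding f_def using l \<psi> by (auto simp: is_lifting_def intro!: continuous_intros)
    show "\<exists>e>0. \<forall>y. y \<in> UNIV \<and> f y \<noteq> f x \<longrightarrow> e \<le> norm (f y - f x)" for x
    proof (intro exI[of _ 1] conjI allI impI)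
      fix y assume "y \<in> UNIV \<and> f y \<noteq> f x"
      then have "1 \<le> \<bar>n y - n x\<bar>" by (simp add: fn)
      then have "1 \<le> \<bar>real_of_int (n y - n x)\<bar>" by linarith
      then show "1 \<le> norm (f y - f x)" by (simp add: fn)
    qed simp
  qed auto
  then obtain c where c: "\<And>x. f x = c" by (auto simp: constant_on_def)
  then have \<psi>c: "\<psi> x = \<phi> x + 2 * pi * c" for x using c[of x] by (simp add: f_def field_simps)
  have "((\<lambda>x. \<phi> x - \<phi> (- x)) \<longlongrightarrow> P - Q) at_top"
    using Q by (intro tendsto_diff P) (simp add: filterlim_at_bot_mirror)
  then have "Lim at_top (\<lambda>x. \<psi> x - \<psi> (- x)) = P - Q" unfolding \<psi>c by (intro tendsto_Lim) auto
  then show ?thesis by (simp add: winding_deg_def Let_def \<psi>_def[symmetric])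
qed

section \<open>The circle-valued map carried by an unfolded profile\<close>

lemma vector2_eq: "(vector [a, b] :: real^2) = a *\<^sub>R axis 1 1 + b *\<^sub>R axis 2 1"
  by (simp add: vec_eq_iff forall_2 axis_def)

lemma norm_sq_real2: "(norm (v :: real^2))\<^sup>2 = (v $ 1)\<^sup>2 + (v $ 2)\<^sup>2"
  by (simp add: power2_norm_eq_inner inner_vec_def sum_2) (simp add: power2_eq_square)

text \<open>Suprema of increasing sequences add up, so the bound on the sum splits into separate
  bounds with \<open>S1 + S2 \<le> S\<close>. Bounding each component by \<open>S\<close> would lose
  a factor 2 in the energy.\<close>

lemma dq_finite_sup:
  assumes "\<And>n. dq f n + dq f' n \<le> ennreal S" "f \<in> borel_measurable borel" "f' \<in> borel_measurable borel" "0 \<le> S"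
  obtains S1 S2 where "0 \<le> S1" "0 \<le> S2" "S1 + S2 \<le> S" "\<And>n. dq f n \<le> ennreal S1" "\<And>n. dq f' n \<le> ennreal S2"
proof -
  have "(SUP n. dq f n) + (SUP n. dq f' n) = (SUP n. dq f n + dq f' n)"
    by (rule ennreal_SUP_add[symmetric]) (use assms incseq_dq in auto)
  also have "\<dots> \<le> ennreal S" using assms(1) by (intro SUP_least)
  finally have sum: "(SUP n. dq f n) + (SUP n. dq f' n) \<le> ennreal S" .
  obtain S1 where S1: "(SUP n. dq f n) = ennreal S1" "0 \<le> S1"
    using sum by (cases "SUP n. dq f n") (auto simp: top_unique)
  obtain S2 where S2: "(SUP n. dq f' n) = ennreal S2" "0 \<le> S2"
    using sum by (cases "SUP n. dq f' n") (auto simp: top_unique)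
  show ?thesis
  proof (rule that[of S1 S2])
    show "S1 + S2 \<le> S" using sum S1 S2 assms(4) by (simp add: ennreal_plus[symmetric] del: ennreal_plus)
    show "dq f n \<le> ennreal S1" for n unfolding S1(1)[symmetric] by (rule SUP_upper) simp
    show "dq f' n \<le> ennreal S2" for n unfolding S2(1)[symmetric] by (rule SUP_upper) simp
  qed (use S1 S2 in auto)
qed

lemma set_integrable_compact_of_square:
  fixes g :: "real \<Rightarrow> real"
  assumes [measurable]: "g \<in> borel_measurable lborel" and g2: "integrable lborel (\<lambda>x. (g x)\<^sup>2)" and K: "compact K"
  shows "set_integrable lborel K g"
proof -
  obtain a where a: "K \<subseteq> {- a..a}"
    using compact_imp_bounded[OF K] unfolding bounded_pos by (force simp: abs_le_iff)
  have "set_integrable lborel {- \<bar>a\<bar>..\<bar>a\<bar>} g" by (rule set_integral_square_le(1)[OF _ g2]) auto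
  then show ?thesis
    by (rule set_integrable_subset) (use a K in \<open>auto intro: borel_compact\<close>)
qed

text \<open>The component derivatives assemble to a weak derivative \<open>G\<close>. The version
  chosen in \<open>weak_deriv\<close> has the same interval integrals, so it agrees with
  \<open>G\<close> almost everywhere and has the same norm.\<close>

lemma sobolev_map_of_primitives:
  fixes m :: "real \<Rightarrow> real^2"
  assumes m: "continuous_on UNIV m" "\<And>x. norm (m x) = 1"
    and g1: "l2_primitive (\<lambda>x. m x $ 1) g1" and g2: "l2_primitive (\<lambda>x. m x $ 2) g2"
  shows "m \<in> H1_loc_circle"
    and "L2_norm_sq (weak_deriv m) = ennreal ((LINT x|lborel. (g1 x)\<^sup>2) + (LINT x|lborel. (g2 x)\<^sup>2))"
proof -
  have [measurable]: "g1 \<in> borel_measurable borel" "g2 \<in> borel_measurable borel"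
    and i: "integrable lborel (\<lambda>x. (g1 x)\<^sup>2)" "integrable lborel (\<lambda>x. (g2 x)\<^sup>2)"
    and ftc: "\<And>a b. a \<le> b \<Longrightarrow> m b $ 1 - m a $ 1 = (LINT x:{a..b}|lborel. g1 x)"
     "\<And>a b. a \<le> b \<Longrightarrow> m b $ 2 - m a $ 2 = (LINT x:{a..b}|lborel. g2 x)"
    using g1 g2 by (auto simp: l2_primitive_def)
  define G where "G x = (vector [g1 x, g2 x] :: real^2)" for x
  have Gm[measurable]: "G \<in> borel_measurable borel" unfolding G_def vector2_eq by measurable
  have Gn: "(norm (G x))\<^sup>2 = (g1 x)\<^sup>2 + (g2 x)\<^sup>2" for x by (simp add: norm_sq_real2 G_def)
  have si: "set_integrable lborel K g1" "set_integrable lborel K g2" if "compact K" for K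
    using that i by (auto intro!: set_integrable_compact_of_square)
  have GK: "(\<lambda>x. indicator K x *\<^sub>R G x) = (\<lambda>x. (indicator K x *\<^sub>R g1 x) *\<^sub>R axis 1 1 + (indicator K x *\<^sub>R g2 x) *\<^sub>R axis 2 1)" for K
    by (auto simp: G_def vector2_eq scaleR_add_right)
  have GL1: "G \<in> L1_loc"
  proof -
    have "set_integrable lborel K G" if "compact K" for K
      unfolding set_integrable_def GK using si[OF that] unfolding set_integrable_def
      by (intro Bochner_Integration.integrable_add integrable_scaleR_left)
    then show ?thesis by (simp add: L1_loc_def)
  qed
  have GL2: "G \<in> L2_loc"
  proof -
    have "integrable lborel (\<lambda>x. (norm (G x))\<^sup>2)" unfolding Gn by (intro Bochner_Integration.integrable_add i)
    then have "set_integrable lborel K (\<lambda>x. (norm (G x))\<^sup>2)" if "compact K" for K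
      unfolding set_integrable_def by (rule integrable_mult_indicator[rotated]) (use that in \<open>simp add: borel_compact\<close>)
    then show ?thesis by (simp add: L2_loc_def)
  qed
  have rep: "m b - m a = (LINT x:{a..b}|lborel. G x)" if "a \<le> b" for a b
  proof -
    have "(LINT x:{a..b}|lborel. G x) = (LINT x:{a..b}|lborel. g1 x) *\<^sub>R axis 1 1 + (LINT x:{a..b}|lborel. g2 x) *\<^sub>R axis 2 1"
      unfolding set_lebesgue_integral_def GK
      using si[of "{a..b}"] unfolding set_integrable_def
      by (subst Bochner_Integration.integral_add) (auto simp del: real_scaleR_def)
    also have "\<dots> = m b - m a" unfolding ftc[OF that, symmetric] by (simp add: vec_eq_iff forall_2 axis_def)
    finally show ?thesis by simp
  qed
  have w: "has_weak_deriv m G" by (rule has_weak_deriv_of_primitive[OF m(1) GL1 rep])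
  have "m \<in> L2_loc"
    unfolding L2_loc_def using m
    by (auto intro!: borel_measurable_continuous_onI borel_integrable_compact simp: set_integrable_def simp del: real_scaleR_def)
  then show "m \<in> H1_loc_circle" using m w GL2 by (auto simp: H1_loc_circle_def H1_loc_def)
  have w': "has_weak_deriv m (weak_deriv m)" unfolding weak_deriv_def by (rule someI[of "has_weak_deriv m", OF w])
  then have "weak_deriv m \<in> L1_loc" by (simp add: has_weak_deriv_def)
  then have "AE x in lborel. weak_deriv m x = G x"
    by (rule AE_eq_of_interval_integrals[OF _ GL1]) (use weak_deriv_ftc[OF m(1) w'] rep in \<open>metis\<close>)
  then have "L2_norm_sq (weak_deriv m) = L2_norm_sq G"
    unfolding L2_norm_sq_def by (intro nn_integral_cong_AE) auto
  also have "\<dots> = ennreal (LINT x|lborel. (g1 x)\<^sup>2 + (g2 x)\<^sup>2)"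
    unfolding L2_norm_sq_def Gn using i by (intro nn_integral_eq_integral Bochner_Integration.integrable_add) auto
  finally show "L2_norm_sq (weak_deriv m) = ennreal ((LINT x|lborel. (g1 x)\<^sup>2) + (LINT x|lborel. (g2 x)\<^sup>2))" using i by simp
qed

lemma Hdot_uminus: "Hdot_half_sq (\<lambda>x. - f x) = Hdot_half_sq f"
  by (simp add: Hdot_half_sq_def abs_minus_commute)

text \<open>Unfolding changes the derivative of the angle only in sign, and chords of the circle are
  no longer than arcs, so the map costs no more than its profile. The sign \<open>s\<close> reflects
  the second component, which reverses the degree and leaves the estimates unchanged.\<close>

lemma realise_profile:
  assumes u: "profile u" and fin: "profile_energy u < \<infinity>" and z: "alternates u (2 * k) z" and s: "s = 1 \<or> s = - 1"
  obtains m where "m \<in> A1 (s * int (k + 1))" "E1 m \<le> profile_energy u / 2"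
proof -
  obtain E where E: "profile_energy u \<le> ennreal E" "0 \<le> E" using fin by (cases "profile_energy u") auto
  have "4 * half_angle_energy u < \<infinity>" using fin by (simp add: profile_energy_def)
  then obtain S where S: "4 * half_angle_energy u = ennreal S" "0 \<le> S" by (cases "4 * half_angle_energy u") auto
  obtain g where g: "l2_primitive (angle u) g" and gS: "(LINT x|lborel. (g x)\<^sup>2) \<le> S"
    using primitive_of_dq_bound[OF angle_props(8)[OF u], of S] dq_angle[OF u E] S by metis
  obtain \<phi> h where \<phi>: "continuous_on UNIV \<phi>" "l2_primitive \<phi> h" "\<And>x. cos (\<phi> x) = 1 - u x" "\<And>x. (h x)\<^sup>2 = (g x)\<^sup>2"
    "\<And>x. x \<le> z 0 \<Longrightarrow> \<phi> x = angle u x"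
    "\<And>x. z (2 * k) \<le> x \<Longrightarrow> \<phi> x = real (2 * k + 2) * pi - angle u x"
    using unfold_angle[OF u z g order_refl] by auto
  define \<sigma> where "\<sigma> = real_of_int s"
  have \<sigma>: "\<sigma> = 1 \<or> \<sigma> = - 1" "\<sigma>\<^sup>2 = 1" using s by (auto simp: \<sigma>_def)
  define m where "m x = (vector [cos (\<phi> x), \<sigma> * sin (\<phi> x)] :: real^2)" for x
  have m12: "m x $ 1 = cos (\<phi> x)" "m x $ 2 = \<sigma> * sin (\<phi> x)" for x by (simp_all add: m_def)
  have mc: "continuous_on UNIV m" unfolding m_def vector2_eq by (intro continuous_intros \<phi>(1))
  have mn: "norm (m x) = 1" for x
  proof -
    have "(norm (m x))\<^sup>2 = 1" by (simp add: norm_sq_real2 m12 power_mult_distrib \<sigma>)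
    then show ?thesis by (simp add: power2_eq_1_iff) (metis norm_ge_zero neg_0_le_iff_le not_one_le_zero)
  qed
  have comp: "continuous_on UNIV (\<lambda>x. m x $ 1)" "continuous_on UNIV (\<lambda>x. m x $ 2)" unfolding m12 by (intro continuous_intros \<phi>(1))+
  then have [measurable]: "(\<lambda>x. m x $ 1) \<in> borel_measurable borel" "(\<lambda>x. m x $ 2) \<in> borel_measurable borel"
    by (auto intro: borel_measurable_continuous_onI)
  have [measurable]: "\<phi> \<in> borel_measurable borel" using \<phi>(1) by (rule borel_measurable_continuous_onI)
  have dqm: "dq (\<lambda>x. m x $ 1) n + dq (\<lambda>x. m x $ 2) n \<le> ennreal S" for n
  proof -
    have "dq (\<lambda>x. m x $ 1) n + dq (\<lambda>x. m x $ 2) n \<le> dq \<phi> n"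
      unfolding dq_add[OF \<open>(\<lambda>x. m x $ 1) \<in> _\<close> \<open>(\<lambda>x. m x $ 2) \<in> _\<close>] unfolding dq_def
    proof (intro nn_integral_mono ennreal_leI)
      fix x
      define a where "a = \<phi> (x + 1/2^n)" define b where "b = \<phi> x"
      have "(cos a - cos b)\<^sup>2 + (\<sigma> * sin a - \<sigma> * sin b)\<^sup>2 = (cos a - cos b)\<^sup>2 + \<sigma>\<^sup>2 * (sin a - sin b)\<^sup>2"
        by (simp add: power_mult_distrib[symmetric] right_diff_distrib)
      also have "\<dots> = 2 - 2 * cos (a - b)" by (simp add: \<sigma> cos_diff power2_diff sin_squared_eq algebra_simps)
      also have "\<dots> \<le> (a - b)\<^sup>2" by (rule two_minus_two_cos_le)
      finally have "(2^n)\<^sup>2 * ((cos a - cos b)\<^sup>2 + (\<sigma> * sin a - \<sigma> * sin b)\<^sup>2) \<le> (2^n)\<^sup>2 * (a - b)\<^sup>2" by (intro mult_left_mono) auto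
      then show "(2^n)\<^sup>2 * ((m (x + 1/2^n) $ 1 - m x $ 1)\<^sup>2 + (m (x + 1/2^n) $ 2 - m x $ 2)\<^sup>2) \<le> (2^n * (\<phi> (x + 1/2^n) - \<phi> x))\<^sup>2"
        by (simp add: m12 a_def b_def power_mult_distrib)
    qed
    also have "\<dots> \<le> (\<integral>\<^sup>+x. ennreal ((h x)\<^sup>2) \<partial>lborel)" by (rule dq_le_of_primitive[OF \<phi>(2)])
    also have "\<dots> = ennreal (LINT x|lborel. (g x)\<^sup>2)"
      unfolding \<phi>(4) using g by (intro nn_integral_eq_integral) (auto simp: l2_primitive_def)
    also have "\<dots> \<le> ennreal S" by (rule ennreal_leI[OF gS])
    finally show ?thesis .
  qed
  obtain S1 S2 where SS: "0 \<le> S1" "0 \<le> S2" "S1 + S2 \<le> S" "\<And>n. dq (\<lambda>x. m x $ 1) n \<le> ennreal S1" "\<And>n. dq (\<lambda>x. m x $ 2) n \<le> ennreal S2"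
    using dq_finite_sup[OF dqm _ _ S(2)] by auto
  obtain g1 where g1: "l2_primitive (\<lambda>x. m x $ 1) g1" "(LINT x|lborel. (g1 x)\<^sup>2) \<le> S1"
    using primitive_of_dq_bound[OF comp(1) SS(4,1)] by blast
  obtain g2 where g2: "l2_primitive (\<lambda>x. m x $ 2) g2" "(LINT x|lborel. (g2 x)\<^sup>2) \<le> S2"
    using primitive_of_dq_bound[OF comp(2) SS(5,2)] by blast
  note sob = sobolev_map_of_primitives[OF mc mn g1(1) g2(1)]
  have "L2_norm_sq (weak_deriv m) \<le> 4 * half_angle_energy u"
    unfolding sob(2) S(1) using g1(2) g2(2) SS(3) by (intro ennreal_leI) linarith
  moreover have mu: "(\<lambda>x. m x $ 1 - 1) = (\<lambda>x. - u x)" by (simp add: m12 \<phi>(3))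
  ultimately have E1: "E1 m \<le> profile_energy u / 2"
    unfolding E1_def profile_energy_def mu Hdot_uminus
    by (intro divide_right_mono_ennreal add_mono) (auto simp: L2_norm_sq_def)
  also have "\<dots> < \<infinity>" using fin by (simp add: ennreal_divide_eq_top_iff less_top[symmetric])
  finally have E1f: "E1 m < \<infinity>" .
  define \<psi> where "\<psi> x = \<sigma> * \<phi> x" for x
  have lift: "is_lifting m \<psi>"
    unfolding is_lifting_def \<psi>_def m_def using \<sigma>(1) by (auto intro!: continuous_intros \<phi>(1))
  have top: "(\<phi> \<longlongrightarrow> real (2 * k + 2) * pi - 0) at_top"
  proof (rule Lim_transform_eventually)
    show "((\<lambda>x. real (2 * k + 2) * pi - angle u x) \<longlongrightarrow> real (2 * k + 2) * pi - 0) at_top"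
      by (intro tendsto_intros angle_tendsto_0 u profile_tendsto_0 fin)
    show "\<forall>\<^sub>F x in at_top. real (2 * k + 2) * pi - angle u x = \<phi> x"
      using eventually_ge_at_top[of "z (2 * k)"] by eventually_elim (simp add: \<phi>(6))
  qed
  have bot: "(\<phi> \<longlongrightarrow> 0) at_bot"
  proof (rule Lim_transform_eventually)
    show "(angle u \<longlongrightarrow> 0) at_bot" by (intro angle_tendsto_0 u profile_tendsto_0 fin)
    show "\<forall>\<^sub>F x in at_bot. angle u x = \<phi> x"
      using eventually_le_at_bot[of "z 0"] by eventually_elim (simp add: \<phi>(5))
  qed
  have "winding_deg m = (\<sigma> * (real (2 * k + 2) * pi - 0) - \<sigma> * 0) / (2 * pi)"
    by (rule winding_deg_eq[OF lift]) (unfold \<psi>_def, intro tendsto_intros top bot, intro tendsto_intros bot)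
  also have "\<dots> = real_of_int (s * int (k + 1))" by (simp add: \<sigma>_def field_simps)
  finally have "m \<in> A1 (s * int (k + 1))" using sob(1) E1f by (simp add: A1_def)
  then show ?thesis using that E1 by blast
qed

section \<open>From a circle-valued map of given degree to its profile\<close>

lemma lifting_exists:
  fixes m :: "real \<Rightarrow> real^2"
  assumes m: "continuous_on UNIV m" "\<And>x. norm (m x) = 1"
  shows "\<exists>\<phi>. is_lifting m \<phi>"
proof -
  define c where "c x = complex_of_real (m x $ 1) + \<i> * complex_of_real (m x $ 2)" for x
  have cc: "continuous_on UNIV c" unfolding c_def by (intro continuous_intros m)
  have cn: "norm (c x) = 1" for x
    using norm_sq_real2[of "m x"] m(2)[of x] by (simp add: c_def cmod_def)
  have c0: "c x \<noteq> 0" for x using cn[of x] by auto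
  obtain g where g: "continuous_on UNIV g" "\<And>x. c x = exp (g x)"
    using continuous_logarithm_on_contractible[OF cc convex_imp_contractible[OF convex_UNIV]] c0 by auto
  \<comment> \<open>As \<open>c\<close> has modulus 1, its logarithm is purely imaginary, and the
    imaginary part is a lifting.\<close>
  have re: "Re (g x) = 0" for x using cn[of x] unfolding g(2) by simp
  have "m x $ 1 = cos (Im (g x)) \<and> m x $ 2 = sin (Im (g x))" for x
    using arg_cong[OF g(2)[of x], of Re] arg_cong[OF g(2)[of x], of Im] re[of x]
    by (simp add: c_def Re_exp Im_exp)
  then have "is_lifting m (\<lambda>x. Im (g x))"
    unfolding is_lifting_def using g(1) by (auto simp: vec_eq_iff forall_2 intro!: continuous_intros)
  then show ?thesis by blast
qed

text \<open>Once \<open>cos (\<phi> x)\<close> stays positive, continuity confines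
  \<open>\<phi>\<close> to distance less than \<open>pi / 2\<close> from one multiple of
  \<open>2 * pi\<close>. There the arccosine recovers the distance to that multiple from the
  cosine.\<close>

lemma lifting_limit:
  fixes \<phi> :: "real \<Rightarrow> real"
  assumes \<phi>: "continuous_on UNIV \<phi>" and lim: "((\<lambda>x. cos (\<phi> x)) \<longlongrightarrow> 1) at_top"
  shows "\<exists>k::int. (\<phi> \<longlongrightarrow> 2 * pi * k) at_top"
proof -
  have "\<forall>\<^sub>F x in at_top. 0 < cos (\<phi> x)" using lim by (intro order_tendstoD(1)) auto
  then obtain X where X: "\<And>x. X \<le> x \<Longrightarrow> 0 < cos (\<phi> x)" by (auto simp: eventually_at_top_linorder)
  define k where "k = round (\<phi> X / (2 * pi))"
  define \<psi> where "\<psi> x = \<bar>\<phi> x - 2 * pi * of_int k\<bar>" for x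
  have cos: "cos (\<psi> x) = cos (\<phi> x)" for x
    using cos_int_2pin[of k] sin_int_2pin[of k] by (simp add: \<psi>_def cos_diff)
  have \<psi>c: "continuous_on A \<psi>" for A unfolding \<psi>_def by (intro continuous_intros continuous_on_subset[OF \<phi>]) auto
  have "\<bar>of_int k - \<phi> X / (2 * pi)\<bar> \<le> 1 / 2" unfolding k_def by (rule of_int_round_abs_le)
  then have "2 * pi * \<bar>of_int k - \<phi> X / (2 * pi)\<bar> \<le> 2 * pi * (1 / 2)" by (intro mult_left_mono) auto
  moreover have "2 * pi * \<bar>of_int k - \<phi> X / (2 * pi)\<bar> = \<bar>2 * pi * (of_int k - \<phi> X / (2 * pi))\<bar>" by (simp only: abs_mult) simp
  moreover have "\<dots> = \<psi> X" by (simp add: \<psi>_def algebra_simps abs_minus_commute)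
  ultimately have \<psi>X: "\<psi> X \<le> pi" by simp
  have small: "\<psi> X < pi / 2"
  proof (rule ccontr)
    assume "\<not> ?thesis"
    then have "cos (\<psi> X) \<le> cos (pi / 2)" using \<psi>X by (intro cos_monotone_0_pi_le) auto
    then show False using X[of X] by (simp add: cos)
  qed
  have bd: "\<psi> x < pi / 2" if x: "X \<le> x" for x
  proof (rule ccontr)
    assume "\<not> ?thesis"
    then obtain y where "X \<le> y" "y \<le> x" "\<psi> y = pi / 2"
      using IVT'[of \<psi> X "pi / 2" x] small x \<psi>c by auto
    moreover from this have "cos (\<psi> y) = 0" by (simp only: cos_pi_half)
    ultimately show False using X[of y] cos[of y] by simp
  qed
  have "((\<lambda>x. arccos (cos (\<phi> x))) \<longlongrightarrow> arccos 1) at_top"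
    by (rule continuous_on_tendsto_compose[OF continuous_on_arccos' lim]) auto
  moreover have "\<forall>\<^sub>F x in at_top. arccos (cos (\<phi> x)) = \<psi> x"
    using eventually_ge_at_top[of X]
  proof eventually_elim
    case (elim x)
    have "\<psi> x \<le> pi" using bd[OF elim] pi_gt_zero by linarith
    then have "arccos (cos (\<psi> x)) = \<psi> x" by (intro arccos_cos) (simp_all add: \<psi>_def)
    then show ?case by (simp add: cos)
  qed
  ultimately have "(\<psi> \<longlongrightarrow> arccos 1) at_top" by (rule Lim_transform_eventually)
  then have "((\<lambda>x. \<phi> x - 2 * pi * of_int k) \<longlongrightarrow> 0) at_top" by (simp add: \<psi>_def[abs_def] tendsto_rabs_zero_iff)
  then show ?thesis using LIM_zero_cancel by blast
qed

text \<open>The counterpart of \<open>angle_increment\<close> in the other direction. With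
  \<open>A\<close> the inner product of the two half-angle vectors,
  \<open>\<kappa> = 2 * (1 - A)\<close>, and the half-angle formulas give
  \<open>A^2 \<ge> 1 - q\<close>. Folding onto a half circle enters through
  \<open>|b * d| \<ge> b * d\<close>: it does not increase distances.\<close>

lemma half_angle_increment_circle:
  fixes v w :: "real^2"
  assumes v: "norm v = 1" and w: "norm w = 1"
  defines "U \<equiv> \<lambda>x::real^2. 1 - x $ 1"
  defines "\<kappa> \<equiv> (sqrt (1 - U v / 2) - sqrt (1 - U w / 2))\<^sup>2 + (sqrt (U v / 2) - sqrt (U w / 2))\<^sup>2"
  defines "q \<equiv> ((v $ 1 - w $ 1)\<^sup>2 + (v $ 2 - w $ 2)\<^sup>2) / 4"
  shows "(1 - q / 2) * \<kappa> \<le> q"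
proof -
  define a where "a = v $ 1" define b where "b = v $ 2" define c where "c = w $ 1" define d where "d = w $ 2"
  have ab: "a\<^sup>2 + b\<^sup>2 = 1" and cd: "c\<^sup>2 + d\<^sup>2 = 1" using norm_sq_real2[of v] norm_sq_real2[of w] v w by (auto simp: a_def b_def c_def d_def)
  have a1: "a\<^sup>2 \<le> 1" "c\<^sup>2 \<le> 1" using ab cd zero_le_power2[of b] zero_le_power2[of d] by linarith+
  then have abd: "\<bar>a\<bar> \<le> 1" "\<bar>c\<bar> \<le> 1" by (auto simp: abs_square_le_1)
  define C where "C = sqrt ((1 + a) / 2)" define S where "S = sqrt ((1 - a) / 2)"
  define C' where "C' = sqrt ((1 + c) / 2)" define S' where "S' = sqrt ((1 - c) / 2)"
  have sq: "C\<^sup>2 = (1 + a) / 2" "S\<^sup>2 = (1 - a) / 2" "C'\<^sup>2 = (1 + c) / 2" "S'\<^sup>2 = (1 - c) / 2"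
    using abd by (auto simp: C_def S_def C'_def S'_def abs_le_iff)
  have nn: "0 \<le> C" "0 \<le> S" "0 \<le> C'" "0 \<le> S'" using abd by (auto simp: C_def S_def C'_def S'_def abs_le_iff)
  have "1 - (1 - a) / 2 = (1 + a) / 2" "1 - (1 - c) / 2 = (1 + c) / 2" by (simp_all add: field_simps)
  then have k: "\<kappa> = (C - C')\<^sup>2 + (S - S')\<^sup>2"
    unfolding \<kappa>_def U_def C_def S_def C'_def S'_def a_def[symmetric] c_def[symmetric] by (simp only:)
  define A where "A = C * C' + S * S'"
  have A0: "0 \<le> A" using nn by (simp add: A_def)
  have kA: "\<kappa> = 2 - 2 * A" unfolding k A_def power2_diff sq by (simp add: algebra_simps) (simp add: field_simps)
  have "(C * S)\<^sup>2 = \<bar>b / 2\<bar>\<^sup>2" "(C' * S')\<^sup>2 = \<bar>d / 2\<bar>\<^sup>2"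
    using ab cd unfolding power_mult_distrib sq by (simp_all add: power2_eq_square field_simps)
  then have "C * S = \<bar>b / 2\<bar>" "C' * S' = \<bar>d / 2\<bar>" using nn by (auto intro!: power2_eq_imp_eq simp del: power2_abs)
  then have "(C * S) * (C' * S') = \<bar>(b / 2) * (d / 2)\<bar>" by (simp only: abs_mult)
  then have bd: "(C * S) * (C' * S') \<ge> b * d / 4" by simp
  have "A\<^sup>2 = C\<^sup>2 * C'\<^sup>2 + S\<^sup>2 * S'\<^sup>2 + 2 * ((C * S) * (C' * S'))" by (simp add: A_def power2_eq_square algebra_simps)
  also have "\<dots> \<ge> C\<^sup>2 * C'\<^sup>2 + S\<^sup>2 * S'\<^sup>2 + 2 * (b * d / 4)" using bd by simp
  also have "C\<^sup>2 * C'\<^sup>2 + S\<^sup>2 * S'\<^sup>2 + 2 * (b * d / 4) = (1 + a * c + b * d) / 2" unfolding sq by (simp add: field_simps)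
  also have "\<dots> = 1 - q"
    unfolding q_def a_def[symmetric] b_def[symmetric] c_def[symmetric] d_def[symmetric] power2_diff using ab cd by (simp add: field_simps)
  finally have A2: "1 - q \<le> A\<^sup>2" .
  have q0: "0 \<le> q" by (simp add: q_def)
  have A1: "A \<le> 1" using kA k zero_le_power2[of "C - C'"] zero_le_power2[of "S - S'"] by linarith
  \<comment> \<open>From \<open>A^2 \<le> A\<close>; it yields \<open>2 - q \<le> 1 + A\<close>, so
    that \<open>1 - A\<close> can be estimated through \<open>1 - A^2\<close>.\<close>
  have "1 - q \<le> A" using A2 mult_left_le[of A A] A0 A1 by (simp add: power2_eq_square)
  then have "(1 - A) * (2 - q) \<le> (1 - A) * (1 + A)" using A1 by (intro mult_left_mono) auto
  also have "\<dots> = 1 - A\<^sup>2" by (simp add: power2_eq_square algebra_simps)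
  also have "\<dots> \<le> q" using A2 by simp
  finally show ?thesis by (simp add: kA algebra_simps)
qed

lemma two_times_half_ennreal: "2 * (x / 2) = (x :: ennreal)"
proof -
  have "inverse (2::ennreal) * 2 = ennreal (1/2 * 2)" by (subst ennreal_mult) auto
  then show ?thesis by (simp add: divide_ennreal_def mult.assoc mult.commute[of 2])
qed

text \<open>By \<open>half_angle_increment_circle\<close>, increments of the half-angle vector are
  asymptotically at most half those of \<open>m\<close>, which accounts for the factor 4. The
  relative error \<open>Q n x / 2\<close> is at most \<open>(G / 4) / 2^n\<close> by Hoelder
  continuity of the components.\<close>

lemma profile_of_map:
  assumes m: "m \<in> H1_loc_circle" and fin: "E1 m < \<infinity>"
  defines "u \<equiv> \<lambda>x. 1 - m x $ 1"
  shows "profile u" "profile_energy u \<le> 2 * E1 m"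
proof -
  have mc: "continuous_on UNIV m" and mn: "\<And>x. norm (m x) = 1" and ex: "\<exists>g. has_weak_deriv m g"
    using m by (auto simp: H1_loc_circle_def H1_loc_def)
  have comp: "continuous_on UNIV (\<lambda>x. m x $ i)" for i by (intro continuous_intros mc)
  have "\<bar>m x $ 1\<bar> \<le> 1" for x using component_le_norm_cart[of "m x" 1] mn by simp
  then have ub: "0 \<le> u x \<and> u x \<le> 2" for x by (simp add: u_def abs_le_iff)
  show prof: "profile u" unfolding profile_def using ub by (auto simp: u_def intro!: continuous_intros comp)
  have [measurable]: "u \<in> borel_measurable borel" using prof by (rule profile_measurable)
  have [measurable]: "(\<lambda>x. m x $ i) \<in> borel_measurable borel" for i by (rule borel_measurable_continuous_onI[OF comp])
  define g where "g = weak_deriv m"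
  have w: "has_weak_deriv m g" unfolding g_def weak_deriv_def using ex by (rule someI_ex)
  then have gL: "g \<in> L1_loc" by (simp add: has_weak_deriv_def)
  then have [measurable]: "g \<in> borel_measurable borel" by (simp add: L1_loc_def)
  have gm[measurable]: "(\<lambda>x. g x $ i) \<in> borel_measurable borel" for i
    by (rule borel_measurable_continuous_on[of "\<lambda>v. v $ i"]) (auto intro!: continuous_intros)
  have E2: "2 * E1 m = L2_norm_sq g + Hdot_half_sq (\<lambda>x. m x $ 1 - 1) + L2_norm_sq (\<lambda>x. m x $ 1 - 1)"
    unfolding E1_def g_def by (rule two_times_half_ennreal)
  have "2 * E1 m < \<infinity>" using fin by (simp add: ennreal_mult_less_top)
  then have "L2_norm_sq g < \<infinity>" unfolding E2 by simp
  then obtain G where G: "L2_norm_sq g = ennreal G" "0 \<le> G" by (cases "L2_norm_sq g") auto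
  have gsum: "(\<integral>\<^sup>+x. ennreal ((g x $ 1)\<^sup>2) \<partial>lborel) + (\<integral>\<^sup>+x. ennreal ((g x $ 2)\<^sup>2) \<partial>lborel) = ennreal G"
    unfolding G(1)[symmetric] L2_norm_sq_def norm_sq_real2 by (subst nn_integral_add[symmetric]) auto
  have gi: "integrable lborel (\<lambda>x. (g x $ i)\<^sup>2)" for i :: 2
  proof (rule integrableI_nonneg)
    have "(\<integral>\<^sup>+x. ennreal ((g x $ i)\<^sup>2) \<partial>lborel) \<le> ennreal G"
      unfolding gsum[symmetric] using exhaust_2[of i] by auto
    then show "(\<integral>\<^sup>+x. ennreal ((g x $ i)\<^sup>2) \<partial>lborel) < \<infinity>" by (auto simp: less_top[symmetric] top_unique)
  qed auto
  have prim: "l2_primitive (\<lambda>x. m x $ i) (\<lambda>x. g x $ i)" for i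
    unfolding l2_primitive_def
  proof (intro conjI allI impI gi)
    fix a b :: real assume ab: "a \<le> b"
    have "m b $ i - m a $ i = (LINT x:{a..b}|lborel. g x) $ i" using weak_deriv_ftc[OF mc w ab] by (metis vector_minus_component)
    also have "\<dots> = (LINT x|lborel. (indicator {a..b} x *\<^sub>R g x) $ i)"
      unfolding set_lebesgue_integral_def using set_integrable_L1_loc[OF gL, of a b] unfolding set_integrable_def
      by (intro integral_bounded_linear[OF bounded_linear_vec_nth, symmetric])
    finally show "m b $ i - m a $ i = (LINT x:{a..b}|lborel. g x $ i)" by (simp add: set_lebesgue_integral_def)
  qed auto
  have dqi: "dq (\<lambda>x. m x $ 1) n + dq (\<lambda>x. m x $ 2) n \<le> ennreal G" for n
    unfolding gsum[symmetric] by (intro add_mono dq_le_of_primitive prim)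
  have dq1: "dq (\<lambda>x. m x $ i) n \<le> ennreal G" for i :: 2 and n
    using dqi[of n] exhaust_2[of i] by (auto intro: order_trans[rotated])
  have H: "(m x $ i - m y $ i)\<^sup>2 \<le> G * \<bar>x - y\<bar>" for i :: 2 and x y
    by (rule hoelder_of_dq[OF comp dq1 G(2)])
  define Q where "Q n x = ((m (x + 1/2^n) $ 1 - m x $ 1)\<^sup>2 + (m (x + 1/2^n) $ 2 - m x $ 2)\<^sup>2) / 4" for n x
  have [measurable]: "Q n \<in> borel_measurable borel" for n unfolding Q_def by measurable
  have "dq (half_cos u) n + dq (half_sin u) n \<le> ennreal (G / 4)" for n
  proof (rule dq_le_asymptotic[where C = "G / 4" and F = Q])
    show "half_cos u \<in> borel_measurable borel" "half_sin u \<in> borel_measurable borel" "Q n \<in> borel_measurable borel" for n by measurable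
    show "0 \<le> G / 4" using G by simp
    fix n x
    define k where "k = (half_cos u (x + 1/2^n) - half_cos u x)\<^sup>2 + (half_sin u (x + 1/2^n) - half_sin u x)\<^sup>2"
    have "Q n x / 2 \<le> G / 4 / 2^n" using H[of "x + 1/2^n" 1 x] H[of "x + 1/2^n" 2 x] by (simp add: Q_def field_simps)
    then have "(1 - G / 4 / 2^n) * k \<le> (1 - Q n x / 2) * k" by (intro mult_right_mono) (auto simp: k_def)
    also have "\<dots> \<le> Q n x"
      using half_angle_increment_circle[OF mn[of "x + 1/2^n"] mn[of x]] unfolding Q_def k_def half_cos_def half_sin_def u_def .
    finally show "(1 - G / 4 / 2^n) * k \<le> Q n x" .
  next
    fix n
    have "(\<integral>\<^sup>+x. ennreal ((2^n)\<^sup>2 * Q n x) \<partial>lborel) = (\<integral>\<^sup>+x. ennreal (1/4) * ennreal ((2^n)\<^sup>2 * ((m (x + 1/2^n) $ 1 - m x $ 1)\<^sup>2 + (m (x + 1/2^n) $ 2 - m x $ 2)\<^sup>2)) \<partial>lborel)"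
      by (intro nn_integral_cong, subst ennreal_mult[symmetric]) (auto simp: Q_def)
    also have "\<dots> = ennreal (1/4) * (dq (\<lambda>x. m x $ 1) n + dq (\<lambda>x. m x $ 2) n)"
      by (subst dq_add) (auto intro!: nn_integral_cmult)
    also have "\<dots> \<le> ennreal (1/4) * ennreal G" by (intro mult_left_mono dqi) simp
    also have "\<dots> = ennreal (G / 4)" using G(2) by (subst ennreal_mult[symmetric]) auto
    finally show "(\<integral>\<^sup>+x. ennreal ((2^n)\<^sup>2 * Q n x) \<partial>lborel) \<le> ennreal (G / 4)" .
  qed
  then have "half_angle_energy u \<le> ennreal (G / 4)" unfolding half_angle_energy_def by (intro SUP_least)
  then have "4 * half_angle_energy u \<le> 4 * ennreal (G / 4)" by (rule mult_left_mono) simp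
  also have "\<dots> = ennreal (4 * (G / 4))" using G(2) by (subst ennreal_mult) auto
  finally have D: "4 * half_angle_energy u \<le> L2_norm_sq g" by (simp add: G(1))
  have mu: "(\<lambda>x. m x $ 1 - 1) = (\<lambda>x. - u x)" by (simp add: u_def)
  show "profile_energy u \<le> 2 * E1 m"
    unfolding E2 profile_energy_def mu Hdot_uminus by (intro add_mono D) (auto simp: L2_norm_sq_def)
qed

text \<open>The levels \<open>pi\<close>, \<open>2 * pi\<close>, up to
  \<open>(2 * k + 1) * pi\<close> lie strictly between the limits of \<open>\<psi>\<close>, and the
  intermediate value theorem provides them one after the other, each to the right of the last. The
  index \<open>i\<close> belongs to the level \<open>(i + 1) * pi\<close>, so even indices carry the
  value 2.\<close>

lemma crossing_points:
  fixes \<psi> :: "real \<Rightarrow> real"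
  assumes \<psi>: "continuous_on UNIV \<psi>" and bot: "(\<psi> \<longlongrightarrow> 0) at_bot" and top: "(\<psi> \<longlongrightarrow> real (2 * k + 2) * pi) at_top"
    and u: "\<And>x. u x = 1 - cos (\<psi> x)"
  shows "\<exists>z. alternates u (2 * k) z"
proof -
  have "\<forall>\<^sub>F x in at_bot. \<psi> x < pi" using bot by (intro order_tendstoD(2)) auto
  then obtain X where X: "\<psi> X < pi" by (auto simp: eventually_at_bot_linorder)
  have "real (2 * k + 1) * pi < real (2 * k + 2) * pi" by (intro mult_strict_right_mono) auto
  then have "\<forall>\<^sub>F x in at_top. real (2 * k + 1) * pi < \<psi> x" using top by (intro order_tendstoD(1))
  then obtain Y where Y: "X \<le> Y" "real (2 * k + 1) * pi < \<psi> Y"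
    by (metis (mono_tags, lifting) eventually_at_top_linorder nle_le)
  have lev: "real (j + 1) * pi \<le> real (2 * k + 1) * pi" if "j \<le> 2 * k" for j
    using that by (intro mult_right_mono) auto
  have ivt: "\<exists>x. a < x \<and> x \<le> Y \<and> \<psi> x = real (j + 1) * pi" if aj: "a \<le> Y" "\<psi> a < real (j + 1) * pi" "j \<le> 2 * k" for a j
  proof -
    have "real (j + 1) * pi \<le> \<psi> Y" using lev[OF aj(3)] Y(2) by linarith
    then obtain x where "a \<le> x" "x \<le> Y" "\<psi> x = real (j + 1) * pi"
      using IVT'[of \<psi> a "real (j + 1) * pi" Y, OF less_imp_le[OF aj(2)] _ aj(1) continuous_on_subset[OF \<psi>]] by blast
    then show ?thesis using aj(2) by (intro exI[of _ x]) (auto simp: less_le)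
  qed
  have "j \<le> 2 * k \<Longrightarrow> \<exists>z. (\<forall>i<j. z i < z (Suc i)) \<and> (\<forall>i\<le>j. \<psi> (z i) = real (i + 1) * pi \<and> z i \<le> Y)" for j
  proof (induction j)
    case 0
    obtain x where "x \<le> Y" "\<psi> x = real (0 + 1) * pi" using ivt[of X 0] X Y(1) by auto
    then show ?case by (intro exI[of _ "\<lambda>_. x"]) auto
  next
    case (Suc j)
    then obtain z where z: "\<forall>i<j. z i < z (Suc i)" "\<forall>i\<le>j. \<psi> (z i) = real (i + 1) * pi \<and> z i \<le> Y" by auto
    have "\<psi> (z j) < real (Suc j + 1) * pi" using z(2) by simp
    then obtain x where x: "z j < x" "x \<le> Y" "\<psi> x = real (Suc j + 1) * pi" using ivt[of "z j" "Suc j"] z(2) Suc.prems by auto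
    show ?case
      by (rule exI[of _ "z(Suc j := x)"]) (use z x in \<open>auto simp: less_Suc_eq le_Suc_eq\<close>)
  qed
  from this[OF order_refl] obtain z where z: "\<forall>i<2 * k. z i < z (Suc i)" "\<forall>i\<le>2 * k. \<psi> (z i) = real (i + 1) * pi" by blast
  have "u (z i) = (if even i then 2 else 0)" if "i \<le> 2 * k" for i
  proof -
    have "cos (\<psi> (z i)) = (- 1) ^ (i + 1)" using z(2) that cos_npi[of "i + 1"] by simp
    then show ?thesis by (simp add: u)
  qed
  then show ?thesis using z(1) by (auto simp: alternates_def)
qed

text \<open>Subtracting the left limit and multiplying by the sign of \<open>l\<close> normalises
  the lifting to run from 0 to \<open>2 * |l| * pi\<close> without changing its cosine; then
  \<open>crossing_points\<close> applies with \<open>k + 1 = |l|\<close>.\<close>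

lemma map_alternates:
  assumes m: "m \<in> A1 l" and l: "l \<noteq> 0"
  shows "\<exists>z. alternates (\<lambda>x. 1 - m x $ 1) (2 * (nat \<bar>l\<bar> - 1)) z"
proof -
  have mH: "m \<in> H1_loc_circle" and fin: "E1 m < \<infinity>" and deg: "winding_deg m = real_of_int l" using m by (auto simp: A1_def)
  have mc: "continuous_on UNIV m" and mn: "\<And>x. norm (m x) = 1" using mH by (auto simp: H1_loc_circle_def)
  define u where "u x = 1 - m x $ 1" for x
  note pu = profile_of_map[OF mH fin, folded u_def[abs_def]]
  have "2 * E1 m < \<infinity>" using fin by (simp add: ennreal_mult_less_top)
  with pu(2) have "profile_energy u < \<infinity>" by (rule le_less_trans)
  note u0 = profile_tendsto_0[OF pu(1) this]
  obtain \<phi> where \<phi>: "is_lifting m \<phi>" using lifting_exists[OF mc mn] by blast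
  have \<phi>c: "continuous_on UNIV \<phi>" and m1: "\<And>x. m x $ 1 = cos (\<phi> x)" using \<phi> by (auto simp: is_lifting_def)
  have cosu: "cos (\<phi> x) = 1 - u x" for x by (simp add: u_def m1)
  have "((\<lambda>x. 1 - u x) \<longlongrightarrow> 1 - 0) at_top" "((\<lambda>x. 1 - u x) \<longlongrightarrow> 1 - 0) at_bot" by (intro tendsto_intros u0)+
  then have c: "((\<lambda>x. cos (\<phi> x)) \<longlongrightarrow> 1) at_top" "((\<lambda>x. cos (\<phi> (- x))) \<longlongrightarrow> 1) at_top"
    by (simp_all add: cosu filterlim_at_bot_mirror)
  obtain b :: int where b: "(\<phi> \<longlongrightarrow> 2 * pi * b) at_top" using lifting_limit[OF \<phi>c c(1)] by blast
  have "continuous_on UNIV (\<lambda>x. \<phi> (- x))" by (intro continuous_on_compose2[OF \<phi>c] continuous_intros) auto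
  from lifting_limit[OF this c(2)] obtain a :: int where "((\<lambda>x. \<phi> (- x)) \<longlongrightarrow> 2 * pi * a) at_top" by blast
  then have a: "(\<phi> \<longlongrightarrow> 2 * pi * a) at_bot" by (simp add: filterlim_at_bot_mirror)
  have "winding_deg m = (2 * pi * b - 2 * pi * a) / (2 * pi)" by (rule winding_deg_eq[OF \<phi> b a])
  also have "\<dots> = real_of_int (b - a)" by (simp add: field_simps)
  finally have ba: "b - a = l" using deg by simp
  define s where "s = real_of_int (sgn l)"
  have s: "s = 1 \<or> s = - 1" using l by (auto simp: s_def sgn_if)
  define \<psi> where "\<psi> x = s * (\<phi> x - 2 * pi * a)" for x
  have "\<exists>z. alternates u (2 * (nat \<bar>l\<bar> - 1)) z"
  proof (rule crossing_points[where \<psi> = \<psi>])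
    show "continuous_on UNIV \<psi>" unfolding \<psi>_def by (intro continuous_intros \<phi>c)
    have "(\<psi> \<longlongrightarrow> s * (2 * pi * a - 2 * pi * a)) at_bot" unfolding \<psi>_def by (intro tendsto_intros a)
    then show "(\<psi> \<longlongrightarrow> 0) at_bot" by simp
    have "(\<psi> \<longlongrightarrow> s * (2 * pi * b - 2 * pi * a)) at_top" unfolding \<psi>_def by (intro tendsto_intros b)
    moreover have "s * (2 * pi * b - 2 * pi * a) = real (2 * (nat \<bar>l\<bar> - 1) + 2) * pi"
    proof -
      have "s * (2 * pi * b - 2 * pi * a) = 2 * pi * (s * l)" using ba by (auto simp: algebra_simps)
      also have "s * l = real_of_int \<bar>l\<bar>" by (simp add: s_def abs_sgn mult.commute flip: of_int_mult)
      also have "2 * pi * real_of_int \<bar>l\<bar> = (2 * real_of_int \<bar>l\<bar>) * pi" by simp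
      also have "2 * real_of_int \<bar>l\<bar> = real (2 * (nat \<bar>l\<bar> - 1) + 2)" using l by (simp add: of_nat_diff)
      finally show ?thesis .
    qed
    ultimately show "(\<psi> \<longlongrightarrow> real (2 * (nat \<bar>l\<bar> - 1) + 2) * pi) at_top" by (simp only:)
    have "cos (\<psi> x) = cos (\<phi> x - 2 * pi * a)" for x 
    proof -
      have "\<psi> x = \<phi> x - 2 * pi * a \<or> \<psi> x = - (\<phi> x - 2 * pi * a)" using s by (auto simp: \<psi>_def)
      then show ?thesis by (metis cos_minus)
    qed
    then show "u x = 1 - cos (\<psi> x)" for x
      using cosu[of x] cos_int_2pin[of a] sin_int_2pin[of a] by (simp add: cos_diff)
  qed
  then show ?thesis by (simp add: u_def[abs_def])
qed

section \<open>A competitor of finite energy, and degree zero\<close>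

lemma abs_trig_diff_le:
  fixes a b :: real
  shows "\<bar>sin a - sin b\<bar> \<le> \<bar>a - b\<bar>" "\<bar>cos a - cos b\<bar> \<le> \<bar>a - b\<bar>"
proof -
  have *: "(cos a - cos b)\<^sup>2 + (sin a - sin b)\<^sup>2 \<le> (a - b)\<^sup>2"
    using two_minus_two_cos_le[of "a - b"] by (simp add: cos_diff power2_diff sin_squared_eq algebra_simps)
  have "(sin a - sin b)\<^sup>2 \<le> (a - b)\<^sup>2" "(cos a - cos b)\<^sup>2 \<le> (a - b)\<^sup>2"
    using * zero_le_power2[of "cos a - cos b"] zero_le_power2[of "sin a - sin b"] by linarith+
  then show "\<bar>sin a - sin b\<bar> \<le> \<bar>a - b\<bar>" "\<bar>cos a - cos b\<bar> \<le> \<bar>a - b\<bar>" by (simp_all add: abs_le_square_iff)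
qed

text \<open>The profile of a map that winds \<open>k + 1\<close> times around the circle at unit
  speed on \<open>{0..L}\<close> and rests elsewhere. Being Lipschitz with compact support makes
  every term of the energy finite, so the infimum over the class is finite.\<close>

lemma admissible_profile_exists:
  obtains v z where "profile v" "alternates v (2 * k) z" "profile_energy v < \<infinity>"
proof -
  define L where "L = real (2 * k + 2) * pi"
  have L: "L > 0" by (simp add: L_def add_pos_nonneg)
  define t where "t x = max 0 (min L x)" for x
  have tl: "\<bar>t x - t y\<bar> \<le> \<bar>x - y\<bar>" for x y unfolding t_def by linarith
  have t0: "t x = 0" if "x \<le> 0" for x using that L by (simp add: t_def)
  have tL: "t x = L" if "L \<le> x" for x using that L by (simp add: t_def)
  define v where "v x = 1 - cos (t x)" for x
  have tc: "continuous_on UNIV t" unfolding t_def by (intro continuous_intros)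
  have v2: "0 \<le> v x \<and> v x \<le> 2" for x using cos_le_one[of "t x"] cos_ge_minus_one[of "t x"] by (simp add: v_def)
  have v: "profile v" unfolding profile_def using v2 by (auto simp: v_def intro!: continuous_intros tc)
  have [measurable]: "v \<in> borel_measurable borel" using v by (rule profile_measurable)
  have cL: "cos L = 1" unfolding L_def using cos_npi[of "2 * k + 2"] by simp
  have vz: "v x = 0" if "x \<notin> {0..L}" for x using that t0[of x] tL[of x] cL by (auto simp: v_def)
  have z: "\<exists>z. alternates v (2 * k) z"
  proof (rule crossing_points[where \<psi> = t, OF tc])
    show "(t \<longlongrightarrow> 0) at_bot"
      by (rule tendsto_eventually, rule eventually_mono[OF eventually_le_at_bot[of 0]]) (rule t0)
    show "(t \<longlongrightarrow> real (2 * k + 2) * pi) at_top" unfolding L_def[symmetric]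
      by (rule tendsto_eventually, rule eventually_mono[OF eventually_ge_at_top[of L]]) (rule tL)
  qed (simp add: v_def)
  have hs: "half_sin v x = \<bar>sin (t x / 2)\<bar>" for x
    using cos_double_sin[of "t x / 2"] by (simp add: half_sin_def v_def)
  have hc: "half_cos v x = \<bar>cos (t x / 2)\<bar>" for x
  proof -
    have "1 - v x / 2 = (cos (t x / 2))\<^sup>2" using cos_double_cos[of "t x / 2"] by (simp add: v_def field_simps)
    then show ?thesis by (simp add: half_cos_def)
  qed
  have dqb: "dq f n \<le> ennreal (L + 1)"
    if f: "\<And>x y. \<bar>f x - f y\<bar> \<le> \<bar>t x - t y\<bar>" for f :: "real \<Rightarrow> real" and n
  proof -
    define h :: real where "h = 1 / 2^n"
    have h: "0 < h" "h \<le> 1" "2^n * h = 1" by (auto simp: h_def)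
    \<comment> \<open>Increments vanish outside this interval: from the left, \<open>x + h\<close>
      reaches \<open>{0..L}\<close> only if \<open>x \<ge> - 1\<close>, because
      \<open>h \<le> 1\<close>.\<close>
    have "dq f n \<le> (\<integral>\<^sup>+x. indicator {-1..L} x \<partial>lborel)"
      unfolding dq_def
    proof (intro nn_integral_mono)
      fix x
      show "ennreal ((2^n * (f (x + 1/2^n) - f x))\<^sup>2) \<le> indicator {-1..L} x"
      proof (cases "x \<in> {-1..L}")
        case True
        have "\<bar>f (x + h) - f x\<bar> \<le> h" using f[of "x + h" x] tl[of "x + h" x] h by simp
        then have "2^n * \<bar>f (x + h) - f x\<bar> \<le> 2^n * h" by (intro mult_left_mono) auto
        then have "\<bar>2^n * (f (x + h) - f x)\<bar> \<le> 1" using h by (simp add: abs_mult)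
        then have "(2^n * (f (x + h) - f x))\<^sup>2 \<le> 1" by (simp add: abs_square_le_1)
        then show ?thesis using True by (simp add: h_def)
      next
        case False
        then have "t (x + h) = t x" using h t0[of x] t0[of "x + h"] tL[of x] tL[of "x + h"] by auto
        then have "f (x + h) = f x" using f[of "x + h" x] by simp
        then show ?thesis by (simp add: h_def)
      qed
    qed
    also have "\<dots> = ennreal (L + 1)" using L by simp
    finally show ?thesis .
  qed
  have "dq (half_cos v) n + dq (half_sin v) n \<le> ennreal (L + 1) + ennreal (L + 1)" for n
  proof (intro add_mono dqb)
    fix x y
    have "\<bar>\<bar>cos (t x / 2)\<bar> - \<bar>cos (t y / 2)\<bar>\<bar> \<le> \<bar>cos (t x / 2) - cos (t y / 2)\<bar>" by simp
    also have "\<dots> \<le> \<bar>t x / 2 - t y / 2\<bar>" by (rule abs_trig_diff_le)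
    finally show "\<bar>half_cos v x - half_cos v y\<bar> \<le> \<bar>t x - t y\<bar>" unfolding hc by linarith
    have "\<bar>\<bar>sin (t x / 2)\<bar> - \<bar>sin (t y / 2)\<bar>\<bar> \<le> \<bar>sin (t x / 2) - sin (t y / 2)\<bar>" by simp
    also have "\<dots> \<le> \<bar>t x / 2 - t y / 2\<bar>" by (rule abs_trig_diff_le)
    finally show "\<bar>half_sin v x - half_sin v y\<bar> \<le> \<bar>t x - t y\<bar>" unfolding hs by linarith
  qed
  then have "half_angle_energy v \<le> ennreal (L + 1) + ennreal (L + 1)" unfolding half_angle_energy_def by (intro SUP_least)
  also have "\<dots> < \<infinity>" by simp
  finally have D: "half_angle_energy v < \<infinity>" .
  have "L2_norm_sq v \<le> (\<integral>\<^sup>+x. 4 * indicator {0..L} x \<partial>lborel)"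
    unfolding L2_norm_sq_def
  proof (intro nn_integral_mono)
    fix x
    have "(v x)\<^sup>2 \<le> 2\<^sup>2" using v2[of x] by (intro power_mono) auto
    then have "ennreal ((v x)\<^sup>2) \<le> ennreal 4" by (intro ennreal_leI) simp
    then show "ennreal ((norm (v x))\<^sup>2) \<le> 4 * indicator {0..L} x"
      using vz[of x] by (cases "x \<in> {0..L}") auto
  qed
  also have "\<dots> < \<infinity>" using L by (subst nn_integral_cmult_indicator) (auto simp: ennreal_mult_less_top)
  finally have L2: "L2_norm_sq v < \<infinity>" .
  \<comment> \<open>Squared increments of \<open>v\<close> over a distance \<open>d\<close> are
    bounded by \<open>d^2\<close> and by 4, hence by \<open>8 * d^2 / (1 + d^2)\<close>; this leaves
    a kernel that is integrable in each variable.\<close>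
  define K where "K s t = ennreal (8 * (1 / (1\<^sup>2 + (s - t)\<^sup>2)))" for s t :: real
  have [measurable]: "(\<lambda>x. K (a x) (b x)) \<in> borel_measurable M" if [measurable]: "a \<in> borel_measurable M" "b \<in> borel_measurable M" for a b M
    unfolding K_def by measurable
  have KI: "(\<integral>\<^sup>+s. K s t \<partial>lborel) \<le> ennreal 32" for t
  proof -
    have "(\<integral>\<^sup>+s. K s t \<partial>lborel) = ennreal 8 * (\<integral>\<^sup>+s. ennreal (1 / (1\<^sup>2 + (s - t)\<^sup>2)) \<partial>lborel)"
    proof -
      have "K s t = ennreal 8 * ennreal (1 / (1\<^sup>2 + (s - t)\<^sup>2))" for s unfolding K_def by (rule ennreal_mult) auto
      then show ?thesis by (simp only:) (rule nn_integral_cmult, measurable)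
    qed
    also have "\<dots> \<le> ennreal 8 * ennreal (4 / 1)" by (intro mult_left_mono nn_integral_inverse_square_shift) auto
    also have "\<dots> = ennreal 32" by (subst ennreal_mult[symmetric]) auto
    finally show ?thesis .
  qed
  have I32: "(\<integral>\<^sup>+t. indicator {0..L} t * (\<integral>\<^sup>+s. K s t \<partial>lborel) \<partial>lborel) < \<infinity>"
  proof -
    have "(\<integral>\<^sup>+t. indicator {0..L} t * (\<integral>\<^sup>+s. K s t \<partial>lborel) \<partial>lborel) \<le> (\<integral>\<^sup>+t. ennreal 32 * indicator {0..L} t \<partial>lborel)"
      by (intro nn_integral_mono) (use KI in \<open>auto simp: indicator_def\<close>)
    also have "\<dots> < \<infinity>" using L by (subst nn_integral_cmult_indicator) (auto simp: ennreal_mult_less_top)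
    finally show ?thesis .
  qed
  have "gagliardo v \<le> (\<integral>\<^sup>+t. \<integral>\<^sup>+s. indicator {0..L} t * K s t + indicator {0..L} s * K s t \<partial>lborel \<partial>lborel)"
    unfolding gagliardo_def
  proof (intro nn_integral_mono)
    fix s r
    show "ennreal (\<bar>v s - v r\<bar>\<^sup>2 / \<bar>s - r\<bar>\<^sup>2) \<le> indicator {0..L} r * K s r + indicator {0..L} s * K s r"
    proof (cases "s = r \<or> (s \<notin> {0..L} \<and> r \<notin> {0..L})")
      case True then show ?thesis using vz[of s] vz[of r] by auto
    next
      case False
      define d where "d = \<bar>s - r\<bar>"
      have d: "d > 0" using False by (simp add: d_def)
      have "\<bar>v s - v r\<bar> \<le> \<bar>t s - t r\<bar>" using abs_trig_diff_le(2)[of "t r" "t s"] by (simp add: v_def abs_minus_commute)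
      then have 1: "\<bar>v s - v r\<bar> \<le> d" using tl[of s r] by (simp add: d_def)
      have 2: "\<bar>v s - v r\<bar> \<le> 2" using v2[of s] v2[of r] by (simp add: abs_le_iff)
      have e1: "\<bar>v s - v r\<bar>\<^sup>2 \<le> d\<^sup>2" using 1 by (intro power_mono) auto
      have e2: "\<bar>v s - v r\<bar>\<^sup>2 \<le> 2\<^sup>2" using 2 by (intro power_mono) auto
      have "\<bar>v s - v r\<bar>\<^sup>2 * d\<^sup>2 \<le> 2\<^sup>2 * d\<^sup>2" by (intro mult_right_mono e2) auto
      moreover have "\<bar>v s - v r\<bar>\<^sup>2 * (1 + d\<^sup>2) = \<bar>v s - v r\<bar>\<^sup>2 + \<bar>v s - v r\<bar>\<^sup>2 * d\<^sup>2"
        by (simp only: distrib_left mult_1_right)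
      moreover have "(2::real)\<^sup>2 * d\<^sup>2 = 4 * d\<^sup>2" by simp
      ultimately have "\<bar>v s - v r\<bar>\<^sup>2 * (1 + d\<^sup>2) \<le> 8 * d\<^sup>2" using e1 zero_le_power2[of d] by linarith
      moreover have "1 + d\<^sup>2 > 0" by (intro add_pos_nonneg) auto
      ultimately have "\<bar>v s - v r\<bar>\<^sup>2 / d\<^sup>2 \<le> 8 * (1 / (1\<^sup>2 + d\<^sup>2))" using d by (simp add: field_simps)
      then have "ennreal (\<bar>v s - v r\<bar>\<^sup>2 / \<bar>s - r\<bar>\<^sup>2) \<le> K s r" unfolding K_def by (intro ennreal_leI) (simp add: d_def)
      also have "\<dots> \<le> indicator {0..L} r * K s r + indicator {0..L} s * K s r" using False by (auto simp: indicator_def)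
      finally show ?thesis .
    qed
  qed
  also have "\<dots> = (\<integral>\<^sup>+t. \<integral>\<^sup>+s. indicator {0..L} t * K s t \<partial>lborel \<partial>lborel) + (\<integral>\<^sup>+t. \<integral>\<^sup>+s. indicator {0..L} s * K s t \<partial>lborel \<partial>lborel)"
    by (simp add: nn_integral_add)
  also have "(\<integral>\<^sup>+t. \<integral>\<^sup>+s. indicator {0..L} s * K s t \<partial>lborel \<partial>lborel) = (\<integral>\<^sup>+s. \<integral>\<^sup>+t. indicator {0..L} s * K t s \<partial>lborel \<partial>lborel)"
    by (subst lborel_pair.Fubini') (auto simp: K_def power2_commute)
  also have "(\<integral>\<^sup>+t. \<integral>\<^sup>+s. indicator {0..L} t * K s t \<partial>lborel \<partial>lborel) = (\<integral>\<^sup>+t. indicator {0..L} t * (\<integral>\<^sup>+s. K s t \<partial>lborel) \<partial>lborel)"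
    by (intro nn_integral_cong nn_integral_cmult) measurable
  finally have "gagliardo v < \<infinity>" using I32 by (auto intro: le_less_trans)
  then have H: "Hdot_half_sq v < \<infinity>" unfolding Hdot_gagliardo by (simp add: ennreal_mult_less_top)
  have "profile_energy v < \<infinity>" using D L2 H by (simp add: profile_energy_def ennreal_mult_less_top)
  then show ?thesis using that v z by blast
qed

lemma constant_map:
  defines "m \<equiv> \<lambda>_::real. (vector [1, 0] :: real^2)"
  shows "m \<in> A1 0" "E1 m = 0"
proof -
  have m12: "m x $ 1 = 1" "m x $ 2 = 0" for x by (simp_all add: m_def)
  have p: "l2_primitive (\<lambda>x. m x $ i) (\<lambda>_. 0)" for i by (simp add: l2_primitive_def m_def set_lebesgue_integral_def)
  have mc: "continuous_on UNIV m" unfolding m_def by (rule continuous_on_const)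
  have mn: "norm (m x) = 1" for x
  proof -
    have "(norm (m x))\<^sup>2 = 1\<^sup>2" by (simp add: norm_sq_real2 m12)
    then show ?thesis by (rule power2_eq_imp_eq) auto
  qed
  note sob = sobolev_map_of_primitives[OF mc mn p p]
  show E: "E1 m = 0" unfolding E1_def sob(2) by (simp add: m12 Hdot_half_sq_def L2_norm_sq_def)
  have "is_lifting m (\<lambda>_. 0)" by (simp add: is_lifting_def m_def)
  then have "winding_deg m = (0 - 0) / (2 * pi)" by (rule winding_deg_eq) auto
  then show "m \<in> A1 0" using sob(1) E by (simp add: A1_def)
qed

theorem corollary2:
  fixes l :: int
  shows "\<exists>m \<in> A1 l. E1 m = (INF u \<in> A1 l. E1 u)"
proof -
  have "\<exists>m\<in>A1 l. \<forall>m'\<in>A1 l. E1 m \<le> E1 m'"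
  proof (cases "l = 0")
    case True
    show ?thesis unfolding True by (rule bexI[OF _ constant_map(1)]) (simp add: constant_map(2))
  next
    case False
    \<comment> \<open>Degree of modulus \<open>k + 1\<close> forces \<open>k + 1\<close> peaks with
      \<open>k\<close> zeros between them, that is, \<open>2 * k + 1\<close> marked points.\<close>
    define k where "k = nat \<bar>l\<bar> - 1"
    have lk: "l = sgn l * int (k + 1)" and sl: "sgn l = 1 \<or> sgn l = - 1" using False by (auto simp: k_def sgn_if)
    obtain v0 z0 where v0: "profile v0" "alternates v0 (2 * k) z0" "profile_energy v0 < \<infinity>"
      using admissible_profile_exists by blast
    obtain u z where u: "profile u" "alternates u (2 * k) z"
      and min: "\<And>v z'. profile v \<Longrightarrow> alternates v (2 * k) z' \<Longrightarrow> profile_energy u \<le> profile_energy v"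
      using profile_energy_minimiser_exists[OF v0] by blast
    have "profile_energy u < \<infinity>" using min[OF v0(1,2)] v0(3) by (rule le_less_trans)
    then obtain m where m: "m \<in> A1 (sgn l * int (k + 1))" "E1 m \<le> profile_energy u / 2" using realise_profile[OF u(1) _ u(2) sl] by blast
    \<comment> \<open>Realising the minimal profile costs at most half its energy, and the profile
      of any competitor lies above the minimal one; the two bounds meet at
      \<open>E1 m'\<close>.\<close>
    have "E1 m \<le> E1 m'" if m': "m' \<in> A1 l" for m'
    proof -
      have H: "m' \<in> H1_loc_circle" "E1 m' < \<infinity>" using m' by (auto simp: A1_def)
      obtain z' where "alternates (\<lambda>x. 1 - m' x $ 1) (2 * k) z'" using map_alternates[OF m' False] by (auto simp: k_def)
      then have "profile_energy u \<le> 2 * E1 m'" using min profile_of_map[OF H] order_trans by blast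
      then have "profile_energy u / 2 \<le> 2 * E1 m' / 2" by (rule divide_right_mono_ennreal)
      also have "\<dots> = E1 m'" using two_times_half_ennreal[of "E1 m'"] by (simp add: ennreal_times_divide)
      finally show ?thesis using m(2) by (rule order_trans[rotated])
    qed
    then show ?thesis using m(1) lk by metis
  qed
  then obtain m where m: "m \<in> A1 l" "\<And>m'. m' \<in> A1 l \<Longrightarrow> E1 m \<le> E1 m'" by blast
  then have "E1 m = (INF u \<in> A1 l. E1 u)" by (intro antisym INF_greatest INF_lower) auto
  with m(1) show ?thesis by blast
qed

end
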